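(* Let $k\geq 3$ with $k\neq 5$, let $m\geq 10$, and let $n\geq (k-1)a^{(k)}_m+k-1$. Then $$\frac{1}{k-1}\left(n-\left\lfloor\frac{n-k+2}{(k-1)a^{(k)}_m+1}\right\rfloor-k+2\right)\leq \mathrm{sat}_k(n,\text{Berge-}P_m)\leq\left\lceil\frac{1}{k-1}\left(n-\left\lfloor\frac{n}{(k-1)a^{(k)}_m+1}\right\rfloor\right)\right\rceil.$$
   Context: Here $k,m,n$ are integers. Hypergraphs are finite and have no repeated edges; a hypergraph is $k$-uniform if every edge has exactly $k$ vertices. $P_m$ is the graph path on $m$ vertices ($m-1$ edges). For a graph $F$, a hypergraph $B$ is a Berge-$F$ if (with $V(F)$ identified with distinct vertices of $B$) there is a bijection $\phi:E(F)\to E(B)$ with $e\subseteq\phi(e)$ for all $e\in E(F)$. A hypergraph contains a Berge-$F$ if some subhypergraph of it is a Berge-$F$. A $k$-uniform hypergraph $H$ is Berge-$F$-saturated if $H$ contains no Berge-$F$, but for every $k$-subset $e$ of $V(H)$ with $e\notin E(H)$ the hypergraph $H+e$ contains a Berge-$F$. $\mathrm{sat}_k(n,\text{Berge-}F)$ is the minimum number of edges of a $k$-uniform Berge-$F$-saturated hypergraph on $n$ vertices. A linear tree is a connected hypergraph with no Berge cycle of any length $\geq 2$ (in particular two distinct edges share at most one vertex); equivalently, in the $k$-uniform case, a connected hypergraph with $|V|=(k-1)|E|+1$. Define $$a^{(k)}_m=\min\{|E(T)| : T\text{ is a }k\text{-uniform Berge-}P_m\text{-saturated linear tree on at least }k+1\text{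 vertices}\}.$$ *)

theory Defs
  imports Complex_Main
begin

text \<open>A hypergraph is a pair of a vertex set and a set of edges (so there are no repeated edges).\<close>

type_synonym 'a hypergraph = "'a set \<times> 'a set set"

abbreviation verts :: "'a hypergraph \<Rightarrow> 'a set" where
  "verts H \<equiv> fst H"

abbreviation edges :: "'a hypergraph \<Rightarrow> 'a set set" where
  "edges H \<equiv> snd H"

definition hypergraph :: "'a hypergraph \<Rightarrow> bool" where
  "hypergraph H \<longleftrightarrow> finite (verts H) \<and> (\<forall>e\<in>edges H. e \<subseteq> verts H)"

definition uniform :: "nat \<Rightarrow> 'a hypergraph \<Rightarrow> bool" where
  "uniform k H \<longleftrightarrow> hypergraph H \<and> (\<forall>e\<in>edges H. card e = k)"

definition subhypergraph :: "'a hypergraph \<Rightarrow> 'a hypergraph \<Rightarrow> bool" where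
  "subhypergraph B H \<longleftrightarrow> hypergraph B \<and> verts B \<subseteq> verts H \<and> edges B \<subseteq> edges H"

definition add_edge :: "'a hypergraph \<Rightarrow> 'a set \<Rightarrow> 'a hypergraph" where
  "add_edge H e = (verts H, insert e (edges H))"

definition path_graph :: "nat \<Rightarrow> nat hypergraph" where
  "path_graph m = ({..<m}, {{i, Suc i} | i. Suc i < m})"

text \<open>The injection \<open>f\<close> is the identification of the vertices of \<open>F\<close> with distinct vertices of
  \<open>B\<close>. Graphs \<open>F\<close> are represented as 2-uniform hypergraphs.\<close>

definition is_Berge :: "'b hypergraph \<Rightarrow> 'a hypergraph \<Rightarrow> bool" where
  "is_Berge F B \<longleftrightarrow>
    (\<exists>f \<phi>. inj_on f (verts F) \<and> f ` verts F \<subseteq> verts B \<and>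
           bij_betw \<phi> (edges F) (edges B) \<and> (\<forall>e\<in>edges F. f ` e \<subseteq> \<phi> e))"

definition contains_Berge :: "'b hypergraph \<Rightarrow> 'a hypergraph \<Rightarrow> bool" where
  "contains_Berge F H \<longleftrightarrow> (\<exists>B. subhypergraph B H \<and> is_Berge F B)"

definition Berge_saturated :: "nat \<Rightarrow> 'b hypergraph \<Rightarrow> 'a hypergraph \<Rightarrow> bool" where
  "Berge_saturated k F H \<longleftrightarrow>
    uniform k H \<and> \<not> contains_Berge F H \<and>
    (\<forall>e. e \<subseteq> verts H \<and> card e = k \<and> e \<notin> edges H \<longrightarrow> contains_Berge F (add_edge H e))"

text \<open>Every finite hypergraph has an isomorphic copy on natural numbers, so here and in
  \<open>min_sat_tree\<close> the minimum is taken over hypergraphs with vertices in \<open>nat\<close>. On \<open>nat\<close>,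
  \<open>Inf\<close> of a nonempty set is its minimum (and \<open>Inf {} = 0\<close>).\<close>

definition sat :: "nat \<Rightarrow> nat \<Rightarrow> 'b hypergraph \<Rightarrow> nat" where
  "sat k n F = Inf {card (edges H) | H :: nat hypergraph.
                      Berge_saturated k F H \<and> card (verts H) = n}"

definition connected_hypergraph :: "'a hypergraph \<Rightarrow> bool" where
  "connected_hypergraph H \<longleftrightarrow>
    verts H \<noteq> {} \<and>
    (\<forall>u\<in>verts H. \<forall>v\<in>verts H. (u, v) \<in> {(x, y). \<exists>e\<in>edges H. x \<in> e \<and> y \<in> e}\<^sup>*)"

text \<open>A Berge cycle of length \<open>l\<close>: distinct vertices and distinct edges
  $v_0, e_0, v_1, e_1, \ldots, v_{l-1}, e_{l-1}$ with $v_i, v_{i+1} \in e_i$, indices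
  modulo \<open>l\<close>. For \<open>l = 2\<close> this is a pair of edges sharing two vertices.\<close>

definition has_Berge_cycle :: "nat \<Rightarrow> 'a hypergraph \<Rightarrow> bool" where
  "has_Berge_cycle l H \<longleftrightarrow>
    (\<exists>v e. inj_on v {..<l} \<and> v ` {..<l} \<subseteq> verts H \<and>
           inj_on e {..<l} \<and> e ` {..<l} \<subseteq> edges H \<and>
           (\<forall>i<l. v i \<in> e i \<and> v (Suc i mod l) \<in> e i))"

definition linear_tree :: "'a hypergraph \<Rightarrow> bool" where
  "linear_tree T \<longleftrightarrow>
    hypergraph T \<and> connected_hypergraph T \<and> (\<forall>l\<ge>2. \<not> has_Berge_cycle l T)"

definition min_sat_tree :: "nat \<Rightarrow> nat \<Rightarrow> nat" where
  "min_sat_tree k m = Inf {card (edges T) | T :: nat hypergraph.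
     linear_tree T \<and> Berge_saturated k (path_graph m) T \<and> card (verts T) \<ge> k + 1}"

end

theory Submission imports Defs begin

text \<open>
  Write \<open>t = m - 1\<close>, so that the forbidden object is a Berge path with \<open>t\<close> edges, and write
  \<open>a\<close> for \<open>min_sat_tree k m\<close> and \<open>A = (k - 1) * a + 1\<close> for the number of vertices of a minimum
  saturated linear tree.  A connected \<open>k\<close>-uniform hypergraph with \<open>e\<close> edges has at most
  \<open>(k - 1) * e + 1\<close> vertices, with equality exactly for linear trees, so a hypergraph on \<open>n\<close>
  vertices saves edges only through its tree components (lemma \<open>grow_card\<close>).

  Lower bound.  Tree components with at least two edges are themselves saturated, hence have at
  least \<open>A\<close> vertices.  The remaining tree components are isolated vertices and single edges; an
  edge added inside their union lies on paths with at most three edges only, so this union is one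
  edge or consists of at most \<open>k - 1\<close> isolated vertices.  If there are \<open>k - 1\<close> isolated vertices,
  saturation makes every other vertex the start of a path with \<open>t - 1\<close> edges.  In a tree with
  longest path \<open>t - 1\<close> this fails for the second vertex of that path, so there is no large tree
  component.  Counting tree components in these cases gives lemma \<open>lower_bound\<close>.

  Upper bound.  Suppose that a minimum saturated tree \<open>T\<close> has a path with \<open>t - 1\<close> edges.
  From every vertex of a connected hypergraph with such a path there starts a path with at least
  half as many edges, so an edge across two components always completes a path with \<open>t\<close> edges, and
  disjoint unions stay saturated (\<open>union_sat\<close>).  The further vertices are absorbed by one copy of
  \<open>T\<close>.  The key remark (\<open>path_gains_at_end\<close>) is that a vertex \<open>x\<close> starting a path with
  \<open>t - 1\<close> edges takes care of itself: every additional edge through \<open>x\<close> gives a path with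
  \<open>t\<close> edges.  Pendant edges at the end of a longest path only create such vertices
  (\<open>add_pendant\<close>), which absorbs multiples of \<open>k - 1\<close>.  A remainder \<open>i\<close> is absorbed by one edge
  more: near the end of a longest path, some pendant edges are replaced by an edge sharing
  \<open>k - i\<close> vertices with a tree edge, again with all changed vertices starting long paths
  (\<open>sat_tree_absorb\<close>).

  It remains to find a minimum saturated tree with a path of \<open>t - 1\<close> edges (\<open>min_tree\<close>).  If the
  longest path of a saturated tree has \<open>l\<close> edges, consider two consecutive edges \<open>f\<close>, \<open>g\<close> of it,
  with common vertex \<open>c\<close>, and let \<open>d\<close> be the next path vertex.  Adding \<open>(f - {c}) \<union> {d}\<close>
  lengthens the longest path by at most two edges, and by two only if the tree has another branch of
  full height at \<open>g\<close> or, in the middle of the path, at \<open>c\<close> (\<open>swapped_edge_forces_tail\<close>).  Therefore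
  \<open>l\<close> is \<open>t - 1\<close> or \<open>t - 2\<close>, and in the second case the tree has three full binary branches around
  its centre.  An explicit binary tree, thinned out on its
  lowest level, is saturated, has a path of \<open>t - 1\<close> edges and has no more edges than this
  (\<open>ex_bintree_pair\<close>), so the minimum is attained by a tree of the required kind.
\<close>

section \<open>Berge paths\<close>

text \<open>The edge set \<open>A\<close> and the vertex set \<open>V\<close> of the path are carried along as sets: that paths can be
  joined is then a matter of disjointness, and length is cardinality.\<close>
inductive bpath :: "'a set set \<Rightarrow> 'a \<Rightarrow> 'a \<Rightarrow> 'a set set \<Rightarrow> 'a set \<Rightarrow> bool" for E where
  nil: "bpath E u u {} {u}"
| cons: "\<lbrakk>a \<in> E; u \<in> a; v \<in> a; a \<notin> A; u \<notin> V; bpath E v w A V\<rbrakk> \<Longrightarrow> bpath E u w (insert a A) (insert u V)"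

lemma bpath_basic:
  assumes "bpath E u w A V"
  shows "finite A" "finite V" "u \<in> V" "w \<in> V" "A \<subseteq> E" "card V = Suc (card A)"
  using assms by (induction) auto

lemma bpath_restrict: "bpath E u w A V \<Longrightarrow> A \<subseteq> E' \<Longrightarrow> bpath E' u w A V"
  by (induction rule: bpath.induct) (auto intro: bpath.intros)

text \<open>Tails are paths in \<open>E - {a}\<close>; this turns a path that happens to miss \<open>a\<close> into one.\<close>
lemma bpath_avoid: "bpath E u w A V \<Longrightarrow> a \<notin> A \<Longrightarrow> bpath (E - {a}) u w A V"
  by (rule bpath_restrict, assumption) (use bpath_basic(5)[of E u w A V] in blast)

lemma bpath_mono: "bpath E u w A V \<Longrightarrow> E \<subseteq> E' \<Longrightarrow> bpath E' u w A V"
  by (meson bpath_basic(5) bpath_restrict subset_trans)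

lemma bpath_verts: "bpath E u w A V \<Longrightarrow> v \<in> V \<Longrightarrow> v = u \<and> A = {} \<or> (\<exists>a\<in>A. v \<in> a)"
  by (induction rule: bpath.induct) auto

lemma bpath_verts_end: "bpath E u w A V \<Longrightarrow> A \<noteq> {} \<Longrightarrow> v \<in> V \<Longrightarrow> \<exists>a\<in>A. v \<in> a"
  using bpath_verts by fast

lemma bpath_edge_meets: "bpath E u w A V \<Longrightarrow> a \<in> A \<Longrightarrow> \<exists>v\<in>V. v \<in> a"
  by (induction rule: bpath.induct) auto

lemma bpath_loop: "bpath E u u A V \<Longrightarrow> A = {} \<and> V = {u}"
  by (erule bpath.cases) (auto dest: bpath_basic)

lemma bpath_empty: "bpath E u w {} V \<Longrightarrow> w = u \<and> V = {u}"
  by (erule bpath.cases) auto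

lemma bpath_single: "a \<in> E \<Longrightarrow> u \<in> a \<Longrightarrow> v \<in> a \<Longrightarrow> u \<noteq> v \<Longrightarrow> bpath E u v {a} {u, v}"
  using bpath.cons[OF _ _ _ _ _ bpath.nil, of a E u v] by auto

lemma bpath_concat:
  assumes "bpath E u v A V" "bpath E v w B W" "A \<inter> B = {}" "V \<inter> W = {v}"
  shows "bpath E u w (A \<union> B) (V \<union> W)"
  using assms
proof (induction arbitrary: rule: bpath.induct)
  case (nil u) then show ?case using bpath_basic(3)[OF nil(1)] by (simp add: insert_absorb)
next
  case (cons a u v' A V v)
  have vV: "v \<in> V" using cons.hyps bpath_basic by metis
  have "V \<inter> W = {v}" "u \<notin> W" using cons.prems cons.hyps vV by auto
  then have "bpath E v' w (A \<union> B) (V \<union> W)" using cons by auto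
  then have "bpath E u w (insert a (A \<union> B)) (insert u (V \<union> W))"
    using cons.hyps cons.prems \<open>u \<notin> W\<close> by (intro bpath.cons) auto
  then show ?case by simp
qed

lemma bpath_rev: "bpath E u w A V \<Longrightarrow> bpath E w u A V"
proof (induction rule: bpath.induct)
  case (nil u) show ?case by (rule bpath.nil)
next
  case (cons a u v A V w)
  have "v \<in> V" using cons.hyps bpath_basic by metis
  have "bpath E w u (A \<union> {a}) (V \<union> {v,u})"
    using cons \<open>v \<in> V\<close> by (intro bpath_concat[OF cons.IH] bpath_single) auto
  then show ?case using \<open>v \<in> V\<close> by (simp add: insert_absorb insert_commute)
qed

text \<open>Two disjoint paths that start in a common edge \<open>a\<close> merge into one path, run backwards along the
  first, through \<open>a\<close>, and forwards along the second.\<close>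
lemma bpath_join:
  assumes "bpath E p x A V" "bpath E q y B W" "a \<in> E" "p \<in> a" "q \<in> a"
    "a \<notin> A" "a \<notin> B" "A \<inter> B = {}" "V \<inter> W = {}"
  shows "bpath E x y (insert a (A \<union> B)) (V \<union> W)"
proof -
  have pV: "p \<in> V" "p \<notin> W" using assms bpath_basic by (metis, metis disjoint_iff bpath_basic(3))
  have "bpath E p y (insert a B) (insert p W)" using assms pV by (intro bpath.cons) auto
  with bpath_rev[OF assms(1)] have "bpath E x y (A \<union> insert a B) (V \<union> insert p W)"
    using assms pV by (intro bpath_concat) auto
  then show ?thesis using pV by (simp add: insert_absorb)
qed

lemma bpath_join_card:
  assumes "bpath E p x A V" "bpath E q y B W" "a \<in> E" "p \<in> a" "q \<in> a"
    "a \<notin> A" "a \<notin> B" "A \<inter> B = {}" "V \<inter> W = {}"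
  shows "card (insert a (A \<union> B)) = Suc (card A + card B)"
  using assms bpath_basic(1)[OF assms(1)] bpath_basic(1)[OF assms(2)] by (simp add: card_Un_disjoint)

lemma bpath_split_vertex:
  assumes "bpath E u w A V" "y \<in> V"
  shows "\<exists>A1 A2 V1 V2. bpath E u y A1 V1 \<and> bpath E y w A2 V2 \<and> A = A1 \<union> A2 \<and> A1 \<inter> A2 = {} \<and> V = V1 \<union> V2 \<and> V1 \<inter> V2 = {y}"
  using assms
proof (induction rule: bpath.induct)
  case (nil u) then show ?case using bpath.nil[of E u] by auto
next
  case (cons a u v A V w)
  show ?case
  proof (cases "y = u")
    case True
    have "bpath E u w (insert a A) (insert u V)" using cons by (auto intro: bpath.cons)
    then show ?thesis using True bpath.nil[of E u]
      by - (rule exI[of _ "{}"], rule exI[of _ "insert a A"], rule exI[of _ "{u}"], rule exI[of _ "insert u V"], auto)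
  next
    case False
    then obtain A1 A2 V1 V2 where 1: "bpath E v y A1 V1" "bpath E y w A2 V2" "A = A1 \<union> A2" "A1 \<inter> A2 = {}"
      "V = V1 \<union> V2" "V1 \<inter> V2 = {y}" using cons by auto
    have "bpath E u y (insert a A1) (insert u V1)" using 1 cons.hyps by (intro bpath.cons) auto
    then show ?thesis using 1 cons.hyps False
      by - (rule exI[of _ "insert a A1"], rule exI[of _ A2], rule exI[of _ "insert u V1"], rule exI[of _ V2], simp add: insert_commute)
  qed
qed

lemma bpath_split_edge:
  assumes "bpath E u w A V" "a \<in> A"
  shows "\<exists>p q A1 A2 V1 V2. bpath E u p A1 V1 \<and> bpath E q w A2 V2 \<and> p \<in> a \<and> q \<in> a \<and> a \<notin> A1 \<and> a \<notin> A2 \<and>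
    A = insert a (A1 \<union> A2) \<and> A1 \<inter> A2 = {} \<and> V = V1 \<union> V2 \<and> V1 \<inter> V2 = {}"
  using assms
proof (induction rule: bpath.induct)
  case (nil u) then show ?case by auto
next
  case (cons b u v A V w)
  show ?case
  proof (cases "a = b")
    case True
    then show ?thesis using cons bpath.nil[of E u]
      by - (rule exI[of _ u], rule exI[of _ v], rule exI[of _ "{}"], rule exI[of _ A], rule exI[of _ "{u}"], rule exI[of _ V], auto)
  next
    case False
    then have "a \<in> A" using cons.prems by simp
    from cons.IH[OF this] obtain p q A1 A2 V1 V2 where 1: "bpath E v p A1 V1" "bpath E q w A2 V2" "p \<in> a" "q \<in> a" "a \<notin> A1" "a \<notin> A2"
      "A = insert a (A1 \<union> A2)" "A1 \<inter> A2 = {}" "V = V1 \<union> V2" "V1 \<inter> V2 = {}" by blast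
    have "bpath E u p (insert b A1) (insert u V1)" using 1 cons.hyps by (intro bpath.cons) auto
    then show ?thesis using 1 cons.hyps False
      by - (rule exI[of _ p], rule exI[of _ q], rule exI[of _ "insert b A1"], rule exI[of _ A2], rule exI[of _ "insert u V1"], rule exI[of _ V2], simp add: insert_commute)
  qed
qed

text \<open>Used to place a given edge of a longest path at a given distance from its start.\<close>
lemma bpath_split_nth:
  assumes "bpath E u w A V" "i < card A"
  shows "\<exists>a p q A1 A2 V1 V2. bpath E u p A1 V1 \<and> bpath E q w A2 V2 \<and> a \<in> E \<and> p \<in> a \<and> q \<in> a \<and> a \<notin> A1 \<and> a \<notin> A2 \<and>
    A = insert a (A1 \<union> A2) \<and> A1 \<inter> A2 = {} \<and> V = V1 \<union> V2 \<and> V1 \<inter> V2 = {} \<and> card A1 = i"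
  using assms
proof (induction arbitrary: i rule: bpath.induct)
  case (nil u) then show ?case by auto
next
  case (cons b u v A V w)
  show ?case
  proof (cases i)
    case 0
    then show ?thesis using cons bpath.nil[of E u]
      by - (rule exI[of _ b], rule exI[of _ u], rule exI[of _ v], rule exI[of _ "{}"], rule exI[of _ A], rule exI[of _ "{u}"], rule exI[of _ V], auto)
  next
    case (Suc i')
    have "i' < card A" using cons.prems cons.hyps Suc bpath_basic(1)[OF cons.hyps(6)] by simp
    from cons.IH[OF this] obtain a p q A1 A2 V1 V2 where 1: "bpath E v p A1 V1" "bpath E q w A2 V2" "a \<in> E" "p \<in> a" "q \<in> a" "a \<notin> A1" "a \<notin> A2"
      "A = insert a (A1 \<union> A2)" "A1 \<inter> A2 = {}" "V = V1 \<union> V2" "V1 \<inter> V2 = {}" "card A1 = i'" by blast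
    have "bpath E u p (insert b A1) (insert u V1)" using 1 cons.hyps by (intro bpath.cons) auto
    moreover have "card (insert b A1) = i" using 1 Suc cons.hyps bpath_basic(1)[OF 1(1)] by simp
    moreover have "a \<noteq> b" using 1(8) cons.hyps(4) by blast
    ultimately show ?thesis using 1 cons.hyps
      by - (rule exI[of _ a], rule exI[of _ p], rule exI[of _ q], rule exI[of _ "insert b A1"], rule exI[of _ A2], rule exI[of _ "insert u V1"], rule exI[of _ V2], simp add: insert_commute)
  qed
qed

lemma bpath_prefix:
  assumes "bpath E u w A V" "i \<le> card A"
  shows "\<exists>w' A' V'. bpath E u w' A' V' \<and> A' \<subseteq> A \<and> V' \<subseteq> V \<and> card A' = i"
proof (cases "i = card A")
  case True then show ?thesis using assms by blast
next
  case False then have "i < card A" using assms by simp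
  from bpath_split_nth[OF assms(1) this] show ?thesis by blast
qed

lemma bpath_first:
  assumes "bpath E u w A V" "A \<noteq> {}"
  shows "\<exists>a v A' V'. a \<in> E \<and> u \<in> a \<and> v \<in> a \<and> a \<notin> A' \<and> u \<notin> V' \<and> bpath E v w A' V' \<and> A = insert a A' \<and> V = insert u V'"
  using assms by (cases rule: bpath.cases) auto

definition has_path :: "'a set set \<Rightarrow> nat \<Rightarrow> bool" where
  "has_path E n \<longleftrightarrow> (\<exists>u w A V. bpath E u w A V \<and> n \<le> card A)"

lemma has_pathI: "bpath E u w A V \<Longrightarrow> n \<le> card A \<Longrightarrow> has_path E n"
  unfolding has_path_def by blast

lemma has_path_mono: "has_path E n \<Longrightarrow> E \<subseteq> E' \<Longrightarrow> has_path E' n"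
  unfolding has_path_def using bpath_mono by metis

lemma has_path_le: "has_path E n \<Longrightarrow> n' \<le> n \<Longrightarrow> has_path E n'"
  unfolding has_path_def using order_trans by metis

lemma has_path_exact: "has_path E n \<Longrightarrow> \<exists>u w A V. bpath E u w A V \<and> card A = n"
  unfolding has_path_def using bpath_prefix by metis

text \<open>Together with its converse below, the bridge from indexed sequences of vertices and edges to the
  inductive predicate.\<close>
lemma bpath_of_fun:
  assumes "inj_on f {..n}" "inj_on \<epsilon> {..<n}" "\<And>i. i < n \<Longrightarrow> \<epsilon> i \<in> E \<and> f i \<in> \<epsilon> i \<and> f (Suc i) \<in> \<epsilon> i"
  shows "bpath E (f 0) (f n) (\<epsilon> ` {..<n}) (f ` {..n})"
  using assms
proof (induction n)
  case 0 then show ?case using bpath.nil[of E "f 0"] by simp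
next
  case (Suc n)
  have 1: "bpath E (f 0) (f n) (\<epsilon> ` {..<n}) (f ` {..n})"
    by (rule Suc.IH) (use Suc.prems in \<open>simp_all add: lessThan_Suc atMost_Suc\<close>)
  have 2: "bpath E (f n) (f (Suc n)) {\<epsilon> n} {f n, f (Suc n)}"
    using Suc.prems(3)[of n] inj_onD[OF Suc.prems(1), of n "Suc n"] by (intro bpath_single) auto
  have 3: "\<epsilon> n \<notin> \<epsilon> ` {..<n}" using inj_on_image_mem_iff[OF Suc.prems(2), of n "{..<n}"] by auto
  have 4: "f (Suc n) \<notin> f ` {..n}" using inj_on_image_mem_iff[OF Suc.prems(1), of "Suc n" "{..n}"] by auto
  have "f n \<in> f ` {..n}" by simp
  with 4 have 5: "f ` {..n} \<inter> {f n, f (Suc n)} = {f n}" by (simp add: Int_insert_right)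
  have 6: "\<epsilon> ` {..<n} \<inter> {\<epsilon> n} = {}" using 3 by (simp add: Int_insert_right)
  have "bpath E (f 0) (f (Suc n)) (\<epsilon> ` {..<n} \<union> {\<epsilon> n}) (f ` {..n} \<union> {f n, f (Suc n)})"
    by (rule bpath_concat[OF 1 2 6 5])
  moreover have "f ` {..n} \<union> {f n, f (Suc n)} = f ` {..Suc n}" by (auto simp: atMost_Suc)
  moreover have "\<epsilon> ` {..<n} \<union> {\<epsilon> n} = \<epsilon> ` {..<Suc n}" by (auto simp: lessThan_Suc)
  ultimately show ?case by simp
qed

lemma bpath_to_fun:
  assumes "bpath E u w A V"
  shows "\<exists>f \<epsilon>. inj_on f {..card A} \<and> inj_on \<epsilon> {..<card A} \<and> f 0 = u \<and> f (card A) = w \<and> f ` {..card A} = V \<and> \<epsilon> ` {..<card A} = A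
    \<and> (\<forall>i<card A. f i \<in> \<epsilon> i \<and> f (Suc i) \<in> \<epsilon> i)"
  using assms
proof (induction rule: bpath.induct)
  case (nil u) then show ?case by - (rule exI[of _ "\<lambda>_. u"], rule exI[of _ "\<lambda>_. {}"], auto)
next
  case (cons a u v A V w)
  obtain f \<epsilon> where 1: "inj_on f {..card A}" "inj_on \<epsilon> {..<card A}" "f 0 = v" "f (card A) = w" "f ` {..card A} = V" "\<epsilon> ` {..<card A} = A"
    "\<And>i. i < card A \<Longrightarrow> f i \<in> \<epsilon> i \<and> f (Suc i) \<in> \<epsilon> i" using cons.IH by blast
  have c: "card (insert a A) = Suc (card A)" using cons.hyps bpath_basic(1)[OF cons.hyps(6)] by simp
  define f' where "f' = case_nat u f"
  define e' where "e' = case_nat a \<epsilon>"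
  have s1: "{..Suc (card A)} = insert 0 (Suc ` {..card A})" by (simp add: atMost_Suc_eq_insert_0)
  have s2: "{..<Suc (card A)} = insert 0 (Suc ` {..<card A})" by (simp add: lessThan_Suc_eq_insert_0)
  have i1: "f' ` {..Suc (card A)} = insert u V" unfolding s1 image_insert image_image f'_def using 1(5) by simp
  have i2: "e' ` {..<Suc (card A)} = insert a A" unfolding s2 image_insert image_image e'_def using 1(6) by simp
  have j1: "inj_on f' {..Suc (card A)}"
    by (rule eq_card_imp_inj_on) (use i1 cons.hyps bpath_basic[OF cons.hyps(6)] in auto)
  have j2: "inj_on e' {..<Suc (card A)}"
    by (rule eq_card_imp_inj_on) (use i2 c in auto)
  show ?case unfolding c
  proof (rule exI[of _ f'], rule exI[of _ e'], intro conjI allI impI j1 j2 i1 i2)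
    fix i assume "i < Suc (card A)"
    then show "f' i \<in> e' i" "f' (Suc i) \<in> e' i" using 1 cons.hyps by (cases i; auto simp: f'_def e'_def)+
  qed (use 1 in \<open>auto simp: f'_def\<close>)
qed

text \<open>Berge copies of a graph path are exactly Berge paths.  For \<open>n = 0\<close> the single vertex of
  \<open>bpath\<close> need not belong to \<open>V\<close>, hence the restriction.\<close>
lemma contains_path_iff:
  assumes "hypergraph (V, E)" "n \<noteq> 0"
  shows "contains_Berge (path_graph (Suc n)) (V, E) \<longleftrightarrow> has_path E n"
proof
  have inj: "i = j" if "{i, Suc i} = {j, Suc j}" for i j :: nat using that by (auto simp: doubleton_eq_iff)
  {
    assume "contains_Berge (path_graph (Suc n)) (V, E)"
    then obtain B f \<phi> where B: "subhypergraph B (V, E)" "inj_on f {..<Suc n}" "bij_betw \<phi> {{i, Suc i} | i. Suc i < Suc n} (edges B)"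
      "\<forall>e\<in>{{i, Suc i} | i. Suc i < Suc n}. f ` e \<subseteq> \<phi> e"
      unfolding contains_Berge_def is_Berge_def path_graph_def by auto
    define \<epsilon> where "\<epsilon> i = \<phi> {i, Suc i}" for i
    have "bpath E (f 0) (f n) (\<epsilon> ` {..<n}) (f ` {..n})"
    proof (rule bpath_of_fun)
      show "inj_on f {..n}" using B(2) by (simp add: lessThan_Suc_atMost)
      show i2: "inj_on \<epsilon> {..<n}"
      proof (rule inj_onI)
        fix i j assume "i \<in> {..<n}" "j \<in> {..<n}" "\<epsilon> i = \<epsilon> j"
        then have "{i, Suc i} = {j, Suc j}" using B(3) unfolding \<epsilon>_def bij_betw_def
          by (intro inj_onD[of \<phi> "{{i, Suc i} | i. Suc i < Suc n}"]) auto
        then show "i = j" by (rule inj)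
      qed
      fix i assume "i < n"
      then have m: "{i, Suc i} \<in> {{i, Suc i} | i. Suc i < Suc n}" by auto
      have "\<epsilon> i \<in> edges B" unfolding \<epsilon>_def using B(3) m bij_betwE by blast
      moreover have "f ` {i, Suc i} \<subseteq> \<epsilon> i" using B(4) m unfolding \<epsilon>_def by blast
      ultimately show "\<epsilon> i \<in> E \<and> f i \<in> \<epsilon> i \<and> f (Suc i) \<in> \<epsilon> i" using B(1) unfolding subhypergraph_def by auto
    qed
    moreover have "inj_on \<epsilon> {..<n}"
      proof (rule inj_onI)
        fix i j assume "i \<in> {..<n}" "j \<in> {..<n}" "\<epsilon> i = \<epsilon> j"
        then have "{i, Suc i} = {j, Suc j}" using B(3) unfolding \<epsilon>_def bij_betw_def
          by (intro inj_onD[of \<phi> "{{i, Suc i} | i. Suc i < Suc n}"]) auto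
        then show "i = j" by (rule inj)
      qed
    ultimately show "has_path E n" by (auto intro!: has_pathI simp: card_image)
  }
  assume "has_path E n"
  then obtain u w A W where b: "bpath E u w A W" "card A = n" using has_path_exact by blast
  from bpath_to_fun[OF b(1)] obtain f \<epsilon> where 1: "inj_on f {..n}" "inj_on \<epsilon> {..<n}" "f ` {..n} = W" "\<epsilon> ` {..<n} = A"
    "\<And>i. i < n \<Longrightarrow> f i \<in> \<epsilon> i \<and> f (Suc i) \<in> \<epsilon> i" unfolding b(2) by blast
  show "contains_Berge (path_graph (Suc n)) (V, E)"
  proof -
    have AE: "A \<subseteq> E" using bpath_basic(5)[OF b(1)] .
    have WV: "W \<subseteq> V"
    proof
      fix v assume "v \<in> W"
      moreover have "A \<noteq> {}" using assms b by auto
      ultimately obtain a where "a \<in> A" "v \<in> a" using bpath_verts_end[OF b(1)] by blast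
      then show "v \<in> V" using AE assms unfolding hypergraph_def by auto
    qed
    have Sub: "subhypergraph (V, A) (V, E)" using assms AE unfolding subhypergraph_def hypergraph_def by auto
    define \<phi> where "\<phi> e = \<epsilon> (Min e)" for e
    have ph: "\<phi> {i, Suc i} = \<epsilon> i" for i unfolding \<phi>_def by simp
    let ?P = "{{i, Suc i} | i. Suc i < Suc n}"
    have P: "?P = (\<lambda>i. {i, Suc i}) ` {..<n}" by auto
    have "bij_betw \<phi> ?P A"
      unfolding bij_betw_def
    proof
      show "inj_on \<phi> ?P" unfolding P
        by (rule inj_onI) (use 1(2) in \<open>auto simp: ph inj_on_def\<close>)
      show "\<phi> ` ?P = A" unfolding P image_image ph using 1 by simp
    qed
    moreover have "\<forall>e\<in>?P. f ` e \<subseteq> \<phi> e" using 1(5) by (auto simp: ph)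
    moreover have "inj_on f {..<Suc n}" "f ` {..<Suc n} \<subseteq> V" using 1 WV by (auto simp: lessThan_Suc_atMost)
    ultimately have "is_Berge (path_graph (Suc n)) (V, A)"
      unfolding is_Berge_def path_graph_def by auto
    then show ?thesis unfolding contains_Berge_def using Sub by blast
  qed
qed

section \<open>Reachability\<close>

definition reach :: "'a set set \<Rightarrow> 'a \<Rightarrow> 'a \<Rightarrow> bool" where
  "reach E u v \<longleftrightarrow> (\<exists>A V. bpath E u v A V)"

lemma reach_refl [simp]: "reach E u u" unfolding reach_def by (metis bpath.nil)

lemma reach_sym: "reach E u v \<Longrightarrow> reach E v u" unfolding reach_def by (metis bpath_rev)

lemma reach_mono: "reach E u v \<Longrightarrow> E \<subseteq> E' \<Longrightarrow> reach E' u v"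
  unfolding reach_def using bpath_mono by metis

text \<open>The new vertex may already lie on the path, or the new edge may already be used; in both cases
  the path is entered there and its beginning is dropped.\<close>
lemma reach_step:
  assumes "a \<in> E" "x \<in> a" "x' \<in> a" "reach E x' v"
  shows "reach E x v"
proof -
  obtain A V where b: "bpath E x' v A V" using assms unfolding reach_def by blast
  consider "x \<in> V" | "x \<notin> V" "a \<in> A" | "x \<notin> V" "a \<notin> A" by blast
  then show ?thesis
  proof cases
    case 1 then show ?thesis using bpath_split_vertex[OF b 1] unfolding reach_def by blast
  next
    case 2
    from bpath_split_edge[OF b 2(2)] obtain p q A1 A2 V1 V2 where "bpath E q v A2 V2" "q \<in> a" "a \<notin> A2" "V = V1 \<union> V2"
      by blast
    then have "bpath E x v (insert a A2) (insert x V2)" using assms 2 by (intro bpath.cons) auto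
    then show ?thesis unfolding reach_def by blast
  next
    case 3
    then have "bpath E x v (insert a A) (insert x V)" using assms b by (intro bpath.cons) auto
    then show ?thesis unfolding reach_def by blast
  qed
qed

lemma reach_edge: "a \<in> E \<Longrightarrow> x \<in> a \<Longrightarrow> y \<in> a \<Longrightarrow> reach E x y"
  using reach_step reach_refl by metis

lemma bpath_reach_trans: "bpath E u v A V \<Longrightarrow> reach E v w \<Longrightarrow> reach E u w"
  by (induction rule: bpath.induct) (auto intro: reach_step)

lemma reach_trans: "reach E u v \<Longrightarrow> reach E v w \<Longrightarrow> reach E u w"
  unfolding reach_def[of E u v] by (metis bpath_reach_trans)

lemma bpath_reach: "bpath E u w A V \<Longrightarrow> v \<in> V \<Longrightarrow> reach E u v"
  using bpath_split_vertex unfolding reach_def by metis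

lemma bpath_reach_edge: "bpath E u w A V \<Longrightarrow> a \<in> A \<Longrightarrow> v \<in> a \<Longrightarrow> reach E u v"
proof -
  assume b: "bpath E u w A V" "a \<in> A" "v \<in> a"
  then obtain x where "x \<in> V" "x \<in> a" using bpath_edge_meets by metis
  moreover have "a \<in> E" using b bpath_basic(5)[OF b(1)] by auto
  ultimately show ?thesis using bpath_reach[OF b(1)] reach_edge[OF _ _ b(3)] reach_trans by metis
qed

lemma reach_rtrancl: "reach E u v \<longleftrightarrow> (u, v) \<in> {(x, y). \<exists>e\<in>E. x \<in> e \<and> y \<in> e}\<^sup>*"
proof
  assume "reach E u v"
  then obtain A V where "bpath E u v A V" unfolding reach_def by blast
  then show "(u, v) \<in> {(x, y). \<exists>e\<in>E. x \<in> e \<and> y \<in> e}\<^sup>*"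
    by (induction rule: bpath.induct) (auto intro: converse_rtrancl_into_rtrancl)
next
  assume "(u, v) \<in> {(x, y). \<exists>e\<in>E. x \<in> e \<and> y \<in> e}\<^sup>*"
  then show "reach E u v"
    by (induction rule: converse_rtrancl_induct) (auto intro: reach_step)
qed

lemma reach_isolated: "reach E u v \<Longrightarrow> (\<And>a. a \<in> E \<Longrightarrow> u \<notin> a) \<Longrightarrow> v = u"
  unfolding reach_def by (auto elim: bpath.cases)

section \<open>Acyclic hypergraphs\<close>

text \<open>Deleting an edge separates its vertices from each other.  For connected hypergraphs this is the
  defining property of a linear tree in the form in which it is applied: paths that avoid \<open>g\<close> and
  start in different vertices of \<open>g\<close> live in different components.\<close>
definition bacyclic :: "'a set set \<Rightarrow> bool" where
  "bacyclic E \<longleftrightarrow> (\<forall>g\<in>E. \<forall>c\<in>g. \<forall>y\<in>g. reach (E - {g}) c y \<longrightarrow> c = y)"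

lemma bacyclicD: "bacyclic E \<Longrightarrow> g \<in> E \<Longrightarrow> c \<in> g \<Longrightarrow> y \<in> g \<Longrightarrow> reach (E - {g}) c y \<Longrightarrow> c = y"
  unfolding bacyclic_def by blast

lemma bacyclic_sub: "bacyclic E \<Longrightarrow> E' \<subseteq> E \<Longrightarrow> bacyclic E'"
  unfolding bacyclic_def by (meson Diff_mono order_refl reach_mono subsetD)

text \<open>A common vertex, or any vertex of a common edge, would connect \<open>c\<close> and \<open>y\<close> without \<open>g\<close>.\<close>
lemma bacyclic_disjoint:
  assumes "bacyclic E" "g \<in> E" "c \<in> g" "y \<in> g" "c \<noteq> y" "bpath (E - {g}) c x A V" "bpath (E - {g}) y x' A' V'"
  shows "V \<inter> V' = {}" "A \<inter> A' = {}"
proof -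
  have no: "\<not> reach (E - {g}) c y" using bacyclicD assms by metis
  show "V \<inter> V' = {}"
  proof (rule ccontr)
    assume "V \<inter> V' \<noteq> {}"
    then obtain z where "z \<in> V" "z \<in> V'" by blast
    then show False using no bpath_reach[OF assms(6)] bpath_reach[OF assms(7)] reach_sym reach_trans by metis
  qed
  show "A \<inter> A' = {}"
  proof (rule ccontr)
    assume "A \<inter> A' \<noteq> {}"
    then obtain h where h: "h \<in> A" "h \<in> A'" by blast
    obtain z where "z \<in> h" using bpath_edge_meets[OF assms(6) h(1)] by blast
    then show False using no bpath_reach_edge[OF assms(6) h(1)] bpath_reach_edge[OF assms(7) h(2)] reach_sym reach_trans by metis
  qed
qed

lemma bacyclic_inter_edges: "bacyclic E \<Longrightarrow> g \<in> E \<Longrightarrow> h \<in> E \<Longrightarrow> g \<noteq> h \<Longrightarrow> x \<in> g \<Longrightarrow> x \<in> h \<Longrightarrow> y \<in> g \<Longrightarrow> y \<in> h \<Longrightarrow> x = y"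
  using bacyclicD[of E g x y] reach_edge[of h "E - {g}" x y] by blast

lemma bacyclic_tail_edge: "bacyclic E \<Longrightarrow> g \<in> E \<Longrightarrow> c \<in> g \<Longrightarrow> bpath (E - {g}) c x A V \<Longrightarrow> V \<inter> g = {c}"
  using bacyclicD[of E g c] bpath_reach[of "E - {g}" c x A V] bpath_basic(3)[of "E - {g}" c x A V] by blast

lemma bacyclic_tail_no_edge:
  assumes "bacyclic E" "g \<in> E" "d \<in> g" "bpath (E - {g}) d x A V" "c \<in> g" "c \<noteq> d" "c \<in> f"
  shows "f \<notin> A"
  using bpath_reach_edge[OF assms(4) _ assms(7)] bacyclicD[OF assms(1-3,5)] assms(6) by blast

text \<open>In an acyclic hypergraph a tail at \<open>d\<close> that avoids \<open>g\<close> can always be prolonged backwards over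
  \<open>g\<close>, and the result avoids every other edge at the new start.\<close>
lemma bacyclic_extend:
  assumes "bacyclic E" "g \<in> E" "d \<in> g" "bpath (E - {g}) d x A V" "c \<in> g" "c \<noteq> d"
  shows "bpath E c x (insert g A) (insert c V)" "card (insert g A) = Suc (card A)"
    "f \<noteq> g \<Longrightarrow> c \<in> f \<Longrightarrow> bpath (E - {f}) c x (insert g A) (insert c V)"
proof -
  have A: "g \<notin> A" "A \<subseteq> E" using bpath_basic(5)[OF assms(4)] by auto
  have c: "c \<notin> V" using bacyclic_tail_edge[OF assms(1,2,3,4)] assms by blast
  show 1: "bpath E c x (insert g A) (insert c V)"
    using assms A c bpath_mono[OF assms(4)] by (intro bpath.cons) auto
  show "card (insert g A) = Suc (card A)" using A bpath_basic(1)[OF assms(4)] by simp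
  assume "f \<noteq> g" "c \<in> f"
  moreover have "f \<notin> A" using bacyclic_tail_no_edge assms \<open>c \<in> f\<close> by metis
  ultimately show "bpath (E - {f}) c x (insert g A) (insert c V)"
    using A assms by (intro bpath_restrict[OF 1]) auto
qed

text \<open>Any two tails at distinct vertices of \<open>g\<close> that avoid \<open>g\<close> combine to a path; all length
  estimates in trees come from this.\<close>
lemma bacyclic_join:
  assumes "bacyclic E" "g \<in> E" "p \<in> g" "q \<in> g" "p \<noteq> q" "bpath (E - {g}) p x A V" "bpath (E - {g}) q y B W"
  shows "bpath E x y (insert g (A \<union> B)) (V \<union> W)" "card (insert g (A \<union> B)) = Suc (card A + card B)"
proof -
  have A: "g \<notin> A" "g \<notin> B" using bpath_basic(5)[OF assms(6)] bpath_basic(5)[OF assms(7)] by auto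
  note d = bacyclic_disjoint[OF assms(1-7)]
  have b: "bpath E p x A V" "bpath E q y B W" using assms(6,7) bpath_mono by (metis Diff_subset)+
  show "bpath E x y (insert g (A \<union> B)) (V \<union> W)" using bpath_join[OF b assms(2-4) A d(2,1)] .
  show "card (insert g (A \<union> B)) = Suc (card A + card B)" using bpath_join_card[OF b assms(2-4) A d(2,1)] .
qed

text \<open>A third vertex of \<open>a\<close> on the path would be connected to one of the two transit vertices of
  \<open>a\<close> by a piece of the path that avoids \<open>a\<close>.\<close>
lemma bacyclic_path_thick:
  assumes "bacyclic E" "bpath E u w A V" "a \<in> A" "card a \<ge> 3"
  shows "\<exists>z\<in>a. z \<notin> V"
proof -
  from bpath_split_edge[OF assms(2,3)] obtain p q A1 A2 V1 V2 where
    1: "bpath E u p A1 V1" "bpath E q w A2 V2" "p \<in> a" "q \<in> a" "a \<notin> A1" "a \<notin> A2" "V = V1 \<union> V2" by blast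
  have aE: "a \<in> E" using assms bpath_basic(5)[OF assms(2)] by auto
  have "bpath (E - {a}) p u A1 V1" "bpath (E - {a}) q w A2 V2"
    using bpath_avoid[OF bpath_rev[OF 1(1)] 1(5)] bpath_avoid[OF 1(2) 1(6)] .
  from bacyclic_tail_edge[OF assms(1) aE 1(3) this(1)] bacyclic_tail_edge[OF assms(1) aE 1(4) this(2)]
  have sub: "a \<inter> V \<subseteq> {p, q}" using 1(7) by blast
  have "\<not> a \<subseteq> {p, q}"
  proof
    assume "a \<subseteq> {p, q}"
    then have "card a \<le> card {p,q}" by (intro card_mono) auto
    also have "\<dots> \<le> 2" by (simp add: card_insert_if)
    finally show False using assms by simp
  qed
  then show ?thesis using sub by blast
qed

section \<open>Acyclicity and Berge cycles\<close>

text \<open>Going around a cycle the long way connects two vertices of its last edge.\<close>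
lemma bacyclic_no_cycle:
  assumes "bacyclic E" "l \<ge> 2"
  shows "\<not> has_Berge_cycle l (V, E)"
proof
  assume "has_Berge_cycle l (V, E)"
  then obtain v e where 1: "inj_on v {..<l}" "inj_on e {..<l}" "e ` {..<l} \<subseteq> E" "\<And>i. i < l \<Longrightarrow> v i \<in> e i \<and> v (Suc i mod l) \<in> e i"
    unfolding has_Berge_cycle_def by auto
  define g where "g = e (l - 1)"
  have g: "g \<in> E" "v (l - 1) \<in> g" "v 0 \<in> g" using 1(3) 1(4)[of "l - 1"] assms unfolding g_def by (auto simp: image_subset_iff)
  have "reach (E - {g}) (v 0) (v i)" if "i \<le> l - 1" for i
    using that
  proof (induction i)
    case (Suc i)
    have "e i \<noteq> g" unfolding g_def using Suc inj_onD[OF 1(2), of i "l - 1"] by fastforce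
    then have "e i \<in> E - {g}" using 1(3) Suc by (auto simp: image_subset_iff)
    moreover have "v i \<in> e i" "v (Suc i) \<in> e i" using 1(4)[of i] Suc by auto
    ultimately have "reach (E - {g}) (v i) (v (Suc i))" by (intro reach_edge)
    then show ?case using Suc reach_trans by (metis Suc_leD)
  qed simp
  then have "v 0 = v (l - 1)" using bacyclicD[OF assms(1) g(1,3,2)] by blast
  then show False using inj_onD[OF 1(1), of 0 "l - 1"] assms by auto
qed

text \<open>A path that joins two vertices of \<open>g\<close> and avoids \<open>g\<close> closes up with \<open>g\<close> to a cycle.\<close>
lemma no_cycle_bacyclic:
  assumes "\<And>e. e \<in> E \<Longrightarrow> e \<subseteq> V" "\<And>l. l \<ge> 2 \<Longrightarrow> \<not> has_Berge_cycle l (V, E)"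
  shows "bacyclic E"
  unfolding bacyclic_def
proof (intro ballI impI, rule ccontr)
  fix g c y assume g: "g \<in> E" "c \<in> g" "y \<in> g" "reach (E - {g}) c y" "c \<noteq> y"
  then obtain A W where b: "bpath (E - {g}) c y A W" unfolding reach_def by blast
  let ?n = "card A"
  from bpath_to_fun[OF b] obtain f \<epsilon> where 1: "inj_on f {..?n}" "inj_on \<epsilon> {..<?n}" "f 0 = c" "f ?n = y" "f ` {..?n} = W" "\<epsilon> ` {..<?n} = A"
    "\<And>i. i < ?n \<Longrightarrow> f i \<in> \<epsilon> i \<and> f (Suc i) \<in> \<epsilon> i" by blast
  have AE: "A \<subseteq> E - {g}" using bpath_basic(5)[OF b] .
  have n0: "?n \<ge> 1" using 1(3,4) g(5) by (cases ?n) auto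
  define e where "e i = (if i < ?n then \<epsilon> i else g)" for i
  have "has_Berge_cycle (Suc ?n) (V, E)"
    unfolding has_Berge_cycle_def
  proof (rule exI[of _ f], rule exI[of _ e], intro conjI allI impI)
    show "inj_on f {..<Suc ?n}" using 1(1) by (simp add: lessThan_Suc_atMost)
    have im: "e ` {..<Suc ?n} = insert g A" unfolding lessThan_Suc e_def using 1(6) by auto
    show "inj_on e {..<Suc ?n}"
      by (rule eq_card_imp_inj_on) (use im AE bpath_basic(1)[OF b] in \<open>auto simp: card_insert_if\<close>)
    show "e ` {..<Suc ?n} \<subseteq> edges (V, E)" unfolding im using AE g by auto
    have "W \<subseteq> V"
      using bpath_verts_end[OF b] n0 AE assms(1) by fastforce
    then show "f ` {..<Suc ?n} \<subseteq> verts (V, E)" using 1(5) by (simp add: lessThan_Suc_atMost)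
    fix i assume i: "i < Suc ?n"
    show "f i \<in> e i" using i 1(4,7) g unfolding e_def by (auto simp: less_Suc_eq)
    show "f (Suc i mod Suc ?n) \<in> e i"
    proof (cases "i < ?n")
      case True then show ?thesis using 1(7) unfolding e_def by auto
    next
      case False then have "i = ?n" using i by simp
      then show ?thesis using 1(3) g unfolding e_def by simp
    qed
  qed
  then show False using assms(2)[of "Suc ?n"] n0 by simp
qed

section \<open>Vertices and edges of connected hypergraphs\<close>

text \<open>Every connected hypergraph arises from a vertex by repeatedly adding an edge that meets the vertices
  reached so far; a new edge contributes at most \<open>k - 1\<close> new vertices.\<close>
inductive grow :: "'a \<Rightarrow> 'a set \<Rightarrow> 'a set set \<Rightarrow> bool" for v where
  start: "grow v {v} {}"
| add: "grow v V E \<Longrightarrow> h \<notin> E \<Longrightarrow> h \<inter> V \<noteq> {} \<Longrightarrow> grow v (V \<union> h) (insert h E)"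

lemma grow_basic: "grow v V E \<Longrightarrow> v \<in> V \<and> finite E \<and> (\<forall>e\<in>E. e \<subseteq> V)"
  by (induction rule: grow.induct) auto

text \<open>A maximal edge set that can be grown from \<open>v\<close> is everything: no edge outside it meets its vertices.\<close>
lemma connected_grow:
  assumes fin: "finite E" and sub: "\<And>e. e \<in> E \<Longrightarrow> e \<subseteq> V" and v: "v \<in> V" and con: "\<And>u. u \<in> V \<Longrightarrow> reach E v u"
    and ne: "{} \<notin> E"
  shows "grow v V E"
proof -
  define M where "M = {E'. E' \<subseteq> E \<and> (\<exists>V'. grow v V' E')}"
  have finM: "finite M" unfolding M_def using fin by auto
  have "{} \<in> M" unfolding M_def using grow.start[of v] by blast
  then obtain E' where E': "E' \<in> M" "\<And>F. F \<in> M \<Longrightarrow> E' \<subseteq> F \<Longrightarrow> F = E'"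
    using finite_has_maximal[OF finM] by blast
  then obtain V' where g: "grow v V' E'" "E' \<subseteq> E" unfolding M_def by auto
  note gb = grow_basic[OF g(1)]
  have step: "h \<in> E'" if "h \<in> E" "h \<inter> V' \<noteq> {}" for h
  proof (rule ccontr)
    assume "h \<notin> E'"
    then have "insert h E' \<in> M" using grow.add[OF g(1) _ that(2)] that g unfolding M_def by auto
    then show False using E'(2)[of "insert h E'"] \<open>h \<notin> E'\<close> by blast
  qed
  have sV: "x \<in> V'" if "bpath E u x A W" "u \<in> V'" for u x A W
    using that
  proof (induction rule: bpath.induct)
    case (cons a u v' A W w)
    have "a \<in> E'" using step[of a] cons by blast
    then show ?case using cons gb by blast
  qed simp
  have "V \<subseteq> V'" using con sV gb unfolding reach_def by blast
  moreover have "E \<subseteq> E'"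
  proof
    fix h assume h: "h \<in> E"
    then obtain x where "x \<in> h" using ne by (metis equals0I)
    then show "h \<in> E'" using step[OF h] sub[OF h] \<open>V \<subseteq> V'\<close> by blast
  qed
  moreover have "V' \<subseteq> V"
  proof -
    have "V'' \<subseteq> V" if "grow v V'' E''" "E'' \<subseteq> E" for V'' E''
      using that
    proof (induction rule: grow.induct)
      case (add V E h) then show ?case using sub by blast
    qed (use v in simp)
    then show ?thesis using g by blast
  qed
  ultimately show ?thesis using g by (metis subset_antisym)
qed

text \<open>An edge attached at a single vertex cannot be an inner edge of a path between old vertices.\<close>
lemma grow_bacyclic_step:
  assumes g: "grow v V E" and s: "bacyclic E" and h: "h \<inter> V = {x}"
  shows "bacyclic (insert h E)"
  unfolding bacyclic_def
proof (intro ballI impI)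
  have hE: "e \<subseteq> V" if "e \<in> E" for e using grow_basic[OF g] that by blast
  fix a c y assume a: "a \<in> insert h E" "c \<in> a" "y \<in> a" "reach (insert h E - {a}) c y"
  show "c = y"
  proof (cases "a = h")
    case True
    then have r: "reach E c y" using a(4) by (auto intro: reach_mono)
    show ?thesis
    proof (cases "c = x \<and> y = x")
      case False
      then consider "c \<notin> V" | "y \<notin> V" using a True h by blast
      then show ?thesis
      proof cases
        case 1 then show ?thesis using reach_isolated[OF r] hE by blast
      next
        case 2 then show ?thesis using reach_isolated[OF reach_sym[OF r]] hE by blast
      qed
    qed simp
  next
    case False
    then have aE: "a \<in> E" using a by blast
    obtain A W where b: "bpath (insert h E - {a}) c y A W" using a unfolding reach_def by blast
    show ?thesis
    proof (cases "h \<in> A")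
      case False
      then have "bpath (E - {a}) c y A W" using bpath_basic(5)[OF b] by (intro bpath_restrict[OF b]) auto
      then show ?thesis using bacyclicD[OF s aE a(2,3)] unfolding reach_def by blast
    next
      case True
      from bpath_split_edge[OF b True] obtain p q A1 A2 V1 V2 where
        1: "bpath (insert h E - {a}) c p A1 V1" "bpath (insert h E - {a}) q y A2 V2" "p \<in> h" "q \<in> h" "h \<notin> A1" "h \<notin> A2" "V1 \<inter> V2 = {}"
        by blast
      have "p \<in> V"
      proof (cases "A1 = {}")
        case True then show ?thesis using bpath_empty[of "insert h E - {a}" c p V1] 1(1) hE[OF aE] a(2) by auto
      next
        case False
        from bpath_verts_end[OF 1(1) False bpath_basic(4)[OF 1(1)]] obtain b where "b \<in> A1" "p \<in> b" by blast
        moreover have "b \<in> E" using \<open>b \<in> A1\<close> bpath_basic(5)[OF 1(1)] 1(5) by blast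
        ultimately show ?thesis using hE by blast
      qed
      moreover have "q \<in> V"
      proof (cases "A2 = {}")
        case True then show ?thesis using bpath_empty[of "insert h E - {a}" q y V2] 1(2) hE[OF aE] a(3) by auto
      next
        case False
        from bpath_verts_end[OF 1(2) False bpath_basic(3)[OF 1(2)]] obtain b where "b \<in> A2" "q \<in> b" by blast
        moreover have "b \<in> E" using \<open>b \<in> A2\<close> bpath_basic(5)[OF 1(2)] 1(6) by blast
        ultimately show ?thesis using hE by blast
      qed
      ultimately have "p \<in> {x}" "q \<in> {x}" using 1(3,4) unfolding h[symmetric] by simp_all
      then have "p = q" by simp
      then show ?thesis using 1 bpath_basic(4)[OF 1(1)] bpath_basic(3)[OF 1(2)] by blast
    qed
  qed
qed

lemma grow_reach: "grow v V E \<Longrightarrow> x \<in> V \<Longrightarrow> reach E v x"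
proof (induction arbitrary: x rule: grow.induct)
  case start then show ?case by simp
next
  case (add V E h)
  have m: "reach (insert h E) v y" if "y \<in> V" for y using add.IH[OF that] reach_mono by (metis subset_insertI)
  obtain y where "y \<in> h" "y \<in> V" using add.hyps by blast
  then show ?case using m[of y] m[of x] add.prems reach_edge[of h "insert h E" y x] reach_trans by (metis UnE insertI1)
qed

text \<open>Equality means that each edge was attached at exactly one vertex, which is acyclicity: two
  attachment vertices would be connected without the new edge.\<close>
lemma grow_card:
  assumes "grow v V E" "\<And>e. e \<in> E \<Longrightarrow> card e = k" "k \<ge> 1"
  shows "finite V \<and> card V \<le> (k - 1) * card E + 1 \<and> (card V = (k - 1) * card E + 1 \<longleftrightarrow> bacyclic E)"
  using assms(1,2)
proof (induction rule: grow.induct)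
  case start show ?case by (simp add: bacyclic_def)
next
  case (add V E h)
  have IH: "finite V" "card V \<le> (k - 1) * card E + 1" "card V = (k - 1) * card E + 1 \<longleftrightarrow> bacyclic E" using add by auto
  have fh: "finite h" "card h = k" using add.prems[of h] assms(3) card.infinite by fastforce+
  have cE: "card (insert h E) = Suc (card E)" using add.hyps grow_basic[OF add.hyps(1)] by simp
  have cU: "card (V \<union> h) + card (h \<inter> V) = card V + k" using card_Un_Int[OF IH(1) fh(1)] fh by (simp add: Int_commute)
  have c1: "card (h \<inter> V) \<ge> 1" using add.hyps fh by (simp add: Suc_le_eq card_gt_0_iff)
  have mul: "(k - 1) * Suc (card E) = (k - 1) * card E + (k - 1)" by simp
  have le: "card (V \<union> h) \<le> (k - 1) * card (insert h E) + 1" unfolding cE mul using cU c1 IH(2) assms(3) by linarith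
  have eq: "card (V \<union> h) = (k - 1) * card (insert h E) + 1 \<longleftrightarrow> card V = (k - 1) * card E + 1 \<and> card (h \<inter> V) = 1"
    unfolding cE mul using cU c1 IH(2) assms(3) by linarith
  also have "\<dots> \<longleftrightarrow> bacyclic (insert h E)"
  proof
    assume "card V = (k - 1) * card E + 1 \<and> card (h \<inter> V) = 1"
    then show "bacyclic (insert h E)" using IH(3) grow_bacyclic_step[OF add.hyps(1)] by (auto simp: card_1_singleton_iff)
  next
    assume s: "bacyclic (insert h E)"
    have "x = y" if "x \<in> h \<inter> V" "y \<in> h \<inter> V" for x y
    proof -
      have "reach E x y" using grow_reach[OF add.hyps(1)] that reach_sym reach_trans by (metis IntD2)
      moreover have "insert h E - {h} = E" using add.hyps by blast
      ultimately show ?thesis using bacyclicD[OF s, of h x y] that by auto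
    qed
    then have "card (h \<inter> V) \<le> 1" using fh by (simp add: card_le_Suc0_iff_eq)
    then show "card V = (k - 1) * card E + 1 \<and> card (h \<inter> V) = 1"
      using c1 IH(3) bacyclic_sub[OF s] by auto
  qed
  finally show ?case using le IH(1) fh by simp
qed

section \<open>An exchanged edge on a longest path of a tree\<close>

text \<open>A path starting in a vertex of \<open>f\<close> can use \<open>f\<close> only as its first edge, because the piece before
  \<open>f\<close> would connect two vertices of \<open>f\<close>.\<close>
lemma bacyclic_first_edge:
  assumes "bacyclic E" "f \<in> E" "u \<in> f" "bpath E u x A V" "f \<in> A"
  obtains s A2 V2 where "s \<in> f" "s \<noteq> u" "bpath (E - {f}) s x A2 V2" "A = insert f A2" "V = insert u V2" "f \<notin> A2"
    "card A = Suc (card A2)"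
proof -
  from bpath_split_edge[OF assms(4,5)] obtain p q A1 A2 V1 V2 where
    1: "bpath E u p A1 V1" "bpath E q x A2 V2" "p \<in> f" "q \<in> f" "f \<notin> A1" "f \<notin> A2"
    "A = insert f (A1 \<union> A2)" "A1 \<inter> A2 = {}" "V = V1 \<union> V2" "V1 \<inter> V2 = {}" by blast
  have "reach (E - {f}) u p" using bpath_avoid[OF 1(1,5)] unfolding reach_def by blast
  then have "u = p" using bacyclicD[OF assms(1-3) 1(3)] by blast
  then have A1: "A1 = {}" "V1 = {u}" using bpath_loop 1(1) by metis+
  have "finite A2" using bpath_basic(1)[OF 1(2)] .
  with 1 A1 bpath_basic(3)[OF 1(2)] show ?thesis
    by (intro that[of q A2 V2] bpath_avoid) auto
qed

text \<open>A longest path of a tree is cut at two consecutive edges: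
  \<open>xl \<dots> p f c g d \<dots> xr\<close>, with \<open>j\<close> edges up to and including \<open>f\<close> on the left of \<open>c\<close> and
  \<open>l - 1 - j\<close> edges on the right of \<open>d\<close>; the assumption on \<open>j\<close> says that the left part is the
  shorter one.\<close>
locale swap_config =
  fixes E :: "'a set set" and l j :: nat and c d p xl xr :: 'a and g f AL AR :: "_" and VL VR :: "'a set"
  assumes tree: "bacyclic E" and longest: "\<not> has_path E (Suc l)"
    and g: "g \<in> E" "c \<in> g" "d \<in> g" "c \<noteq> d"
    and f: "f \<in> E" "f \<noteq> g" "c \<in> f" "p \<in> f" "p \<noteq> c"
    and L: "bpath (E - {f}) p xl AL VL" "Suc (card AL) = j"
    and R: "bpath (E - {g}) d xr AR VR" "card AR + j + 1 = l"
    and jl: "2 * j \<le> l"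
begin

lemma path_le_longest: "bpath E u w A V \<Longrightarrow> card A \<le> l"
  using longest has_pathI[of E u w A V "Suc l"] by (meson not_less_eq_eq)

lemma left_tail: "bpath (E - {g}) c xl (insert f AL) (insert c VL)" "card (insert f AL) = j"
  using bacyclic_extend(2,3)[OF tree f(1,4) L(1) f(3)] f g L by auto

text \<open>The following bounds compare a tail with the piece of the longest path that it could replace.\<close>
lemma tail_at_g_le_left: "y \<in> g \<Longrightarrow> y \<noteq> d \<Longrightarrow> bpath (E - {g}) y x A V \<Longrightarrow> card A \<le> j"
  using bacyclic_join[OF tree g(1) _ g(3) _ _ R(1), of y x A V] path_le_longest R(2) by fastforce

lemma tail_at_g_le_right: "y \<in> g \<Longrightarrow> y \<noteq> c \<Longrightarrow> bpath (E - {g}) y x A V \<Longrightarrow> card A + j + 1 \<le> l"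
  using bacyclic_join[OF tree g(1) _ g(2) _ _ left_tail(1), of y x A V] path_le_longest left_tail(2) by fastforce

lemma tail_at_f_le:
  assumes "s \<in> f" "s \<noteq> c" "bpath (E - {f}) s x A V"
  shows "card A + 1 \<le> j"
proof -
  note e = bacyclic_extend(2,3)[OF tree f(1) assms(1,3) f(3) assms(2)[symmetric]]
  from tail_at_g_le_left[OF g(2,4) e(2)[OF f(2)[symmetric] g(2)]] e(1) show ?thesis by simp
qed

lemma tail_at_c_le: "bpath (E - {f, g}) c x A V \<Longrightarrow> card A \<le> j"
  by (rule tail_at_g_le_left[OF g(2,4)], erule bpath_mono) blast

text \<open>The two ways in which the tree can branch off the longest path: at \<open>c\<close>, or at a further vertex of
  \<open>g\<close>.\<close>
definition ctail :: "nat \<Rightarrow> bool" where "ctail n \<longleftrightarrow> (\<exists>x A V. bpath (E - {f, g}) c x A V \<and> n \<le> card A)"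
definition ytail :: "nat \<Rightarrow> bool" where "ytail n \<longleftrightarrow> (\<exists>y\<in>g - {c, d}. \<exists>x A V. bpath (E - {g}) y x A V \<and> n \<le> card A)"

lemma ctail_le: "ctail n \<Longrightarrow> n \<le> j"
  unfolding ctail_def by (elim exE conjE, drule tail_at_c_le) simp

lemma ytail_le:
  assumes "ytail n"
  shows "n \<le> j \<and> n + j + 1 \<le> l"
proof -
  obtain y x A V where y: "y \<in> g" "y \<noteq> c" "y \<noteq> d" "bpath (E - {g}) y x A V" "n \<le> card A"
    using assms unfolding ytail_def by auto
  from tail_at_g_le_left[OF y(1,3,4)] tail_at_g_le_right[OF y(1,2,4)] y(5) show ?thesis by simp
qed

text \<open>Classification by the edges \<open>f\<close> and \<open>g\<close>, which the path can use only at its very beginning: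
  it avoids \<open>f\<close>, or leaves \<open>f\<close> by another vertex than \<open>c\<close>, or goes through \<open>f\<close> and \<open>c\<close>, or
  through \<open>f\<close>, \<open>c\<close> and \<open>g\<close>.\<close>
lemma path_from_f:
  assumes "bpath E u x A V" "u \<in> f" "u \<noteq> c"
  shows "f \<notin> A \<and> card A + 1 \<le> j \<or> f \<in> A \<and> card A \<le> j \<or> (f \<in> A \<and> c \<in> V \<and> card A \<ge> 1 \<and> ctail (card A - 1)) \<or>
    (f \<in> A \<and> g \<in> A \<and> card A \<ge> 2 \<and> (\<exists>y\<in>g - {c}. \<exists>x A' V'. y \<in> V \<and> bpath (E - {g}) y x A' V' \<and> card A = card A' + 2))"
proof (cases "f \<in> A")
  case False
  then show ?thesis using tail_at_f_le[OF assms(2,3) bpath_avoid[OF assms(1)]] by simp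
next
  case True
  from bacyclic_first_edge[OF tree f(1) assms(2,1) True] obtain s A2 V2 where
    s: "s \<in> f" "s \<noteq> u" "bpath (E - {f}) s x A2 V2" "A = insert f A2" "V = insert u V2" "f \<notin> A2" "card A = Suc (card A2)" .
  show ?thesis
  proof (cases "s = c")
    case False
    then show ?thesis using tail_at_f_le[OF s(1) _ s(3)] s True by simp
  next
    case sc: True
    show ?thesis
    proof (cases "g \<in> A2")
      case False
      have "bpath (E - {f, g}) c x A2 V2" using bpath_avoid[OF s(3) False] sc by (simp add: Diff_insert2[symmetric] insert_commute)
      then have "ctail (card A2)" unfolding ctail_def by blast
      moreover have "c \<in> V" using s bpath_basic(3)[OF s(3)] sc by auto
      ultimately show ?thesis using s True by simp
    next
      case gA: True
      have "bacyclic (E - {f})" "g \<in> E - {f}" "s \<in> g" using tree bacyclic_sub f g sc by blast+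
      from bacyclic_first_edge[OF this s(3) gA] obtain y A3 V3 where
        y: "y \<in> g" "y \<noteq> s" "bpath (E - {f} - {g}) y x A3 V3" "V2 = insert s V3" "card A2 = Suc (card A3)" by metis
      have "bpath (E - {g}) y x A3 V3" by (rule bpath_mono[OF y(3)]) blast
      moreover have "y \<in> V" using y bpath_basic(3)[OF y(3)] s by auto
      ultimately show ?thesis using y s sc True gA by auto
    qed
  qed
qed

text \<open>The analogous classification at the other end of the exchanged edge: the path avoids \<open>g\<close>, or
  leaves \<open>g\<close> by a vertex off the longest path, or goes through \<open>g\<close> and \<open>c\<close>, and then possibly
  through \<open>f\<close>.\<close>
lemma path_from_d:
  assumes "bpath E d x B W"
  shows "card B + j + 1 \<le> l \<or> (g \<in> B \<and> card B \<ge> 1 \<and> ytail (card B - 1)) \<or> (g \<in> B \<and> c \<in> W \<and> card B \<ge> 1 \<and> ctail (card B - 1)) \<or>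
    (g \<in> B \<and> f \<in> B \<and> c \<in> W \<and> card B \<le> j + 1)"
proof (cases "g \<in> B")
  case False
  then show ?thesis using tail_at_g_le_right[OF g(3) g(4)[symmetric] bpath_avoid[OF assms]] by simp
next
  case True
  from bacyclic_first_edge[OF tree g(1) g(3) assms True] obtain y tail_at_g_le_right W2 where
    y: "y \<in> g" "y \<noteq> d" "bpath (E - {g}) y x tail_at_g_le_right W2" "B = insert g tail_at_g_le_right" "W = insert d W2" "g \<notin> tail_at_g_le_right" "card B = Suc (card tail_at_g_le_right)" .
  show ?thesis
  proof (cases "y = c")
    case False
    then have "ytail (card tail_at_g_le_right)" unfolding ytail_def using y by blast
    then show ?thesis using y True by simp
  next
    case yc: True
    have cW: "c \<in> W" using y yc bpath_basic(3)[OF y(3)] by simp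
    show ?thesis
    proof (cases "f \<in> tail_at_g_le_right")
      case False
      have "bpath (E - {f, g}) c x tail_at_g_le_right W2" using bpath_avoid[OF y(3) False] yc by (simp add: Diff_insert2[symmetric] insert_commute)
      then have "ctail (card tail_at_g_le_right)" unfolding ctail_def by blast
      then show ?thesis using y True cW by simp
    next
      case fB: True
      have "bacyclic (E - {g})" "f \<in> E - {g}" "y \<in> f" using tree bacyclic_sub f g yc by blast+
      from bacyclic_first_edge[OF this y(3) fB] obtain s A3 V3 where
        s: "s \<in> f" "s \<noteq> y" "bpath (E - {g} - {f}) s x A3 V3" "card tail_at_g_le_right = Suc (card A3)" by metis
      have "bpath (E - {f}) s x A3 V3" by (rule bpath_mono[OF s(3)]) blast
      then have "card A3 + 1 \<le> j" using tail_at_f_le s yc by simp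
      then show ?thesis using y s yc True fB cW by simp
    qed
  qed
qed

definition forced_tail :: bool where "forced_tail \<longleftrightarrow> ytail j \<or> (2 * j = l \<and> ctail j)"

text \<open>Both pieces are classified; since they are disjoint, they do not both use \<open>f\<close>, or both use
  \<open>g\<close>, or both visit \<open>c\<close>.  In the remaining combinations the bounds on tails leave room for
  \<open>l + 1\<close> edges only if some tail is as long as possible.\<close>
lemma swapped_edge_from_f_to_d:
  assumes a: "bpath E u x A V" "u \<in> f" "u \<noteq> c" and b: "bpath E d y B W" and dis: "A \<inter> B = {}" "V \<inter> W = {}"
    and len: "l + 1 \<le> card A + card B"
  shows "card A + card B = l + 1 \<and> forced_tail"
proof -
  have dV: "d \<notin> V" using bpath_basic(3)[OF b] dis by blast
  have Y: "(f \<in> A \<and> g \<in> A \<and> card A \<ge> 2 \<and> ytail (card A - 2))"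
    if "f \<in> A \<and> g \<in> A \<and> card A \<ge> 2 \<and> (\<exists>y\<in>g - {c}. \<exists>x A' V'. y \<in> V \<and> bpath (E - {g}) y x A' V' \<and> card A = card A' + 2)"
    using that dV unfolding ytail_def by fastforce
  have nfg: "\<not> (f \<in> A \<and> f \<in> B)" "\<not> (g \<in> A \<and> g \<in> B)" "\<not> (c \<in> V \<and> c \<in> W)" using dis by blast+
  consider (a1) "card A + 1 \<le> j" | (a2) "f \<in> A" "card A \<le> j" | (a3) "f \<in> A" "c \<in> V" "card A \<ge> 1" "ctail (card A - 1)"
    | (a4) "f \<in> A" "g \<in> A" "card A \<ge> 2" "ytail (card A - 2)"
    using path_from_f[OF a] Y by blast
  note acases = this
  consider (b1) "card B + j + 1 \<le> l" | (b2) "g \<in> B" "card B \<ge> 1" "ytail (card B - 1)"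
    | (b3) "g \<in> B" "c \<in> W" "card B \<ge> 1" "ctail (card B - 1)"
    | (b4) "g \<in> B" "f \<in> B" "card B \<le> j + 1"
    using path_from_d[OF b] by blast
  note bcases = this
  have yt: "n \<le> j \<and> n + j + 1 \<le> l" if "ytail n" for n using ytail_le that by blast
  have ct: "n \<le> j" if "ctail n" for n using ctail_le that by blast
  show ?thesis
  proof (cases rule: acases)
    case a1
    show ?thesis
    proof (cases rule: bcases)
      case b1 then show ?thesis using a1 len jl by linarith
    next
      case b2 then show ?thesis using a1 len jl yt[OF b2(3)] by linarith
    next
      case b3 then show ?thesis using a1 len jl ct[OF b3(4)] by linarith
    next
      case b4 then show ?thesis using a1 len jl by linarith
    qed
  next
    case a2
    show ?thesis
    proof (cases rule: bcases)
      case b1 then show ?thesis using a2 len jl by linarith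
    next
      case b2 then show ?thesis using a2 len jl yt[OF b2(3)] by linarith
    next
      case b3
      then have "card B - 1 = j" "2 * j = l" "card A + card B = l + 1" using a2 len jl ct[OF b3(4)] by linarith+
      then show ?thesis using b3 unfolding forced_tail_def by simp
    next
      case b4 then show ?thesis using a2 nfg by blast
    qed
  next
    case a3
    show ?thesis
    proof (cases rule: bcases)
      case b1 then show ?thesis using a3 len jl ct[OF a3(4)] by linarith
    next
      case b2
      note u = ct[OF a3(4)] yt[OF b2(3)]
      have eq: "card A + card B = l + 1" using a3 b2 u len jl by linarith
      show ?thesis
      proof (cases "2 * j = l")
        case True
        then have "card A - 1 = j" using a3 b2 u len jl by linarith
        then show ?thesis using a3 eq True unfolding forced_tail_def by simp
      next
        case False
        then have "card B - 1 = j" using a3 b2 u len jl by linarith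
        then show ?thesis using b2 eq unfolding forced_tail_def by simp
      qed
    next
      case b3 then show ?thesis using a3 nfg by blast
    next
      case b4 then show ?thesis using a3 nfg by blast
    qed
  next
    case a4
    show ?thesis
    proof (cases rule: bcases)
      case b1
      then have "card A - 2 = j" "card A + card B = l + 1" using a4 len jl yt[OF a4(4)] by linarith+
      then show ?thesis using a4 unfolding forced_tail_def by simp
    qed (use a4 nfg in blast)+
  qed
qed

text \<open>At most one of the two pieces uses \<open>f\<close>, and the other one is shorter than \<open>j\<close>.\<close>
lemma swapped_edge_inside_f:
  assumes a: "bpath E u x A V" "u \<in> f" "u \<noteq> c" and b: "bpath E w y B W" "w \<in> f" "w \<noteq> c" and dis: "A \<inter> B = {}"
  shows "card A + card B \<le> l"
proof -
  have gen: "card A + j \<le> l + 1" "f \<notin> A \<Longrightarrow> card A + 1 \<le> j" if a: "bpath E u x A V" "u \<in> f" "u \<noteq> c" for u x A V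
  proof -
    show "f \<notin> A \<Longrightarrow> card A + 1 \<le> j" using path_from_f[OF a] by blast
    have "n \<le> j" if "ctail n" for n using ctail_le that by blast
    moreover have "card A' + j + 1 \<le> l" if "y \<in> g - {c}" "bpath (E - {g}) y x A' V'" for y x A' V' using tail_at_g_le_right[OF _ _ that(2)] that by blast
    ultimately show "card A + j \<le> l + 1" using path_from_f[OF a] jl by fastforce
  qed
  show ?thesis
  proof (cases "f \<in> A")
    case True
    then have "f \<notin> B" using dis by blast
    then show ?thesis using gen(1)[OF a] gen(2)[OF b] by linarith
  next
    case False
    then show ?thesis using gen(2)[OF a] gen(1)[OF b] by linarith
  qed
qed

text \<open>A longer path must pass through the added edge, and it enters and leaves that edge either
  within \<open>f\<close> or once through \<open>d\<close>.\<close>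
lemma swapped_edge_forces_tail:
  assumes "has_path (insert (insert d (f - {c})) E) n" "l + 2 \<le> n"
  shows "n = l + 2 \<and> forced_tail"
proof -
  let ?e = "insert d (f - {c})"
  have eE: "?e \<notin> E"
  proof
    assume "?e \<in> E"
    then have "has_path E n" using assms by (simp add: insert_absorb)
    then show False using longest has_path_le assms(2) by (metis Suc_leI add_2_eq_Suc' le_Suc_eq lessI)
  qed
  obtain u w Q VQ where Q: "bpath (insert ?e E) u w Q VQ" "card Q = n" using has_path_exact[OF assms(1)] by blast
  have eQ: "?e \<in> Q"
  proof (rule ccontr)
    assume "?e \<notin> Q"
    then have "bpath E u w Q VQ" using bpath_basic(5)[OF Q(1)] by (intro bpath_restrict[OF Q(1)]) auto
    then show False using path_le_longest[of u w Q VQ] Q assms by simp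
  qed
  from bpath_split_edge[OF Q(1) eQ] obtain p1 q1 A1 A2 V1 V2 where
    1: "bpath (insert ?e E) u p1 A1 V1" "bpath (insert ?e E) q1 w A2 V2" "p1 \<in> ?e" "q1 \<in> ?e" "?e \<notin> A1" "?e \<notin> A2"
    "Q = insert ?e (A1 \<union> A2)" "A1 \<inter> A2 = {}" "V1 \<inter> V2 = {}" by blast
  have b1: "bpath E p1 u A1 V1" using bpath_basic(5)[OF 1(1)] 1(5) by (intro bpath_rev[OF bpath_restrict[OF 1(1)]]) auto
  have b2: "bpath E q1 w A2 V2" using bpath_basic(5)[OF 1(2)] 1(6) by (intro bpath_restrict[OF 1(2)]) auto
  have cQ: "card Q = Suc (card A1 + card A2)"
    using 1(5-8) bpath_basic(1)[OF b1] bpath_basic(1)[OF b2] by (simp add: card_Un_disjoint)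
  then have len: "l + 1 \<le> card A1 + card A2" using Q assms by simp
  consider "p1 \<in> f" "p1 \<noteq> c" "q1 \<in> f" "q1 \<noteq> c" | "p1 \<in> f" "p1 \<noteq> c" "q1 = d" | "p1 = d" "q1 \<in> f" "q1 \<noteq> c" | "p1 = d" "q1 = d"
    using 1(3,4) by blast
  then show ?thesis
  proof cases
    case 1 then show ?thesis using swapped_edge_inside_f[OF b1 1(1,2) b2 1(3,4)] \<open>A1 \<inter> A2 = {}\<close> len by linarith
  next
    case 2 then show ?thesis using swapped_edge_from_f_to_d[OF b1 2(1,2) _ 1(8,9)] b2 len cQ Q by simp
  next
    case 3 then show ?thesis using swapped_edge_from_f_to_d[OF b2 3(2,3), of u A1 V1] b1 len cQ Q 1(8,9) by (simp add: Int_commute add.commute)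
  next
    case 4 then show ?thesis using bpath_basic(3)[OF b1] bpath_basic(3)[OF b2] 1(9) by blast
  qed
qed

end

section \<open>Saturated trees whose paths are too short\<close>

text \<open>The number \<open>t\<close> counts the edges of the forbidden path.\<close>
definition saturated :: "nat \<Rightarrow> nat \<Rightarrow> 'a set \<Rightarrow> 'a set set \<Rightarrow> bool" where
  "saturated k t V E \<longleftrightarrow> finite V \<and> (\<forall>e\<in>E. e \<subseteq> V \<and> card e = k) \<and> \<not> has_path E t \<and>
    (\<forall>e. e \<subseteq> V \<and> card e = k \<and> e \<notin> E \<longrightarrow> has_path (insert e E) t)"

lemma saturated_finite: "saturated k t V E \<Longrightarrow> finite E"
  unfolding saturated_def by (meson finite_Pow_iff finite_subset PowI subsetI)

text \<open>The exchanged edge is not an edge of the tree, as it shares two vertices with \<open>f\<close>.\<close>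
lemma saturated_forces_tail:
  assumes S: "saturated k t V E" and k: "k \<ge> 3" and tc: "swap_config E l j c d p xl xr g f AL AR VL VR" and t: "l + 2 \<le> t"
  shows "t = l + 2 \<and> swap_config.forced_tail E l j c d g f"
proof -
  interpret swap_config E l j c d p xl xr g f AL AR VL VR by (rule tc)
  let ?e = "insert d (f - {c})"
  have fk: "card f = k" "f \<subseteq> V" "g \<subseteq> V" "finite V" using S f g unfolding saturated_def by auto
  have ff: "finite f" using fk finite_subset by blast
  have df: "d \<notin> f" using bacyclic_inter_edges[OF tree f(1) g(1) f(2), of c d] f g by blast
  have ce: "card ?e = k" using df ff fk f(3) k by simp
  have "?e \<notin> E"
  proof
    assume eE: "?e \<in> E"
    have "\<exists>q\<in>f. q \<noteq> c \<and> q \<noteq> p"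
    proof (rule ccontr)
      assume "\<not> ?thesis"
      then have "f \<subseteq> {c, p}" by blast
      then have "card f \<le> card {c, p}" by (intro card_mono) auto
      also have "\<dots> \<le> 2" by (simp add: card_insert_if)
      finally show False using fk k by simp
    qed
    then obtain q where "q \<in> f" "q \<noteq> c" "q \<noteq> p" by blast
    moreover have "?e \<noteq> f" using df by blast
    ultimately show False using bacyclic_inter_edges[OF tree eE f(1), of p q] f by blast
  qed
  moreover have "?e \<subseteq> V" using fk g(3) by blast
  ultimately have "has_path (insert ?e E) t" using S ce unfolding saturated_def by blast
  from swapped_edge_forces_tail[OF this t] show ?thesis .
qed

lemma bpath_swap: "bpath (E - F) u w A V \<Longrightarrow> f \<notin> A \<Longrightarrow> bpath (E - {f}) u w A V"
  by (rule bpath_mono[OF bpath_avoid[of "E - F" u w A V f]]) auto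

lemma ex_swap_config:
  assumes "bacyclic E" "bpath E u w A V" "card A = l" "\<not> has_path E (Suc l)" "1 \<le> j" "j + 1 \<le> l" "2 * j \<le> l"
  shows "\<exists>c d p xl xr g f AL AR VL VR. swap_config E l j c d p xl xr g f AL AR VL VR"
proof -
  from bpath_split_nth[OF assms(2), of j] obtain g c d A1 A2 V1 V2 where
    1: "bpath E u c A1 V1" "bpath E d w A2 V2" "g \<in> E" "c \<in> g" "d \<in> g" "g \<notin> A1" "g \<notin> A2"
    "A = insert g (A1 \<union> A2)" "A1 \<inter> A2 = {}" "V1 \<inter> V2 = {}" "card A1 = j" using assms by fastforce
  have "card A = Suc (card A1 + card A2)" using 1 bpath_basic(1)[OF 1(1)] bpath_basic(1)[OF 1(2)] by (simp add: card_Un_disjoint)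
  then have cA2: "card A2 + j + 1 = l" using assms 1 by simp
  have cd: "c \<noteq> d" using 1 bpath_basic(4)[OF 1(1)] bpath_basic(3)[OF 1(2)] by blast
  have "A1 \<noteq> {}" using assms 1 by auto
  from bpath_first[OF bpath_rev[OF 1(1)] this] obtain f p AL VL where
    2: "f \<in> E" "c \<in> f" "p \<in> f" "f \<notin> AL" "c \<notin> VL" "bpath E p u AL VL" "A1 = insert f AL" by blast
  have "p \<noteq> c" using 2 bpath_basic(3)[OF 2(6)] by blast
  moreover have "Suc (card AL) = j" using 2 1 bpath_basic(1)[OF 2(6)] by simp
  moreover have "f \<noteq> g" using 2 1 by blast
  ultimately have "swap_config E l j c d p u w g f AL A2 VL V2"
    using assms 1 2 cA2 cd bpath_avoid[OF 2(6,4)] bpath_avoid[OF 1(2,7)] by unfold_locales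
  then show ?thesis by blast
qed

text \<open>The vertices behind the edge \<open>g\<close>, seen from its vertex \<open>d\<close>.\<close>
definition branch :: "'a set set \<Rightarrow> 'a \<Rightarrow> 'a set \<Rightarrow> 'a set" where
  "branch E d g = (\<Union>y\<in>g - {d}. {w. reach (E - {g}) y w})"

text \<open>Behind a further edge \<open>f\<close> at \<open>c\<close> one stays on the side of \<open>c\<close> with respect to \<open>g\<close>, which makes
  branches on successive levels nested and branches at different vertices of \<open>g\<close> disjoint.\<close>
lemma branch_sub:
  assumes "bacyclic E" "g \<in> E" "f \<in> E" "f \<noteq> g" "c \<in> g" "c \<in> f"
  shows "branch E c f \<subseteq> {w. reach (E - {g}) c w} - {c}"
proof
  fix w assume "w \<in> branch E c f"
  then obtain p where p: "p \<in> f" "p \<noteq> c" "reach (E - {f}) p w" unfolding branch_def by blast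
  have nc: "\<not> reach (E - {f}) p c" using bacyclicD[OF assms(1,3) p(1) assms(6)] p by blast
  obtain A V where b: "bpath (E - {f}) p w A V" using p unfolding reach_def by blast
  have gA: "g \<notin> A" using bpath_reach_edge[OF b _ assms(5)] nc by blast
  have "bpath (E - {g}) p w A V" by (rule bpath_swap[OF b gA])
  then have "reach (E - {g}) p w" unfolding reach_def by blast
  moreover have "reach (E - {g}) c p" using reach_edge[of f "E - {g}" c p] assms p by blast
  ultimately have "reach (E - {g}) c w" using reach_trans by metis
  moreover have "w \<noteq> c" using nc p by blast
  ultimately show "w \<in> {w. reach (E - {g}) c w} - {c}" by simp
qed

lemma reach_in: "reach E u v \<Longrightarrow> (\<And>e. e \<in> E \<Longrightarrow> e \<subseteq> V) \<Longrightarrow> u \<in> V \<Longrightarrow> v \<in> V"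
  unfolding reach_rtrancl by (induction rule: rtrancl_induct) auto

lemma reach_branch_disjoint:
  assumes "bacyclic E" "g \<in> E" "c \<in> g" "y \<in> g" "c \<noteq> y"
  shows "{w. reach (E - {g}) c w} \<inter> {w. reach (E - {g}) y w} = {}"
proof -
  have "\<not> (reach (E - {g}) c w \<and> reach (E - {g}) y w)" for w
    using bacyclicD[OF assms(1-4)] assms(5) reach_trans[OF _ reach_sym[of "E - {g}" y w], of c] by blast
  then show ?thesis by blast
qed

lemma mult_le_mono_cancel: "(c::nat) * a \<le> c * b \<Longrightarrow> 0 < c \<Longrightarrow> a \<le> b"
  by simp

text \<open>Trees in which every exchange forces a tail, as happens when each exchanged edge lengthens the
  longest path by two.\<close>
locale thick =
  fixes E :: "'a set set" and V :: "'a set" and k l :: nat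
  assumes tree: "bacyclic E" and longest: "\<not> has_path E (Suc l)"
    and fin: "finite V" and unif: "\<And>e. e \<in> E \<Longrightarrow> e \<subseteq> V \<and> card e = k" and k3: "k \<ge> 3"
    and forced_tail: "\<And>j c d p xl xr g f AL AR VL VR. swap_config E l j c d p xl xr g f AL AR VL VR \<Longrightarrow> swap_config.forced_tail E l j c d g f"
begin

lemma branch_V: "g \<in> E \<Longrightarrow> branch E d g \<subseteq> V"
proof
  fix w assume "g \<in> E" "w \<in> branch E d g"
  then obtain y where "y \<in> g" "reach (E - {g}) y w" unfolding branch_def by blast
  then show "w \<in> V" using reach_in[of "E - {g}" y w V] unif \<open>g \<in> E\<close> by blast
qed

lemma branch_finite: "g \<in> E \<Longrightarrow> finite (branch E d g)"
  using branch_V fin finite_subset by metis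

lemma three_disjoint:
  assumes "finite A" "finite B" "finite C" "A \<inter> B = {}" "A \<inter> C = {}" "B \<inter> C = {}" "A \<union> B \<union> C \<subseteq> D" "finite D"
  shows "card A + card B + card C \<le> card D"
proof -
  have "card (A \<union> B \<union> C) = card A + card B + card C" using assms by (simp add: card_Un_disjoint Int_Un_distrib2)
  then show ?thesis using card_mono[OF assms(8,7)] by simp
qed

text \<open>By induction on the height: below \<open>g\<close> the longest path continues at \<open>c\<close>, and the forced tail
  continues equally far at a second vertex \<open>y\<close> of \<open>g\<close>; both continuations lie on longest paths,
  so the induction hypothesis applies to them.\<close>
lemma branch_card_ge:
  assumes "g \<in> E" "d \<in> g" "c \<in> g" "c \<noteq> d" "bpath (E - {g}) c x A W" "card A = j" "bpath (E - {g}) d x' A' W'" "card A' + j + 1 = l" "2 * (j + 1) \<le> l"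
  shows "(k - 1) * (2 ^ (j + 1) - 1) \<le> card (branch E d g)"
  using assms
proof (induction j arbitrary: g d c x A W x' A' W')
  case 0
  have "g - {d} \<subseteq> branch E d g" unfolding branch_def by auto
  then have "card (g - {d}) \<le> card (branch E d g)" using branch_finite 0 card_mono by metis
  then show ?case using unif[OF 0(1)] 0(2) finite_subset[of g V] fin by simp
next
  case (Suc j)
  have gk: "g \<subseteq> V" "card g = k" "finite g" using unif[OF Suc.prems(1)] fin finite_subset by auto
  have "A \<noteq> {}" using Suc.prems by auto
  from bpath_first[OF Suc.prems(5) this] obtain f p AL VL where
    2: "f \<in> E - {g}" "c \<in> f" "p \<in> f" "f \<notin> AL" "c \<notin> VL" "bpath (E - {g}) p x AL VL" "A = insert f AL" by blast
  have pc: "p \<noteq> c" using 2 bpath_basic(3)[OF 2(6)] by blast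
  have cAL: "card AL = j" using 2 Suc.prems bpath_basic(1)[OF 2(6)] by simp
  have bL: "bpath (E - {f}) p x AL VL" by (rule bpath_swap[OF 2(6,4)])
  have tc: "swap_config E l (Suc j) c d p x x' g f AL A' VL W'"
    using tree longest Suc.prems 2 pc cAL bL by unfold_locales auto
  then interpret swap_config E l "Suc j" c d p x x' g f AL A' VL W' .
  \<comment> \<open>Below the middle of the path only the tail at another vertex of \<open>g\<close> is possible.\<close>
  have "2 * Suc j \<noteq> l" using Suc.prems(9) by simp
  then have "ytail (Suc j)" using forced_tail[OF tc] unfolding forced_tail_def by blast
  then obtain y z B0 Z0 where y: "y \<in> g" "y \<noteq> c" "y \<noteq> d" "bpath (E - {g}) y z B0 Z0" "Suc j \<le> card B0"
    unfolding ytail_def by auto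
  from bpath_prefix[OF y(4,5)] obtain z1 B Z where B: "bpath (E - {g}) y z1 B Z" "card B = Suc j" by blast
  then have "B \<noteq> {}" by auto
  from bpath_first[OF B(1) this] obtain f' p' B' Z' where
    3: "f' \<in> E - {g}" "y \<in> f'" "p' \<in> f'" "f' \<notin> B'" "y \<notin> Z'" "bpath (E - {g}) p' z1 B' Z'" "B = insert f' B'" by blast
  have pc': "p' \<noteq> y" using 3 bpath_basic(3)[OF 3(6)] by blast
  have cB: "card B' = j" using 3 B bpath_basic(1)[OF 3(6)] by simp
  have bL': "bpath (E - {f'}) p' z1 B' Z'" by (rule bpath_swap[OF 3(6,4)])
  note ext = bacyclic_extend(2,3)[OF tree Suc.prems(1,2,7)]
  have I1: "(k - 1) * (2 ^ (j + 1) - 1) \<le> card (branch E c f)"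
    by (rule Suc.IH[OF _ 2(2,3) pc bL cAL ext(2)[OF Suc.prems(3,4), of f]])
       (use 2 Suc.prems ext(1)[OF Suc.prems(3,4)] in auto)
  have I2: "(k - 1) * (2 ^ (j + 1) - 1) \<le> card (branch E y f')"
    by (rule Suc.IH[OF _ 3(2,3) pc' bL' cB ext(2)[OF y(1,3), of f']])
       (use 3 Suc.prems ext(1)[OF y(1,3)] in auto)
  have s1: "branch E c f \<subseteq> {w. reach (E - {g}) c w} - {c}" using branch_sub[OF tree Suc.prems(1) _ _ Suc.prems(3) 2(2)] 2(1) by blast
  have s2: "branch E y f' \<subseteq> {w. reach (E - {g}) y w} - {y}" using branch_sub[OF tree Suc.prems(1) _ _ y(1) 3(2)] 3(1) by blast
  have "card (g - {d}) + card (branch E c f) + card (branch E y f') \<le> card (branch E d g)"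
  proof (rule three_disjoint)
    show "finite (g - {d})" using gk by simp
    show "finite (branch E c f)" "finite (branch E y f')" "finite (branch E d g)" using branch_finite 2 3 Suc.prems by auto
    show "(g - {d}) \<inter> branch E c f = {}" using s1 bacyclicD[OF tree Suc.prems(1,3)] by blast
    show "(g - {d}) \<inter> branch E y f' = {}" using s2 bacyclicD[OF tree Suc.prems(1) y(1)] by blast
    show "branch E c f \<inter> branch E y f' = {}" using s1 s2 reach_branch_disjoint[OF tree Suc.prems(1,3) y(1)] y(2) by blast
    show "g - {d} \<union> branch E c f \<union> branch E y f' \<subseteq> branch E d g"
      using s1 s2 Suc.prems(3,4) y(1,3) unfolding branch_def[of E d g] by auto
  qed
  moreover have "card (g - {d}) = k - 1" using gk Suc.prems by simp
  moreover have "(k - 1) * (2 ^ (Suc j + 1) - 1) = (k - 1) + 2 * ((k - 1) * (2 ^ (j + 1) - 1))"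
  proof -
    have "(2::nat) ^ (Suc j + 1) - 1 = 1 + 2 * (2 ^ (j + 1) - 1)"
    proof -
      have "2 * X - 1 = 1 + 2 * (X - 1)" if "X \<ge> 1" for X :: nat using that by arith
      from this[of "2 ^ (j + 1)"] show ?thesis by simp
    qed
    then show ?thesis by (simp add: algebra_simps)
  qed
  ultimately show ?case using I1 I2 by linarith
qed

text \<open>The first edge of a long tail leads to a branch as in the previous lemma, provided that the tail
  lies on a longest path.\<close>
lemma ex_full_branch:
  assumes "bpath (E - F) v x A W" "card A = Suc h" "2 * Suc h \<le> l"
    and R: "\<And>f. f \<in> E \<Longrightarrow> f \<notin> F \<Longrightarrow> v \<in> f \<Longrightarrow> \<exists>x' A' W'. bpath (E - {f}) v x' A' W' \<and> card A' + h + 1 = l"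
  shows "\<exists>f\<in>E. f \<notin> F \<and> v \<in> f \<and> (k - 1) * (2 ^ Suc h - 1) \<le> card (branch E v f)"
proof -
  have "A \<noteq> {}" using assms by auto
  from bpath_first[OF assms(1) this] obtain f p AL VL where
    2: "f \<in> E - F" "v \<in> f" "p \<in> f" "f \<notin> AL" "v \<notin> VL" "bpath (E - F) p x AL VL" "A = insert f AL" by blast
  have pc: "p \<noteq> v" using 2 bpath_basic(3)[OF 2(6)] by blast
  have cAL: "card AL = h" using 2 assms bpath_basic(1)[OF 2(6)] by simp
  have bL: "bpath (E - {f}) p x AL VL" by (rule bpath_swap[OF 2(6,4)])
  obtain x' A' W' where "bpath (E - {f}) v x' A' W'" "card A' + h + 1 = l" using R[of f] 2 by blast
  from branch_card_ge[OF _ 2(2,3) pc bL cAL this] assms(3) 2 show ?thesis by auto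
qed

text \<open>For odd length the middle edge \<open>g\<close> carries full branches at both path vertices, and the forced
  tail yields a third one.\<close>
lemma thick_edges_odd:
  assumes l: "l = 2 * h + 1" "h \<ge> 1" and P: "bpath E u w A0 W0" "card A0 = l" and V: "card V = (k - 1) * card E + 1"
  shows "1 + 3 * (2 ^ h - 1) \<le> card E"
proof -
  obtain h' where h': "h = Suc h'" using l by (cases h) auto
  from ex_swap_config[OF tree P longest, of h] l obtain c d p xl xr g f AL AR VL VR where
    tc: "swap_config E l h c d p xl xr g f AL AR VL VR" by auto
  then interpret swap_config E l h c d p xl xr g f AL AR VL VR .
  have "ytail h" using forced_tail[OF tc] l unfolding forced_tail_def by simp
  then obtain y z B0 Z0 where y: "y \<in> g" "y \<noteq> c" "y \<noteq> d" "bpath (E - {g}) y z B0 Z0" "h \<le> card B0"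
    unfolding ytail_def by auto
  from bpath_prefix[OF y(4,5)] obtain z1 B Z where B: "bpath (E - {g}) y z1 B Z" "card B = h" by blast
  have cAR: "card AR = h" using R l by simp
  note extR = bacyclic_extend(2,3)[OF tree g(1,3) R(1)]
  note extL = bacyclic_extend(2,3)[OF tree g(1,2) left_tail(1)]
  have "\<exists>f\<in>E. f \<notin> {g} \<and> c \<in> f \<and> (k - 1) * (2 ^ h - 1) \<le> card (branch E c f)"
    unfolding h'
  proof (rule ex_full_branch[OF left_tail(1)])
    fix f assume "f \<in> E" "f \<notin> {g}" "c \<in> f"
    then show "\<exists>x' A' W'. bpath (E - {f}) c x' A' W' \<and> card A' + h' + 1 = l"
      using extR(2)[OF g(2,4), of f] extR(1)[OF g(2,4)] cAR h' l by (intro exI conjI) auto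
  qed (use left_tail(2) l h' in auto)
  then obtain f1 where f1: "f1 \<in> E" "f1 \<noteq> g" "c \<in> f1" "(k - 1) * (2 ^ h - 1) \<le> card (branch E c f1)" by auto
  have "\<exists>f\<in>E. f \<notin> {g} \<and> d \<in> f \<and> (k - 1) * (2 ^ h - 1) \<le> card (branch E d f)"
    unfolding h'
  proof (rule ex_full_branch[OF R(1)])
    fix f assume "f \<in> E" "f \<notin> {g}" "d \<in> f"
    then show "\<exists>x' A' W'. bpath (E - {f}) d x' A' W' \<and> card A' + h' + 1 = l"
      using extL(2)[OF g(3) g(4)[symmetric], of f] extL(1)[OF g(3) g(4)[symmetric]] left_tail(2) h' l by (intro exI conjI) auto
  qed (use cAR l h' in auto)
  then obtain f2 where f2: "f2 \<in> E" "f2 \<noteq> g" "d \<in> f2" "(k - 1) * (2 ^ h - 1) \<le> card (branch E d f2)" by auto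
  have "\<exists>f\<in>E. f \<notin> {g} \<and> y \<in> f \<and> (k - 1) * (2 ^ h - 1) \<le> card (branch E y f)"
    unfolding h'
  proof (rule ex_full_branch[OF B(1)])
    fix f assume "f \<in> E" "f \<notin> {g}" "y \<in> f"
    then show "\<exists>x' A' W'. bpath (E - {f}) y x' A' W' \<and> card A' + h' + 1 = l"
      using extR(2)[OF y(1,3), of f] extR(1)[OF y(1,3)] cAR h' l by (intro exI conjI) auto
  qed (use B(2) l h' in auto)
  then obtain f3 where f3: "f3 \<in> E" "f3 \<noteq> g" "y \<in> f3" "(k - 1) * (2 ^ h - 1) \<le> card (branch E y f3)" by auto
  have s1: "branch E c f1 \<subseteq> {w. reach (E - {g}) c w} - {c}" using branch_sub[OF tree g(1) f1(1,2) g(2) f1(3)] .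
  have s2: "branch E d f2 \<subseteq> {w. reach (E - {g}) d w} - {d}" using branch_sub[OF tree g(1) f2(1,2) g(3) f2(3)] .
  have s3: "branch E y f3 \<subseteq> {w. reach (E - {g}) y w} - {y}" using branch_sub[OF tree g(1) f3(1,2) y(1) f3(3)] .
  have gk: "g \<subseteq> V" "card g = k" "finite g" using unif[OF g(1)] fin finite_subset by auto
  have d12: "branch E c f1 \<inter> branch E d f2 = {}" "branch E c f1 \<inter> branch E y f3 = {}" "branch E d f2 \<inter> branch E y f3 = {}"
    using s1 s2 s3 reach_branch_disjoint[OF tree g(1,2,3,4)] reach_branch_disjoint[OF tree g(1,2) y(1) y(2)[symmetric]]
      reach_branch_disjoint[OF tree g(1,3) y(1) y(3)[symmetric]] by blast+
  have "card (branch E c f1) + card (branch E d f2) + card (branch E y f3) \<le> card (V - g)"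
  proof (rule three_disjoint)
    show "branch E c f1 \<union> branch E d f2 \<union> branch E y f3 \<subseteq> V - g"
      using s1 s2 s3 branch_V[OF f1(1)] branch_V[OF f2(1)] branch_V[OF f3(1)] bacyclicD[OF tree g(1,2)] bacyclicD[OF tree g(1,3)] bacyclicD[OF tree g(1) y(1)] by blast
  qed (use branch_finite f1(1) f2(1) f3(1) d12 fin in auto)
  also have "card (V - g) = card V - k" using gk by (simp add: card_Diff_subset)
  finally have "3 * ((k - 1) * (2 ^ h - 1)) + k \<le> card V" using f1(4) f2(4) f3(4) k3 card_mono[OF fin gk(1)] gk(2) by linarith
  moreover have "(k - 1) * (1 + 3 * (2 ^ h - 1)) = (k - 1) + 3 * ((k - 1) * (2 ^ h - 1))"
    by (simp only: distrib_left mult_1_right mult.left_commute)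
  ultimately have "(k - 1) * (1 + 3 * (2 ^ h - 1)) \<le> (k - 1) * card E" unfolding V using k3 by linarith
  then show ?thesis by (rule mult_le_mono_cancel) (use k3 in simp)
qed

text \<open>For even length the forced tail cannot start in a further vertex of \<open>g\<close>, where only
  \<open>l - 1 - j\<close> edges fit; so the middle vertex \<open>c\<close> has three full branches.\<close>
lemma thick_edges_even:
  assumes l: "l = 2 * h" "h \<ge> 1" and P: "bpath E u w A0 W0" "card A0 = l" and V: "card V = (k - 1) * card E + 1"
  shows "3 * (2 ^ h - 1) \<le> card E"
proof -
  obtain h' where h': "h = Suc h'" using l by (cases h) auto
  from ex_swap_config[OF tree P longest, of h] l obtain c d p xl xr g f AL AR VL VR where
    tc: "swap_config E l h c d p xl xr g f AL AR VL VR" by auto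
  then interpret swap_config E l h c d p xl xr g f AL AR VL VR .
  have "ctail h" using forced_tail[OF tc] l ytail_le[of h] unfolding forced_tail_def by auto
  then obtain z B0 Z0 where y: "bpath (E - {f, g}) c z B0 Z0" "h \<le> card B0"
    unfolding ctail_def by auto
  from bpath_prefix[OF y] obtain z1 B Z where B: "bpath (E - {f, g}) c z1 B Z" "card B = h" by blast
  have cAR: "card AR = h'" using R l h' by simp
  note extR = bacyclic_extend(2,3)[OF tree g(1,3) R(1)]
  have "\<exists>f'\<in>E. f' \<notin> {f, g} \<and> c \<in> f' \<and> (k - 1) * (2 ^ h - 1) \<le> card (branch E c f')"
    unfolding h'
  proof (rule ex_full_branch[OF B(1)])
    fix f' assume "f' \<in> E" "f' \<notin> {f, g}" "c \<in> f'"
    then show "\<exists>x' A' W'. bpath (E - {f'}) c x' A' W' \<and> card A' + h' + 1 = l"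
      using extR(2)[OF g(2,4), of f'] extR(1)[OF g(2,4)] cAR h' l by (intro exI conjI) auto
  qed (use B(2) l h' in auto)
  then obtain f1 where f1: "f1 \<in> E" "f1 \<noteq> f" "f1 \<noteq> g" "c \<in> f1" "(k - 1) * (2 ^ h - 1) \<le> card (branch E c f1)" by auto
  have f2: "(k - 1) * (2 ^ h - 1) \<le> card (branch E c f)"
    using branch_card_ge[OF f(1,3,4,5) L(1) _ extR(2)[OF g(2,4) f(2) f(3)], of h'] L(2) extR(1)[OF g(2,4)] cAR l h' by simp
  have f3: "(k - 1) * (2 ^ h - 1) \<le> card (branch E c g)"
    using branch_card_ge[OF g(1,2,3) g(4)[symmetric] R(1) cAR left_tail(1)] left_tail(2) l h' by simp
  have d: "branch E c a \<inter> branch E c b = {}" if "a \<in> E" "b \<in> E" "a \<noteq> b" "c \<in> a" "c \<in> b" for a b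
  proof -
    have "branch E c a \<inter> {w. reach (E - {b}) y w} = {}" if "y \<in> b - {c}" for y
      using branch_sub[OF tree \<open>b \<in> E\<close> \<open>a \<in> E\<close> \<open>a \<noteq> b\<close> \<open>c \<in> b\<close> \<open>c \<in> a\<close>] reach_branch_disjoint[OF tree \<open>b \<in> E\<close> \<open>c \<in> b\<close>, of y] that by blast
    then show ?thesis unfolding branch_def[of E c b] by blast
  qed
  have nc: "c \<notin> branch E c a" if "a \<in> E" "c \<in> a" for a
    using bacyclicD[OF tree that(1) _ that(2)] unfolding branch_def by auto
  have "card (branch E c f1) + card (branch E c f) + card (branch E c g) \<le> card (V - {c})"
  proof (rule three_disjoint)
    show "branch E c f1 \<union> branch E c f \<union> branch E c g \<subseteq> V - {c}"
      using nc[OF f1(1,4)] nc[OF f(1,3)] nc[OF g(1,2)] branch_V[OF f1(1)] branch_V[OF f(1)] branch_V[OF g(1)] by blast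
    show "branch E c f1 \<inter> branch E c f = {}" by (rule d[OF f1(1) f(1) f1(2,4) f(3)])
    show "branch E c f1 \<inter> branch E c g = {}" by (rule d[OF f1(1) g(1) f1(3,4) g(2)])
    show "branch E c f \<inter> branch E c g = {}" by (rule d[OF f(1) g(1) f(2,3) g(2)])
  qed (use branch_finite f1(1) f(1) g(1) fin in auto)
  also have "card (V - {c}) = card V - 1" using unif[OF g(1)] g(2) by (intro card_Diff_singleton) auto
  finally have "3 * ((k - 1) * (2 ^ h - 1)) \<le> (k - 1) * card E" using f1(5) f2 f3 V by linarith
  then have "(k - 1) * (3 * (2 ^ h - 1)) \<le> (k - 1) * card E" by (simp only: mult.left_commute[of 3])
  then show ?thesis using k3 by simp
qed

end

lemma has_path_longest:
  assumes "has_path E n" "\<not> has_path E t"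
  shows "\<exists>l\<ge>n. l < t \<and> has_path E l \<and> \<not> has_path E (Suc l)"
proof -
  have "\<exists>l. n \<le> l \<and> has_path E l \<and> \<not> has_path E (Suc l)"
  proof (rule ccontr)
    assume a: "\<not> ?thesis"
    have "has_path E (n + i)" for i by (induction i) (use a assms in auto)
    then have "has_path E (n + t)" .
    then show False using assms(2) has_path_le by (metis le_add2)
  qed
  then show ?thesis using assms(2) has_path_le by (metis not_le_imp_less)
qed

text \<open>The exchange argument needs two consecutive edges of a longest path.\<close>
lemma tree_two_path:
  assumes s: "bacyclic E" and k: "k \<ge> 2" and u: "\<And>e. e \<in> E \<Longrightarrow> e \<subseteq> V \<and> card e = k" and V: "card V \<ge> k + 1"
    and con: "\<And>x y. x \<in> V \<Longrightarrow> y \<in> V \<Longrightarrow> reach E x y"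
  shows "has_path E 2"
proof -
  have fV: "finite V" using V card.infinite by fastforce
  obtain x y where xy: "x \<in> V" "y \<in> V" "x \<noteq> y"
  proof -
    have "\<not> card V \<le> 1" using V k by simp
    then show ?thesis using that card_le_Suc0_iff_eq[OF fV] by auto
  qed
  obtain A W where b: "bpath E x y A W" using con[OF xy(1,2)] unfolding reach_def by blast
  have "A \<noteq> {}" using b xy bpath_empty by metis
  then obtain g where g: "g \<in> E" using bpath_basic(5)[OF b] by blast
  have gk: "g \<subseteq> V" "card g = k" "finite g" using u[OF g] fV finite_subset by auto
  then have "\<not> V \<subseteq> g" using V card_mono[of g V] by auto
  then obtain v where v: "v \<in> V" "v \<notin> g" by blast
  have "g \<noteq> {}" using gk k by auto
  then obtain z where z: "z \<in> g" by blast
  obtain B Z where B: "bpath E v z B Z" using con[of v z] v z gk unfolding reach_def by blast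
  show ?thesis
  proof (cases "card B \<ge> 2")
    case True then show ?thesis using B has_pathI by metis
  next
    case False
    have "B \<noteq> {}" using B v z bpath_empty by metis
    then have "card B = 1" using False bpath_basic(1)[OF B] by (metis One_nat_def card_0_eq less_2_cases_iff not_le)
    then obtain h where h: "B = {h}" using card_1_singletonE by blast
    have vh: "v \<in> h" "z \<in> h" using bpath_verts_end[OF B] bpath_basic(3,4)[OF B] h by auto
    have hE: "h \<in> E" using bpath_basic(5)[OF B] h by blast
    have hg: "h \<noteq> g" using vh v by blast
    have "\<exists>q\<in>g. q \<noteq> z"
    proof (rule ccontr)
      assume "\<not> ?thesis"
      then have "g \<subseteq> {z}" by blast
      then have "card g \<le> card {z}" by (intro card_mono) auto
      then show False using gk k by simp
    qed
    then obtain q where q: "q \<in> g" "q \<noteq> z" by blast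
    have "v \<noteq> z" "v \<noteq> q" using v z q by blast+
    then have "bpath E v q ({h} \<union> {g}) ({v, z} \<union> {z, q})"
      using q z g hE hg vh by (intro bpath_concat[of _ _ z] bpath_single) auto
    moreover have "card ({h} \<union> {g}) = 2" using hg by simp
    ultimately show ?thesis by (metis has_pathI order_refl)
  qed
qed

section \<open>Gluing two hypergraphs at a vertex\<close>

text \<open>The exchanged edge at the very end of a longest path gains at most two edges, so a path of
  \<open>t - 2\<close> edges exists; if no path is longer, the tree is thick.\<close>
lemma short_saturated_tree_edges_ge:
  assumes S: "saturated k t V E" and k: "k \<ge> 3" and s: "bacyclic E" and V: "card V \<ge> k + 1"
    and con: "\<And>x y. x \<in> V \<Longrightarrow> y \<in> V \<Longrightarrow> reach E x y" and t: "t \<ge> 5" and np: "\<not> has_path E (t - 1)"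
  shows "(\<forall>h. t = 2 * h + 3 \<longrightarrow> 1 + 3 * (2 ^ h - 1) \<le> card E) \<and> (\<forall>h. t = 2 * h + 2 \<longrightarrow> 3 * (2 ^ h - 1) \<le> card E)"
proof -
  have u: "\<And>e. e \<in> E \<Longrightarrow> e \<subseteq> V \<and> card e = k" using S unfolding saturated_def by blast
  have "has_path E 2" using tree_two_path[OF s _ u V con] k by simp
  from has_path_longest[OF this np] obtain l where l: "l \<ge> 2" "l < t - 1" "has_path E l" "\<not> has_path E (Suc l)" by blast
  obtain x y A W where P: "bpath E x y A W" "card A = l" using has_path_exact[OF l(3)] by blast
  from ex_swap_config[OF s P l(4), of 1] l obtain c d p xl xr g f AL AR VL VR where
    tc: "swap_config E l 1 c d p xl xr g f AL AR VL VR" by auto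
  have tl: "t = l + 2" using saturated_forces_tail[OF S k tc] l by simp
  interpret thick E V k l
    by unfold_locales (use s l S u k saturated_forces_tail[OF S k] tl in \<open>auto simp: saturated_def\<close>)
  have "V \<noteq> {}" using V by auto
  then obtain v where v: "v \<in> V" by blast
  have "{} \<notin> E" using u k by fastforce
  then have "grow v V E" using connected_grow[OF saturated_finite[OF S] _ v] con v u by blast
  from grow_card[OF this, of k] u k s have cV: "card V = (k - 1) * card E + 1" by simp
  show ?thesis using thick_edges_odd[OF _ _ P cV] thick_edges_even[OF _ _ P cV] tl t by auto
qed

lemma bpath_in: "bpath E u w A W \<Longrightarrow> u \<in> V \<Longrightarrow> (\<And>e. e \<in> E \<Longrightarrow> e \<subseteq> V) \<Longrightarrow> W \<subseteq> V"
  by (induction rule: bpath.induct) auto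

lemma bpath_start_edge: "bpath E u w A W \<Longrightarrow> A \<noteq> {} \<Longrightarrow> (\<And>e. e \<in> E \<Longrightarrow> e \<subseteq> V) \<Longrightarrow> u \<in> V"
  by (erule bpath.cases) auto

lemma inter_singletonD: assumes "g \<inter> f = {c}" shows "c \<in> g" "c \<in> f" "\<And>v. v \<in> g \<Longrightarrow> v \<in> f \<Longrightarrow> v = c"
  using assms by auto

definition crosses :: "'a set set \<Rightarrow> 'a set set \<Rightarrow> 'a \<Rightarrow> 'a \<Rightarrow> 'a \<Rightarrow> 'a set set \<Rightarrow> 'a set \<Rightarrow> bool" where
  "crosses E1 E2 v u w A W \<longleftrightarrow> (\<exists>A1 A2 W1 W2. bpath E1 u v A1 W1 \<and> bpath E2 v w A2 W2 \<and> A = A1 \<union> A2 \<and> W = W1 \<union> W2)"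

lemma glue_step:
  assumes "V1 \<inter> V2 = {v}" "\<And>e. e \<in> E1 \<Longrightarrow> e \<subseteq> V1" "\<And>e. e \<in> E2 \<Longrightarrow> e \<subseteq> V2"
    and a: "a \<in> E1" "u \<in> a" "v' \<in> a" "a \<notin> A" "u \<notin> W" "bpath (E1 \<union> E2) v' w A W"
    and IH: "A \<subseteq> E1 \<or> A \<subseteq> E2 \<or> crosses E1 E2 v v' w A W \<or> crosses E2 E1 v v' w A W"
  shows "insert a A \<subseteq> E1 \<or> crosses E1 E2 v u w (insert a A) (insert u W)"
proof -
  have v'W: "v' \<in> W" using bpath_basic(3)[OF a(6)] .
  have v'1: "v' \<in> V1" using a assms by blast
  have sing: "bpath E1 u v' {a} {u, v'}" using a v'W by (intro bpath_single) auto
  consider "A \<subseteq> E1" | "A \<subseteq> E2" "A \<noteq> {}" | "crosses E1 E2 v v' w A W" | "crosses E2 E1 v v' w A W" using IH by blast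
  then show ?thesis
  proof cases
    case 1 then show ?thesis using a by blast
  next
    case 2
    have b: "bpath E2 v' w A W" using bpath_restrict[OF a(6) 2(1)] .
    have "v' \<in> V2" using bpath_start_edge[OF b 2(2)] assms by blast
    then have "v' = v" using v'1 inter_singletonD[OF assms(1)] by metis
    then have "crosses E1 E2 v u w (insert a A) (insert u W)" unfolding crosses_def
      using sing b v'W by (intro exI[of _ "{a}"] exI[of _ A] exI[of _ "{u,v'}"] exI[of _ W]) auto
    then show ?thesis by blast
  next
    case 3
    then obtain A1 A2 W1 W2 where c: "bpath E1 v' v A1 W1" "bpath E2 v w A2 W2" "A = A1 \<union> A2" "W = W1 \<union> W2"
      unfolding crosses_def by blast
    have "bpath E1 u v (insert a A1) (insert u W1)" using a c by (intro bpath.cons) auto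
    then have "crosses E1 E2 v u w (insert a A) (insert u W)" unfolding crosses_def c using c(2) by (metis Un_insert_left)
    then show ?thesis by blast
  next
    case 4
    then obtain A1 A2 W1 W2 where c: "bpath E2 v' v A2 W2" "bpath E1 v w A1 W1" "A = A2 \<union> A1" "W = W2 \<union> W1"
      unfolding crosses_def by blast
    have "A2 = {}"
    proof (rule ccontr)
      assume n: "A2 \<noteq> {}"
      have "v' \<in> V2" using bpath_start_edge[OF c(1) n] assms by blast
      then have "v' = v" using v'1 inter_singletonD[OF assms(1)] by metis
      then show False using bpath_loop c(1) n by metis
    qed
    then have "A \<subseteq> E1" using c bpath_basic(5)[OF c(2)] by simp
    then show ?thesis using a by blast
  qed
qed

text \<open>A path in two hypergraphs that share only \<open>v\<close> changes sides at most once, namely in \<open>v\<close>.\<close>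
lemma glue:
  assumes "V1 \<inter> V2 = {v}" "\<And>e. e \<in> E1 \<Longrightarrow> e \<subseteq> V1" "\<And>e. e \<in> E2 \<Longrightarrow> e \<subseteq> V2" "bpath (E1 \<union> E2) u w A W"
  shows "A \<subseteq> E1 \<or> A \<subseteq> E2 \<or> crosses E1 E2 v u w A W \<or> crosses E2 E1 v u w A W"
  using assms(4)
proof (induction rule: bpath.induct)
  case (cons a u v' A W w)
  have a: "u \<in> a" "v' \<in> a" "a \<notin> A" "u \<notin> W" "bpath (E1 \<union> E2) v' w A W" using cons by auto
  show ?case
  proof (cases "a \<in> E1")
    case True
    show ?thesis using glue_step[OF assms(1-3) True a cons.IH] by blast
  next
    case False
    then have aE: "a \<in> E2" using cons by blast
    have a2: "bpath (E2 \<union> E1) v' w A W" using a(5) by (simp add: Un_commute)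
    have v2: "V2 \<inter> V1 = {v}" using assms(1) by blast
    have ih: "A \<subseteq> E2 \<or> A \<subseteq> E1 \<or> crosses E2 E1 v v' w A W \<or> crosses E1 E2 v v' w A W" using cons.IH by blast
    show ?thesis using glue_step[OF v2 assms(3,2) aE a(1-4) a2 ih] by blast
  qed
qed simp

text \<open>An excursion to the other side would have to return through \<open>v\<close>.\<close>
lemma glue_reach:
  assumes "V1 \<inter> V2 = {v}" "\<And>e. e \<in> E1 \<Longrightarrow> e \<subseteq> V1" "\<And>e. e \<in> E2 \<Longrightarrow> e \<subseteq> V2"
    and r: "reach (E1 \<union> E2) c y" "c \<in> V1" "y \<in> V1"
  shows "reach E1 c y"
proof -
  obtain A W where b: "bpath (E1 \<union> E2) c y A W" using r unfolding reach_def by blast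
  from glue[OF assms(1-3) b]
  consider "A \<subseteq> E1" | "A \<subseteq> E2" | "crosses E1 E2 v c y A W" | "crosses E2 E1 v c y A W" by blast
  then show ?thesis
  proof cases
    case 1 then show ?thesis using bpath_restrict[OF b] unfolding reach_def by blast
  next
    case 2
    have b2: "bpath E2 c y A W" using bpath_restrict[OF b 2] .
    show ?thesis
    proof (cases "A = {}")
      case True then show ?thesis using bpath_empty b by fastforce
    next
      case False
      have "c \<in> V2" "y \<in> V2" using bpath_start_edge[OF b2 False] bpath_start_edge[OF bpath_rev[OF b2] False] assms(3) by blast+
      then have "c = y" using r inter_singletonD[OF assms(1)] by metis
      then show ?thesis by simp
    qed
  next
    case 3
    then obtain A1 A2 W1 W2 where c: "bpath E1 c v A1 W1" "bpath E2 v y A2 W2" unfolding crosses_def by blast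
    have "v \<in> V2" using assms by blast
    then have "y \<in> V2" using bpath_in[OF c(2)] assms(3) bpath_basic(4)[OF c(2)] by blast
    then have "y = v" using r inter_singletonD[OF assms(1)] by metis
    then show ?thesis using c unfolding reach_def by blast
  next
    case 4
    then obtain A1 A2 W1 W2 where c: "bpath E2 c v A2 W2" "bpath E1 v y A1 W1" unfolding crosses_def by blast
    have "v \<in> V2" using assms by blast
    then have "c \<in> V2" using bpath_in[OF bpath_rev[OF c(1)]] assms(3) bpath_basic(3)[OF c(1)] by blast
    then have "c = v" using r inter_singletonD[OF assms(1)] by metis
    then show ?thesis using c unfolding reach_def by blast
  qed
qed

lemma glue_bacyclic_half:
  assumes "V1 \<inter> V2 = {v}" "\<And>e. e \<in> E1 \<Longrightarrow> e \<subseteq> V1" "\<And>e. e \<in> E2 \<Longrightarrow> e \<subseteq> V2" "bacyclic E1"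
    and g: "g \<in> E1" "c \<in> g" "y \<in> g" "reach (E1 \<union> E2 - {g}) c y"
  shows "c = y"
proof -
  have "reach ((E1 - {g}) \<union> E2) c y" by (rule reach_mono[OF g(4)]) blast
  moreover have "c \<in> V1" "y \<in> V1" using g assms by blast+
  ultimately have "reach (E1 - {g}) c y" using glue_reach[OF assms(1), of "E1 - {g}" E2] assms(2,3) by blast
  then show ?thesis using bacyclicD assms(4) g by metis
qed

lemma glue_bacyclic:
  assumes "V1 \<inter> V2 = {v}" "\<And>e. e \<in> E1 \<Longrightarrow> e \<subseteq> V1" "\<And>e. e \<in> E2 \<Longrightarrow> e \<subseteq> V2" "bacyclic E1" "bacyclic E2"
  shows "bacyclic (E1 \<union> E2)"
  unfolding bacyclic_def
proof (intro ballI impI)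
  fix g c y assume g: "g \<in> E1 \<union> E2" "c \<in> g" "y \<in> g" "reach (E1 \<union> E2 - {g}) c y"
  show "c = y"
  proof (cases "g \<in> E1")
    case True then show ?thesis using glue_bacyclic_half[OF assms(1-4)] g by blast
  next
    case False
    have v2: "V2 \<inter> V1 = {v}" using assms(1) by blast
    have "g \<in> E2" "reach (E2 \<union> E1 - {g}) c y" using g False by (simp_all add: Un_commute)
    then show ?thesis using glue_bacyclic_half[OF v2 assms(3,2,5)] g by blast
  qed
qed

lemma glue_len:
  assumes "V1 \<inter> V2 = {v}" "\<And>e. e \<in> E1 \<Longrightarrow> e \<subseteq> V1" "\<And>e. e \<in> E2 \<Longrightarrow> e \<subseteq> V2"
    and l1: "\<And>u w A W. bpath E1 u w A W \<Longrightarrow> card A \<le> m" and l2: "\<And>u w A W. bpath E2 u w A W \<Longrightarrow> card A \<le> m"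
    and a1: "\<And>w A W. bpath E1 v w A W \<Longrightarrow> card A \<le> a" and a2: "\<And>w A W. bpath E2 v w A W \<Longrightarrow> card A \<le> b" and ab: "a + b \<le> m"
    and P: "bpath (E1 \<union> E2) u w A W"
  shows "card A \<le> m"
proof -
  have cr: "card (A1 \<union> A2) \<le> m" if "bpath E1 v x A1 W1" "bpath E2 v z A2 W2" for x z A1 A2 W1 W2
    using a1[OF that(1)] a2[OF that(2)] ab card_Un_le[of A1 A2] by linarith
  from glue[OF assms(1-3) P]
  consider "A \<subseteq> E1" | "A \<subseteq> E2" | "crosses E1 E2 v u w A W" | "crosses E2 E1 v u w A W" by blast
  then show ?thesis
  proof cases
    case 1 show ?thesis by (rule l1[OF bpath_restrict[OF P 1]])
  next
    case 2 show ?thesis by (rule l2[OF bpath_restrict[OF P 2]])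
  next
    case 3 then show ?thesis unfolding crosses_def using cr bpath_rev by metis
  next
    case 4 then show ?thesis unfolding crosses_def using cr bpath_rev by (metis Un_commute)
  qed
qed

lemma glue_len_from:
  assumes "V1 \<inter> V2 = {v}" "\<And>e. e \<in> E1 \<Longrightarrow> e \<subseteq> V1" "\<And>e. e \<in> E2 \<Longrightarrow> e \<subseteq> V2"
    and s: "s \<in> V1" "s \<noteq> v"
    and l1: "\<And>w A W. bpath E1 s w A W \<Longrightarrow> card A \<le> m"
    and a1: "\<And>A W. bpath E1 s v A W \<Longrightarrow> card A \<le> a" and a2: "\<And>w A W. bpath E2 v w A W \<Longrightarrow> card A \<le> b" and ab: "a + b \<le> m"
    and P: "bpath (E1 \<union> E2) s w A W"
  shows "card A \<le> m"
proof -
  have s2: "s \<notin> V2" using s assms(1) by blast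
  have no2: "A2 = {}" if "bpath E2 s x A2 W2" for x A2 W2
    using bpath_start_edge[OF that] s2 assms(3) by blast
  from glue[OF assms(1-3) P]
  consider "A \<subseteq> E1" | "A \<subseteq> E2" | "crosses E1 E2 v s w A W" | "crosses E2 E1 v s w A W" by blast
  then show ?thesis
  proof cases
    case 1 show ?thesis by (rule l1[OF bpath_restrict[OF P 1]])
  next
    case 2 then show ?thesis using no2[OF bpath_restrict[OF P 2]] by simp
  next
    case 3
    then obtain A1 A2 W1 W2 where c: "bpath E1 s v A1 W1" "bpath E2 v w A2 W2" "A = A1 \<union> A2" unfolding crosses_def by blast
    then show ?thesis using a1[OF c(1)] a2[OF c(2)] ab card_Un_le[of A1 A2] by simp
  next
    case 4
    then obtain A2 W2 where c: "bpath E2 s v A2 W2" unfolding crosses_def by blast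
    then show ?thesis using no2[OF c] s bpath_empty by metis
  qed
qed

lemma bacyclic_path_in_edge:
  assumes "bacyclic E" "g \<in> E" "d \<in> g" "y \<in> g" "bpath E d y A V"
  shows "card A \<le> 1"
proof (cases "g \<in> A")
  case False
  then have "reach (E - {g}) d y" using bpath_avoid[OF assms(5)] unfolding reach_def by blast
  then have "d = y" using bacyclicD assms by metis
  then show ?thesis using bpath_loop assms(5) by fastforce
next
  case True
  from bacyclic_first_edge[OF assms(1-3,5) True] obtain s A2 V2 where
    s: "s \<in> g" "bpath (E - {g}) s y A2 V2" "card A = Suc (card A2)" by metis
  have "s = y" using bacyclicD[OF assms(1,2) s(1) assms(4)] s(2) unfolding reach_def by blast
  then show ?thesis using s bpath_loop by fastforce
qed

section \<open>Binary trees thinned out on the lowest level\<close>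

text \<open>Each edge above the lowest level has exactly two vertices at which the tree continues.  The tree of
  height 2 is a path of two edges: leaving out one branch on the lowest level only keeps the trees
  saturated and makes them small enough to compete with thick trees.\<close>
inductive bintree :: "nat \<Rightarrow> nat \<Rightarrow> 'a \<Rightarrow> 'a set \<Rightarrow> 'a set set \<Rightarrow> bool" for k where
  base: "\<lbrakk>card g = k; card f = k; d \<in> g; c \<noteq> d; g \<inter> f = {c}\<rbrakk> \<Longrightarrow> bintree k 2 d (g \<union> f) {g, f}"
| step: "\<lbrakk>bintree k j c V1 E1; bintree k j y V2 E2; card g = k; d \<in> g; d \<noteq> c; d \<noteq> y; c \<noteq> y;
    g \<inter> V1 = {c}; g \<inter> V2 = {y}; V1 \<inter> V2 = {}\<rbrakk> \<Longrightarrow> bintree k (Suc j) d (g \<union> V1 \<union> V2) (insert g (E1 \<union> E2))"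

lemma single_bacyclic: "bacyclic {g}"
  unfolding bacyclic_def reach_def using bpath_basic(5) bpath_empty by fastforce

lemma single_len: "bpath {g} u w A W \<Longrightarrow> card A \<le> 1"
  using bpath_basic(5)[of "{g}" u w A W] card_mono[of "{g}" A] by simp

context
  fixes k :: nat
  assumes k3: "k \<ge> 3"
begin

lemma bintree_basic:
  "bintree k j d V E \<Longrightarrow> finite V \<and> d \<in> V \<and> (\<forall>e\<in>E. e \<subseteq> V \<and> card e = k) \<and> finite E \<and> 2 \<le> j \<and> card E + 1 = 3 * 2 ^ (j - 2)"
proof (induction rule: bintree.induct)
  case (base g f d c)
  have "g \<noteq> f"
  proof
    assume "g = f"
    then have "d = c" using inter_singletonD(3)[OF base(5), of d] base(3) by simp
    then show False using base(4) by simp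
  qed
  moreover have "finite g" "finite f" using base k3 by (simp_all add: card_ge_0_finite)
  ultimately show ?case using base by simp
next
  case (step j c V1 E1 y V2 E2 g d)
  have E12: "E1 \<inter> E2 = {}"
  proof (rule ccontr)
    assume "E1 \<inter> E2 \<noteq> {}"
    then obtain e where e: "e \<in> E1" "e \<in> E2" by blast
    have "e \<subseteq> V1" "e \<subseteq> V2" "card e = k" using step.IH e by simp_all
    then have "e = {}" using step.hyps(10) by blast
    then show False using \<open>card e = k\<close> k3 by simp
  qed
  have d12: "d \<notin> V1" "d \<notin> V2" using inter_singletonD(3)[OF step.hyps(8), of d] inter_singletonD(3)[OF step.hyps(9), of d] step.hyps by auto
  have "g \<notin> E1" "g \<notin> E2" using step.IH step.hyps(4) d12 by auto
  then have "card (insert g (E1 \<union> E2)) = Suc (card E1 + card E2)" using step.IH E12 by (simp add: card_Un_disjoint)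
  moreover have "Suc j - 2 = Suc (j - 2)" using step.IH by arith
  then have "(2::nat) ^ (Suc j - 2) = 2 * 2 ^ (j - 2)" by simp
  moreover have "finite g" using step k3 by (simp add: card_ge_0_finite)
  ultimately show ?case using step.IH step.hyps by auto
qed

lemma bintree_tree: "bintree k j d V E \<Longrightarrow> bacyclic E \<and> (\<forall>x\<in>V. reach E d x)"
proof (induction rule: bintree.induct)
  case (base g f d c)
  have "bacyclic ({g} \<union> {f})" by (rule glue_bacyclic[of g f c]) (use base single_bacyclic in auto)
  moreover have "reach {g, f} d x" if "x \<in> g \<union> f" for x
  proof (cases "x \<in> g")
    case True
    then show ?thesis using base by (intro reach_edge[of g]) auto
  next
    case False
    have "c \<in> g" "c \<in> f" "x \<in> f" using base that False by blast+
    then have "reach {g, f} d c" "reach {g, f} c x" using base by (auto intro: reach_edge[of g] reach_edge[of f])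
    then show ?thesis by (rule reach_trans)
  qed
  ultimately show ?case by (simp add: insert_commute)
next
  case (step j c V1 E1 y V2 E2 g d)
  note b1 = bintree_basic[OF step(1)] and b2 = bintree_basic[OF step(2)]
  have s1: "bacyclic ({g} \<union> E1)" by (rule glue_bacyclic[of g V1 c]) (use step b1 single_bacyclic in auto)
  have "bacyclic (({g} \<union> E1) \<union> E2)" by (rule glue_bacyclic[of "g \<union> V1" V2 y]) (use step b1 b2 s1 in auto)
  moreover have "reach (insert g (E1 \<union> E2)) d x" if x: "x \<in> g \<union> V1 \<union> V2" for x
  proof -
    let ?E = "insert g (E1 \<union> E2)"
    have gx: "reach ?E d z" if "z \<in> g" for z using step.hyps that by (intro reach_edge[of g]) auto
    have cg: "c \<in> g" "y \<in> g" using step.hyps by blast+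
    consider "x \<in> g" | "x \<in> V1" | "x \<in> V2" using x by blast
    then show ?thesis
    proof cases
      case 1 then show ?thesis by (rule gx)
    next
      case 2
      then have "reach E1 c x" using step.IH by blast
      then have "reach ?E c x" by (rule reach_mono) blast
      then show ?thesis by (rule reach_trans[OF gx[OF cg(1)]])
    next
      case 3
      then have "reach E2 y x" using step.IH by blast
      then have "reach ?E y x" by (rule reach_mono) blast
      then show ?thesis by (rule reach_trans[OF gx[OF cg(2)]])
    qed
  qed
  ultimately show ?case by simp
qed

text \<open>A longest path of a tree of height \<open>j + 1\<close> runs through the top edge \<open>g\<close>, from one of the two
  subtrees of height \<open>j\<close> to the other.\<close>
lemma bintree_len: "bintree k j d V E \<Longrightarrow> (\<forall>u w A W. bpath E u w A W \<longrightarrow> card A \<le> 2 * j - 1) \<and> (\<forall>w A W. bpath E d w A W \<longrightarrow> card A \<le> j)"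
proof (induction rule: bintree.induct)
  case (base g f d c)
  have "card A \<le> 2" if "bpath {g, f} u w A W" for u w A W
  proof -
    have "card A \<le> card {g, f}" using bpath_basic(5)[OF that] by (intro card_mono) auto
    also have "\<dots> \<le> 2" by (simp add: card_insert_if)
    finally show ?thesis .
  qed
  then show ?case by (fastforce intro: order_trans)
next
  case (step j c V1 E1 y V2 E2 g d)
  note b1 = bintree_basic[OF step(1)] and b2 = bintree_basic[OF step(2)]
  have bintree: "bintree k (Suc j) d (g \<union> V1 \<union> V2) (insert g (E1 \<union> E2))" using step.hyps by (intro bintree.step)
  have sepE: "bacyclic (({g} \<union> E1) \<union> E2)" using bintree_tree[OF bintree] by simp
  have sep1: "bacyclic ({g} \<union> E1)" using bacyclic_sub[OF sepE] by blast
  have cg: "c \<in> g" "y \<in> g" "c \<in> V1" "y \<in> V2" "y \<notin> V1" "d \<notin> V1" "d \<notin> V2" using step.hyps by blast+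
  have G1a: "card A \<le> 2 * j + 1" if "bpath ({g} \<union> E1) u w A W" for u w A W
  proof (rule glue_len[of g V1 c "{g}" E1 "2 * j + 1" 1 j, OF _ _ _ _ _ _ _ _ that])
    show "e \<subseteq> V1" if "e \<in> E1" for e using that b1 by blast
    show "card A \<le> 2 * j + 1" if "bpath {g} u w A W" for u w A W using single_len[OF that] by simp
    show "card A \<le> 2 * j + 1" if "bpath E1 u w A W" for u w A W using that step.IH(1) by (meson diff_le_self le_trans trans_le_add1)
    show "card A \<le> 1" if "bpath {g} c w A W" for w A W using single_len[OF that] .
    show "card A \<le> j" if "bpath E1 c w A W" for w A W using that step.IH(1) by blast
  qed (use step.hyps in auto)
  have G1s: "card A \<le> j + 1" if "bpath ({g} \<union> E1) s w A W" "s \<in> g" "s \<noteq> c" for s w A W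
  proof (rule glue_len_from[of g V1 c "{g}" E1 s "j + 1" 1 j, OF _ _ _ _ _ _ _ _ _ that(1)])
    show "e \<subseteq> V1" if "e \<in> E1" for e using that b1 by blast
    show "card A \<le> j + 1" if "bpath {g} s w A W" for w A W using single_len[OF that] by simp
    show "card A \<le> 1" if "bpath {g} s c A W" for A W using single_len[OF that] .
    show "card A \<le> j" if "bpath E1 c w A W" for w A W using that step.IH(1) by blast
  qed (use step.hyps that in auto)
  have all: "card A \<le> 2 * j + 1" if "bpath (({g} \<union> E1) \<union> E2) u w A W" for u w A W
  proof (rule glue_len[of "g \<union> V1" V2 y "{g} \<union> E1" E2 "2 * j + 1" "j + 1" j, OF _ _ _ _ _ _ _ _ that])
    show "(g \<union> V1) \<inter> V2 = {y}" using step.hyps by blast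
    show "e \<subseteq> g \<union> V1" if "e \<in> {g} \<union> E1" for e using that b1 by blast
    show "e \<subseteq> V2" if "e \<in> E2" for e using that b2 by blast
    show "card A \<le> 2 * j + 1" if "bpath ({g} \<union> E1) u w A W" for u w A W using G1a[OF that] .
    show "card A \<le> 2 * j + 1" if "bpath E2 u w A W" for u w A W using that step.IH(2) by (meson diff_le_self le_trans trans_le_add1)
    show "card A \<le> j + 1" if "bpath ({g} \<union> E1) y w A W" for w A W using G1s[OF that] step cg by blast
    show "card A \<le> j" if "bpath E2 y w A W" for w A W using that step.IH(2) by blast
  qed simp
  have from_d: "card A \<le> j + 1" if "bpath (({g} \<union> E1) \<union> E2) d w A W" for w A W
  proof (rule glue_len_from[of "g \<union> V1" V2 y "{g} \<union> E1" E2 d "j + 1" 1 j, OF _ _ _ _ _ _ _ _ _ that])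
    show "(g \<union> V1) \<inter> V2 = {y}" using step.hyps by blast
    show "e \<subseteq> g \<union> V1" if "e \<in> {g} \<union> E1" for e using that b1 by blast
    show "e \<subseteq> V2" if "e \<in> E2" for e using that b2 by blast
    show "d \<in> g \<union> V1" "d \<noteq> y" using step by blast+
    show "card A \<le> j + 1" if "bpath ({g} \<union> E1) d w A W" for w A W using G1s[OF that] step by blast
    show "card A \<le> 1" if "bpath ({g} \<union> E1) d y A W" for A W using bacyclic_path_in_edge[OF sep1 _ _ _ that, of g] step cg by blast
    show "card A \<le> j" if "bpath E2 y w A W" for w A W using that step.IH(2) by blast
  qed simp
  have eq: "insert g (E1 \<union> E2) = ({g} \<union> E1) \<union> E2" by blast
  show ?case unfolding eq using all from_d by simp
qed

lemma ex_other:
  assumes "card (g :: 'a set) = k"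
  shows "\<exists>x\<in>g. x \<noteq> a \<and> x \<noteq> b"
proof (rule ccontr)
  assume "\<not> ?thesis"
  then have "g \<subseteq> {a, b}" by blast
  then have "card g \<le> card {a, b}" by (intro card_mono) auto
  also have "\<dots> \<le> 2" by (simp add: card_insert_if)
  finally show False using assms k3 by simp
qed

lemma bintree_down: "bintree k j d V E \<Longrightarrow> \<exists>x A W. bpath E d x A W \<and> card A = j \<and> W \<subseteq> V"
proof (induction rule: bintree.induct)
  case (base g f d c)
  obtain x where x: "x \<in> f" "x \<noteq> c" using ex_other base by metis
  note i = inter_singletonD[OF base(5)]
  have n: "c \<in> g" "c \<in> f" "d \<notin> f" "x \<notin> g" using i base(3,4) x by metis+
  then have gf: "g \<noteq> f" using x by blast
  have dx: "d \<noteq> x" "c \<noteq> x" "d \<noteq> c" using n base x by blast+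
  have "bpath {g, f} d c {g} {d, c}" "bpath {g, f} c x {f} {c, x}"
    using n base x dx by (auto intro!: bpath_single)
  from bpath_concat[OF this] have "bpath {g, f} d x ({g} \<union> {f}) ({d, c} \<union> {c, x})"
    using gf dx by simp
  moreover have "card ({g} \<union> {f}) = 2" using gf by simp
  moreover have "{d, c} \<union> {c, x} \<subseteq> g \<union> f" using base x by blast
  ultimately show ?case by blast
next
  case (step j c V1 E1 y V2 E2 g d)
  note b1 = bintree_basic[OF step(1)]
  obtain x A W where P: "bpath E1 c x A W" "card A = j" "W \<subseteq> V1" using step by blast
  have n: "g \<notin> E1" "d \<notin> V1" "c \<in> g" using b1 step.hyps by blast+
  have gA: "g \<notin> A" using n bpath_basic(5)[OF P(1)] by blast
  have "bpath (insert g (E1 \<union> E2)) c x A W" by (rule bpath_mono[OF P(1)]) blast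
  then have "bpath (insert g (E1 \<union> E2)) d x (insert g A) (insert d W)" using n gA step.hyps P by (intro bpath.cons) auto
  moreover have "card (insert g A) = Suc j" using gA P bpath_basic(1)[OF P(1)] by simp
  moreover have "insert d W \<subseteq> g \<union> V1 \<union> V2" using P step.hyps by blast
  ultimately show ?case by blast
qed

end

lemma bpath_cons': "\<lbrakk>bpath E v w A V; a \<in> E; u \<in> a; v \<in> a; a \<notin> A; u \<notin> V\<rbrakk> \<Longrightarrow> bpath E u w (insert a A) (insert u V) \<and> card (insert a A) = Suc (card A)"
  using bpath.cons[of a E u v A V w] bpath_basic(1)[of E v w A V] by simp

lemma reach_path_in:
  assumes "reach E u v" "u \<in> V" "\<And>e. e \<in> E \<Longrightarrow> e \<subseteq> V"
  obtains A W where "bpath E u v A W" "W \<subseteq> V" "A \<subseteq> E" "u \<noteq> v \<Longrightarrow> 1 \<le> card A"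
proof -
  obtain A W where b: "bpath E u v A W" using assms unfolding reach_def by blast
  have "1 \<le> card A" if "u \<noteq> v"
  proof -
    have "A \<noteq> {}" using that b bpath_empty by metis
    then show ?thesis using bpath_basic(1)[OF b] by (simp add: Suc_le_eq card_gt_0_iff)
  qed
  then show ?thesis using that[OF b bpath_in[OF b assms(2,3)] bpath_basic(5)[OF b]] by blast
qed

context
  fixes k :: nat
  assumes k3: "k \<ge> 3"
begin

text \<open>From every vertex other than the root one can climb to the top edge and descend in the other
  subtree.  In a tree of height 2 this fails at the one vertex \<open>sp\<close> shared by both edges, from where
  only one edge can be used without visiting the root.\<close>
lemma bintree_W:
  assumes "bintree k j d V E"
  shows "\<exists>sp\<in>V - {d}. (\<forall>w\<in>V - {d}. \<exists>x A W. bpath E w x A W \<and> W \<subseteq> V - {d} \<and> j - 1 \<le> card A \<and> (w \<noteq> sp \<or> 3 \<le> j \<longrightarrow> j \<le> card A))"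
  using assms
proof (cases rule: bintree.cases)
  case (base g f c)
  note i = inter_singletonD[OF base(8)]
  have df: "d \<notin> f" using i(3)[OF base(6)] base(7) by auto
  have gf: "g \<noteq> f" using df base(6) by auto
  obtain x where x: "x \<in> g" "x \<noteq> d" "x \<noteq> c" using ex_other[OF k3 base(4)] by metis
  obtain q where q: "q \<in> f" "q \<noteq> c" using ex_other[OF k3 base(5)] by metis
  have qg: "v \<notin> g" if "v \<in> f" "v \<noteq> c" for v using i(3) that by metis
  have xf: "v \<notin> f" if "v \<in> g" "v \<noteq> c" for v using i(3) that by metis
  have cd: "c \<in> V - {d}" using base(2,7) i(1) by simp
  show ?thesis
  proof (rule bexI[OF _ cd], intro ballI)
    fix w assume w: "w \<in> V - {d}"
    consider "w = c" | "w \<in> g" "w \<noteq> c" | "w \<in> f" "w \<noteq> c" using w base by blast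
    then show "\<exists>x A W. bpath E w x A W \<and> W \<subseteq> V - {d} \<and> j - 1 \<le> card A \<and> (w \<noteq> c \<or> 3 \<le> j \<longrightarrow> j \<le> card A)"
    proof cases
      case 1
      have "bpath E c q {f} {c, q}" using base i(1,2) q by (intro bpath_single) auto
      moreover have "{c, q} \<subseteq> V - {d}" using base cd q df by auto
      ultimately show ?thesis using 1 base by (intro exI[of _ q] exI[of _ "{f}"] exI[of _ "{c, q}"]) auto
    next
      case 2
      have 1: "bpath E c q {f} {c, q}" using base i(1,2) q by (intro bpath_single) auto
      have "w \<noteq> q" using xf[OF 2] q by blast
      with bpath_cons'[OF 1, of g w] have "bpath E w q {g, f} {w, c, q}" "card {g, f} = 2" using 2 i(1,2) base gf by auto
      moreover have "{w, c, q} \<subseteq> V - {d}" using base cd q df w by auto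
      ultimately show ?thesis using base by (intro exI[of _ q] exI[of _ "{g, f}"] exI[of _ "{w, c, q}"]) auto
    next
      case 3
      have 1: "bpath E c x {g} {c, x}" using base i(1,2) x by (intro bpath_single) auto
      have "w \<noteq> x" using qg[OF 3] x by blast
      with bpath_cons'[OF 1, of f w] have "bpath E w x {f, g} {w, c, x}" "card {f, g} = 2" using 3 i(1,2) base gf by auto
      moreover have "{w, c, x} \<subseteq> V - {d}" using base cd x w by auto
      ultimately show ?thesis using base by (intro exI[of _ x] exI[of _ "{f, g}"] exI[of _ "{w, c, x}"]) auto
    qed
  qed
next
  case (step j' c V1 E1 y V2 E2 g)
  note i1 = inter_singletonD[OF step(11)] and i2 = inter_singletonD[OF step(12)]
  note b1 = bintree_basic[OF k3 step(4)] and b2 = bintree_basic[OF k3 step(5)]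
  have d: "d \<notin> V1" "d \<notin> V2" using i1(3)[of d] i2(3)[of d] step(7-9) by auto
  have nc: "y \<notin> V1" "c \<notin> V2" using i1(3)[of y] i2(3)[of c] i1(1) i2(1) step(10) by auto
  have gE: "g \<notin> E1" "g \<notin> E2" using b1 b2 d step(7) by auto
  have cd: "c \<in> V - {d}" using step(2,8) i1(1) by auto
  have half: "\<exists>x A W. bpath E w x A W \<and> W \<subseteq> V - {d} \<and> Suc j' \<le> card A"
    if h: "w \<in> Va" "bintree k j' a Va Ea" "bintree k j' b Vb Eb" "a \<in> g" "b \<in> g" "Va \<inter> Vb = {}" "Va \<subseteq> V - {d}" "Vb \<subseteq> V - {d}" "Ea \<subseteq> E" "Eb \<subseteq> E" "g \<notin> Ea" "g \<notin> Eb" for w a b Va Vb Ea Eb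
  proof -
    note ba = bintree_basic[OF k3 h(2)] and bb = bintree_basic[OF k3 h(3)]
    have "reach Ea a w" using bintree_tree[OF k3 h(2)] h(1) by simp
    then have "reach Ea w a" by (rule reach_sym)
    then obtain A W where A: "bpath Ea w a A W" "W \<subseteq> Va" "A \<subseteq> Ea" by (rule reach_path_in[of Ea w a Va]) (use h ba in auto)
    from bintree_down[OF k3 h(3)] obtain x B Z where B: "bpath Eb b x B Z" "card B = j'" "Z \<subseteq> Vb" by blast
    have BE: "B \<subseteq> Eb" using bpath_basic(5)[OF B(1)] .
    have A': "bpath E a w A W" "bpath E b x B Z" using bpath_rev[OF bpath_mono[OF A(1) h(9)]] bpath_mono[OF B(1) h(10)] .
    have AB: "A \<inter> B = {}"
    proof (rule ccontr)
      assume "A \<inter> B \<noteq> {}"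
      then obtain e where e: "e \<in> Ea" "e \<in> Eb" using A BE by blast
      then have "e \<subseteq> Va" "e \<subseteq> Vb" "card e = k" using ba bb by auto
      then have "e = {}" using h(6) by blast
      then show False using \<open>card e = k\<close> k3 by simp
    qed
    have "W \<inter> Z = {}" using A(2) B(3) h(6) by blast
    moreover have "g \<notin> A" "g \<notin> B" using A(3) BE h by auto
    moreover have "g \<in> E" using step by simp
    ultimately have "bpath E w x (insert g (A \<union> B)) (W \<union> Z)" "card (insert g (A \<union> B)) = Suc (card A + card B)"
      using bpath_join[OF A' _ h(4,5)] bpath_join_card[OF A' _ h(4,5)] AB by auto
    moreover have "W \<union> Z \<subseteq> V - {d}" using A(2) B(3) h(7,8) by blast
    ultimately show ?thesis using B(2) by (intro exI[of _ x] exI[of _ "insert g (A \<union> B)"] exI[of _ "W \<union> Z"]) auto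
  qed
  have sub: "V1 \<subseteq> V - {d}" "V2 \<subseteq> V - {d}" "E1 \<subseteq> E" "E2 \<subseteq> E" using step d by auto
  have all: "\<exists>x A W. bpath E w x A W \<and> W \<subseteq> V - {d} \<and> Suc j' \<le> card A" if w: "w \<in> V - {d}" for w
  proof -
    consider "w \<in> V1" | "w \<in> V2" | "w \<in> g" "w \<notin> V1" "w \<notin> V2" using w step by blast
    then show ?thesis
    proof cases
      case 1 show ?thesis by (rule half[OF 1 step(4,5) i1(1) i2(1) step(13) sub gE])
    next
      case 2
      have "V2 \<inter> V1 = {}" using step(13) by blast
      then show ?thesis by (rule half[OF 2 step(5,4) i2(1) i1(1) _ sub(2,1,4,3) gE(2,1)])
    next
      case 3
      from bintree_down[OF k3 step(5)] obtain x B Z where B: "bpath E2 y x B Z" "card B = j'" "Z \<subseteq> V2" by blast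
      have "bpath E y x B Z" using bpath_mono[OF B(1) sub(4)] .
      moreover have "g \<notin> B" using bpath_basic(5)[OF B(1)] gE by blast
      moreover have "g \<in> E" "w \<notin> Z" using step B 3 by auto
      ultimately have "bpath E w x (insert g B) (insert w Z) \<and> card (insert g B) = Suc (card B)"
        using bpath_cons'[of E y x B Z g w] 3 i2 by blast
      moreover have "insert w Z \<subseteq> V - {d}" using B sub w by blast
      ultimately show ?thesis using B by (intro exI[of _ x] exI[of _ "insert g B"] exI[of _ "insert w Z"]) auto
    qed
  qed
  show ?thesis
  proof (rule bexI[OF _ cd], intro ballI)
    fix w assume "w \<in> V - {d}"
    from all[OF this] obtain x A W where "bpath E w x A W" "W \<subseteq> V - {d}" "Suc j' \<le> card A" by blast
    then show "\<exists>x A W. bpath E w x A W \<and> W \<subseteq> V - {d} \<and> j - 1 \<le> card A \<and> (w \<noteq> c \<or> 3 \<le> j \<longrightarrow> j \<le> card A)"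
      using step(1) by (intro exI[of _ x] exI[of _ A] exI[of _ W]) auto
  qed
qed

lemma bintree_disj:
  assumes "bintree k j a Va Ea" "bintree k j' b Vb Eb" "card (Va \<inter> Vb) \<le> 1"
  shows "Ea \<inter> Eb = {}"
proof (rule ccontr)
  note ba = bintree_basic[OF k3 assms(1)] and bb = bintree_basic[OF k3 assms(2)]
  assume "Ea \<inter> Eb \<noteq> {}"
  then obtain e where e: "e \<in> Ea" "e \<in> Eb" by blast
  then have "e \<subseteq> Va \<inter> Vb" "card e = k" using ba bb by auto
  moreover have "finite (Va \<inter> Vb)" using ba by simp
  ultimately show False using card_mono[of "Va \<inter> Vb" e] assms(3) k3 by simp
qed

end

context
  fixes k :: nat
  assumes k3: "k \<ge> 3"
begin

definition gains :: "'a set set \<Rightarrow> 'a set \<Rightarrow> 'a \<Rightarrow> nat \<Rightarrow> 'a set \<Rightarrow> bool" where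
  "gains E V d j e \<longleftrightarrow> (\<exists>x A W. bpath (insert e E) d x A W \<and> W \<subseteq> V \<and> j + 1 \<le> card A)"

text \<open>The new edge \<open>e\<close> contains a vertex \<open>w\<close> strictly inside the first subtree and a vertex outside of
  it.  Depending on where the second vertex lies -- in the root, in the other subtree, or in the
  top edge only -- one enters the first or the second subtree through \<open>e\<close> and still has a full
  height to descend.  In the last case \<open>w\<close> must not be the exceptional vertex \<open>sp\<close>; as \<open>g\<close> has only
  \<open>k - 3\<close> vertices that carry no subtree and are not the root, \<open>e\<close> is large enough to offer
  another choice.\<close>
lemma gain_step:
  assumes br1: "bintree k j c V1 E1" and br2: "bintree k j y V2 E2" and g: "card g = k" "d \<in> g" "d \<noteq> c" "d \<noteq> y" "c \<noteq> y"
    "g \<inter> V1 = {c}" "g \<inter> V2 = {y}" "V1 \<inter> V2 = {}"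
    and e: "e \<subseteq> g \<union> V1 \<union> V2" "card e = k" "e \<noteq> g" "e \<notin> E1" "e \<notin> E2"
    and w: "w \<in> e" "w \<in> V1" "w \<noteq> c" and r: "r \<in> e" "r \<notin> V1"
  shows "gains (insert g (E1 \<union> E2)) (g \<union> V1 \<union> V2) d (Suc j) e"
proof -
  let ?E = "insert e (insert g (E1 \<union> E2))"
  note i1 = inter_singletonD[OF g(6)] and i2 = inter_singletonD[OF g(7)]
  note b1 = bintree_basic[OF k3 br1] and b2 = bintree_basic[OF k3 br2]
  have d: "d \<notin> V1" "d \<notin> V2" using i1(3)[of d] i2(3)[of d] g(2-4) by auto
  have nc: "y \<notin> V1" "c \<notin> V2" using i1(3)[of y] i2(3)[of c] i1(1) i2(1) g(5) by auto
  have gE: "g \<notin> E1" "g \<notin> E2" using b1 b2 d g(2) by auto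
  have sub: "E1 \<subseteq> ?E" "E2 \<subseteq> ?E" by auto
  have j2: "j \<ge> 2" using b1 by simp
  have E12: "E1 \<inter> E2 = {}" using bintree_disj[OF k3 br1 br2] g(8) by simp
  have wg: "w \<notin> g" using i1(3)[of w] w by auto
  have "reach E1 c w" using bintree_tree[OF k3 br1] w by simp
  then obtain A1 W1 where A1: "bpath E1 c w A1 W1" "W1 \<subseteq> V1" "A1 \<subseteq> E1" "c \<noteq> w \<Longrightarrow> 1 \<le> card A1"
    by (rule reach_path_in[of E1 c w V1]) (use b1 in auto)
  have cA1: "1 \<le> card A1" using A1(4) w(3) by auto
  obtain x2 A2 W2 where A2: "bpath E2 y x2 A2 W2" "card A2 = j" "W2 \<subseteq> V2" using bintree_down[OF k3 br2] by blast
  have A2E: "A2 \<subseteq> E2" using bpath_basic(5)[OF A2(1)] .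
  have P1: "bpath ?E c w A1 W1" by (rule bpath_mono[OF A1(1) sub(1)])
  have P2: "bpath ?E y x2 A2 W2" by (rule bpath_mono[OF A2(1) sub(2)])
  have fA: "finite A1" "finite A2" using bpath_basic(1) A1(1) A2(1) by metis+
  have eg: "e \<notin> A1" "e \<notin> A2" "g \<notin> A1" "g \<notin> A2" "A1 \<inter> A2 = {}" using A1(3) A2E e gE E12 by auto
  have dW: "d \<notin> W1" "d \<notin> W2" "W1 \<inter> W2 = {}" "y \<notin> W1" "c \<notin> W2" "w \<notin> W2" using A1(2) A2(3) d g(8) nc w by auto
  obtain sp where sp: "\<And>w. w \<in> V1 - {c} \<Longrightarrow> \<exists>x A W. bpath E1 w x A W \<and> W \<subseteq> V1 - {c} \<and> j - 1 \<le> card A \<and> (w \<noteq> sp \<or> 3 \<le> j \<longrightarrow> j \<le> card A)" "sp \<in> V1 - {c}"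
    using bintree_W[OF k3 br1] by blast
  have big: "?thesis" if "bpath ?E d x A W" "W \<subseteq> g \<union> V1 \<union> V2" "j + 2 \<le> card A" for x A W
    using that unfolding gains_def by auto
  show ?thesis
  proof (cases "d \<in> e")
    case True
    have J: "bpath ?E w x2 (insert g (A1 \<union> A2)) (W1 \<union> W2)" "card (insert g (A1 \<union> A2)) = Suc (card A1 + card A2)"
      using bpath_join[OF P1 P2 _ i1(1) i2(1)] bpath_join_card[OF P1 P2 _ i1(1) i2(1)] eg dW by auto
    have "bpath ?E d x2 (insert e (insert g (A1 \<union> A2))) (insert d (W1 \<union> W2)) \<and> card (insert e (insert g (A1 \<union> A2))) = Suc (card (insert g (A1 \<union> A2)))"
      using eg dW e True w by (intro bpath_cons'[OF J(1)]) auto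
    then show ?thesis using J(2) A2 A1(2) g(2) cA1 by (intro big[of x2 "insert e (insert g (A1 \<union> A2))" "insert d (W1 \<union> W2)"]) auto
  next
    case de: False
    show ?thesis
    proof (cases "\<exists>r\<in>e. r \<in> V2")
      case True
      then obtain r where r: "r \<in> e" "r \<in> V2" by blast
      show ?thesis
      proof (cases "r = y")
        case True
        have J: "bpath ?E c x2 (insert e (A1 \<union> A2)) (W1 \<union> W2)" "card (insert e (A1 \<union> A2)) = Suc (card A1 + card A2)"
          using bpath_join[OF bpath_rev[OF P1] P2 _ w(1) r(1)[unfolded True]] bpath_join_card[OF bpath_rev[OF P1] P2 _ w(1) r(1)[unfolded True]] eg dW by auto
        have "bpath ?E d x2 (insert g (insert e (A1 \<union> A2))) (insert d (W1 \<union> W2)) \<and> card (insert g (insert e (A1 \<union> A2))) = Suc (card (insert e (A1 \<union> A2)))"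
          using eg dW e(3) g(2) i1(1) by (intro bpath_cons'[OF J(1)]) auto
        then show ?thesis using J(2) A2 A1(2) g(2) cA1 by (intro big[of x2 "insert g (insert e (A1 \<union> A2))" "insert d (W1 \<union> W2)"]) auto
      next
        case ry: False
        have "reach E2 y r" using bintree_tree[OF k3 br2] r by simp
        then obtain B Z where B: "bpath E2 y r B Z" "Z \<subseteq> V2" "B \<subseteq> E2" "y \<noteq> r \<Longrightarrow> 1 \<le> card B"
          by (rule reach_path_in[of E2 y r V2]) (use b2 in auto)
        have cB: "1 \<le> card B" using B(4) ry by auto
        obtain x A W where A: "bpath E1 w x A W" "W \<subseteq> V1 - {c}" "j - 1 \<le> card A" using sp(1)[of w] w by blast
        have AE: "A \<subseteq> E1" using bpath_basic(5)[OF A(1)] .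
        have P: "bpath ?E r y B Z" "bpath ?E w x A W" using bpath_rev[OF bpath_mono[OF B(1) sub(2)]] bpath_mono[OF A(1) sub(1)] .
        have n: "e \<notin> B" "e \<notin> A" "g \<notin> B" "g \<notin> A" "B \<inter> A = {}" using AE B(3) e gE E12 by auto
        have n2: "Z \<inter> W = {}" "d \<notin> Z" "d \<notin> W" using A(2) B(2) g(8) d by auto
        have J: "bpath ?E y x (insert e (B \<union> A)) (Z \<union> W)" "card (insert e (B \<union> A)) = Suc (card B + card A)"
          using bpath_join[OF P _ r(1) w(1)] bpath_join_card[OF P _ r(1) w(1)] n n2 by auto
        have "bpath ?E d x (insert g (insert e (B \<union> A))) (insert d (Z \<union> W)) \<and> card (insert g (insert e (B \<union> A))) = Suc (card (insert e (B \<union> A)))"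
          using n n2 e(3) g(2) i2(1) by (intro bpath_cons'[OF J(1)]) auto
        then show ?thesis using J(2) A B(2) g(2) cB j2 by (intro big[of x "insert g (insert e (B \<union> A))" "insert d (Z \<union> W)"]) auto
      qed
    next
      case noV2: False
      have rg: "z \<in> g - {d, c, y}" if "z \<in> e" "z \<notin> V1" for z
      proof -
        have "z \<notin> V2" using noV2 that by blast
        then have "z \<in> g" using e(1) that by blast
        moreover have "z \<noteq> y" using i2(2) \<open>z \<notin> V2\<close> by blast
        moreover have "z \<noteq> c" using i1(2) that by blast
        moreover have "z \<noteq> d" using de that by blast
        ultimately show ?thesis by blast
      qed
      show ?thesis
      proof (cases "\<exists>w'\<in>e \<inter> V1. w' \<noteq> c \<and> w' \<noteq> sp")
        case True
        then obtain w' where w': "w' \<in> e" "w' \<in> V1" "w' \<noteq> c" "w' \<noteq> sp" by blast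
        obtain x A W where A: "bpath E1 w' x A W" "W \<subseteq> V1 - {c}" "j \<le> card A" using sp(1)[of w'] w' by blast
        have AE: "A \<subseteq> E1" using bpath_basic(5)[OF A(1)] .
        have P: "bpath ?E w' x A W" using bpath_mono[OF A(1) sub(1)] .
        note rr = rg[OF r]
        have n: "e \<notin> A" "g \<notin> A" "r \<notin> W" "d \<notin> W" using AE e gE A(2) r d by auto
        have J: "bpath ?E r x (insert e A) (insert r W) \<and> card (insert e A) = Suc (card A)"
          using n r w' by (intro bpath_cons'[OF P]) auto
        have "bpath ?E d x (insert g (insert e A)) (insert d (insert r W)) \<and> card (insert g (insert e A)) = Suc (card (insert e A))"
          using n rr e(3) g(2) by (intro bpath_cons'[OF conjunct1[OF J]]) auto
        then show ?thesis using J A g(2) rr by (intro big[of x "insert g (insert e A)" "insert d (insert r W)"]) auto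
      next
        case False
        \<comment> \<open>Only vertices without a suitable partner are left, and there are fewer than \<open>k\<close> of them.\<close>
        have "e \<subseteq> (g - {d, c, y}) \<union> {c, sp}" using rg False by blast
        moreover have fg: "finite g" using g(1) k3 by (simp add: card_ge_0_finite)
        ultimately have "card e \<le> card ((g - {d, c, y}) \<union> {c, sp})" by (intro card_mono) auto
        also have "\<dots> \<le> card (g - {d, c, y}) + card {c, sp}" by (rule card_Un_le)
        finally have "card e \<le> card (g - {d, c, y}) + card {c, sp}" .
        moreover have "card (g - {d, c, y}) = k - 3"
          using fg g i1(1) i2(1) by (subst card_Diff_subset) auto
        moreover have "card {c, sp} \<le> 2" by (simp add: card_insert_if)
        ultimately have False using e(2) k3 by linarith
        then show ?thesis ..
      qed
    qed
  qed
qed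

text \<open>An additional edge prolongs the longest path from the root by one edge.  Inside a subtree this
  is the induction hypothesis, preceded by the top edge.\<close>
lemma bintree_gain: "bintree k j d V E \<Longrightarrow> e \<subseteq> V \<Longrightarrow> card e = k \<Longrightarrow> e \<notin> E \<Longrightarrow> gains E V d j e"
proof (induction rule: bintree.induct)
  case (base g f d c)
  note i = inter_singletonD[OF base(5)]
  have df: "d \<notin> f" using i(3)[of d] base(3,4) by auto
  have gf: "g \<noteq> f" using df base(3) by auto
  have fin: "finite g" "finite f" using base(1,2) k3 by (simp_all add: card_ge_0_finite)
  obtain x where x: "x \<in> g" "x \<noteq> d" "x \<noteq> c" using ex_other[OF k3 base(1)] by metis
  have "\<not> e \<subseteq> g" using card_subset_eq[OF fin(1), of e] base by auto
  then obtain p where p: "p \<in> e" "p \<notin> g" by blast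
  then have pf: "p \<in> f" "p \<noteq> c" using base(6) i(1) by auto
  have "\<not> e \<subseteq> f" using card_subset_eq[OF fin(2), of e] base by auto
  then obtain r where r: "r \<in> e" "r \<notin> f" by blast
  then have rg: "r \<in> g" "r \<noteq> c" using base(6) i(2) by auto
  have efg: "e \<noteq> f" "e \<noteq> g" using base(8) by auto
  let ?E = "insert e {g, f}"
  show ?case
  proof (cases "r = d")
    case True
    have 1: "bpath ?E c x {g} {c, x}" using i(1) x by (intro bpath_single) auto
    have "p \<noteq> x" "d \<noteq> p" using p x base(3) by auto
    have 2: "bpath ?E p x {f, g} {p, c, x} \<and> card {f, g} = Suc (card {g})"
      using pf i(2) gf \<open>p \<noteq> x\<close> by (intro bpath_cons'[OF 1]) auto
    have "bpath ?E d x {e, f, g} {d, p, c, x} \<and> card {e, f, g} = Suc (card {f, g})"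
      using p r True efg x base(4) \<open>d \<noteq> p\<close> by (intro bpath_cons'[OF conjunct1[OF 2]]) auto
    moreover have "{d, p, c, x} \<subseteq> g \<union> f" using base(3) pf i(1) x by simp
    ultimately show ?thesis using 2 unfolding gains_def by (intro exI[of _ x] exI[of _ "{e, f, g}"] exI[of _ "{d, p, c, x}"]) auto
  next
    case False
    have 1: "bpath ?E p c {f} {p, c}" using i(2) pf by (intro bpath_single) auto
    have "r \<noteq> p" "d \<noteq> p" using p rg base(3) by auto
    have 2: "bpath ?E r c {e, f} {r, p, c} \<and> card {e, f} = Suc (card {f})"
      using p r rg efg \<open>r \<noteq> p\<close> by (intro bpath_cons'[OF 1]) auto
    have "bpath ?E d c {g, e, f} {d, r, p, c} \<and> card {g, e, f} = Suc (card {e, f})"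
      using False rg efg gf base(3,4) \<open>d \<noteq> p\<close> by (intro bpath_cons'[OF conjunct1[OF 2]]) auto
    moreover have "{d, r, p, c} \<subseteq> g \<union> f" using base(3) pf rg i(1) by simp
    ultimately show ?thesis using 2 unfolding gains_def by (intro exI[of _ c] exI[of _ "{g, e, f}"] exI[of _ "{d, r, p, c}"]) auto
  qed
next
  case (step j c V1 E1 y V2 E2 g d)
  note i1 = inter_singletonD[OF step.hyps(8)] and i2 = inter_singletonD[OF step.hyps(9)]
  note b1 = bintree_basic[OF k3 step.hyps(1)] and b2 = bintree_basic[OF k3 step.hyps(2)]
  have d: "d \<notin> V1" "d \<notin> V2" using i1(3)[of d] i2(3)[of d] step.hyps(4-6) by auto
  have gE: "g \<notin> E1" "g \<notin> E2" using b1 b2 d step.hyps(4) by auto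
  have e: "e \<noteq> g" "e \<notin> E1" "e \<notin> E2" using step.prems(3) by auto
  have up: "gains (insert g (E1 \<union> E2)) (g \<union> V1 \<union> V2) d (Suc j) e"
    if G: "gains Ea Va a j e" and h: "a \<in> g" "d \<notin> Va" "g \<notin> Ea" "Va \<subseteq> V1 \<union> V2" "Ea \<subseteq> E1 \<union> E2" for a Va Ea
  proof -
    obtain x A W where A: "bpath (insert e Ea) a x A W" "W \<subseteq> Va" "j + 1 \<le> card A" using G unfolding gains_def by blast
    have AE: "A \<subseteq> insert e Ea" using bpath_basic(5)[OF A(1)] .
    have P: "bpath (insert e (insert g (E1 \<union> E2))) a x A W" by (rule bpath_mono[OF A(1)]) (use h in auto)
    have "bpath (insert e (insert g (E1 \<union> E2))) d x (insert g A) (insert d W) \<and> card (insert g A) = Suc (card A)"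
      using AE e(1) h step.hyps(4) A(2) by (intro bpath_cons'[OF P]) auto
    then show ?thesis using A h step.hyps(4) unfolding gains_def
      by (intro exI[of _ x] exI[of _ "insert g A"] exI[of _ "insert d W"]) auto
  qed
  consider "e \<subseteq> V1" | "e \<subseteq> V2" | "\<not> e \<subseteq> V1" "\<not> e \<subseteq> V2" by blast
  then show ?case
  proof cases
    case 1 show ?thesis by (rule up[OF step.IH(1)[OF 1 step.prems(2) e(2)] i1(1) d(1) gE(1)]) auto
  next
    case 2 show ?thesis by (rule up[OF step.IH(2)[OF 2 step.prems(2) e(3)] i2(1) d(2) gE(2)]) auto
  next
    case 3
    have fg: "finite g" using step.hyps(3) k3 by (simp add: card_ge_0_finite)
    have "\<not> e \<subseteq> g" using card_subset_eq[OF fg, of e] e(1) step.hyps(3) step.prems(2) by auto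
    then obtain w where w: "w \<in> e" "w \<notin> g" by blast
    then consider "w \<in> V1" | "w \<in> V2" using step.prems(1) by blast
    then show ?thesis
    proof cases
      case 1
      obtain r where "r \<in> e" "r \<notin> V1" using 3 by blast
      then show ?thesis
        using gain_step[OF step.hyps step.prems(1,2) e w(1) 1] w i1(1) by blast
    next
      case 2
      obtain r where r: "r \<in> e" "r \<notin> V2" using 3 by blast
      have V21: "V2 \<inter> V1 = {}" using step.hyps(10) by blast
      have e': "e \<subseteq> g \<union> V2 \<union> V1" using step.prems(1) by blast
      have wy: "w \<noteq> y" using w i2(1) by blast
      from gain_step[OF step.hyps(2,1,3,4,6,5) step.hyps(7)[symmetric] step.hyps(9,8) V21 e' step.prems(2) e(1,3,2) w(1) 2 wy r]
      show ?thesis by (simp add: Un_commute Un_left_commute)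
    qed
  qed
qed

lemma fresh_set: "finite (F::nat set) \<Longrightarrow> \<exists>S. finite S \<and> card S = n \<and> S \<inter> F = {}"
proof -
  assume "finite F"
  then have "infinite (UNIV - F)" by simp
  then obtain B where "finite B" "card B = n" "B \<subseteq> UNIV - F" using infinite_arbitrarily_large by blast
  then show ?thesis by blast
qed

lemma bintree_exists: "\<And>F (d::nat). finite F \<Longrightarrow> \<exists>V E. bintree k (j + 2) d V E \<and> V \<inter> F \<subseteq> {d}"
proof (induction j)
  case 0
  obtain S where S: "finite S" "card S = k - 1" "S \<inter> insert d F = {}" using fresh_set[of "insert d F" "k - 1"] 0 by auto
  obtain R where R: "finite R" "card R = k - 1" "R \<inter> (insert d F \<union> S) = {}" using fresh_set[of "insert d F \<union> S" "k - 1"] 0 S by auto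
  obtain c where c: "c \<in> S" using S k3 by fastforce
  let ?g = "insert d S" let ?f = "insert c R"
  have "c \<notin> R" "d \<notin> S" using S R c by auto
  then have "card ?g = k" "card ?f = k" using S R k3 by auto
  then have "bintree k 2 d (?g \<union> ?f) {?g, ?f}" using S R c by (intro bintree.base[of _ _ _ _ c]) auto
  moreover have "(?g \<union> ?f) \<inter> F \<subseteq> {d}" using S R c by auto
  moreover have "(0::nat) + 2 = 2" by simp
  ultimately show ?case by metis
next
  case (Suc j)
  obtain S where S: "finite S" "card S = k - 1" "S \<inter> insert d F = {}" using fresh_set[of "insert d F" "k - 1"] Suc by auto
  have "\<not> card S \<le> Suc 0" using S k3 by simp
  then obtain c y where cy: "c \<in> S" "y \<in> S" "c \<noteq> y" using card_le_Suc0_iff_eq[OF S(1)] by blast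
  let ?g = "insert d S"
  have fF: "finite (F \<union> ?g)" using Suc.prems S by simp
  obtain V1 E1 where V1: "bintree k (j + 2) c V1 E1" "V1 \<inter> (F \<union> ?g) \<subseteq> {c}" using Suc.IH[OF fF, of c] by blast
  have fV1: "finite V1" "c \<in> V1" using bintree_basic[OF k3 V1(1)] by auto
  have fF2: "finite (F \<union> ?g \<union> V1)" using fF fV1 by simp
  obtain V2 E2 where V2: "bintree k (j + 2) y V2 E2" "V2 \<inter> (F \<union> ?g \<union> V1) \<subseteq> {y}" using Suc.IH[OF fF2, of y] by blast
  have yV2: "y \<in> V2" using bintree_basic[OF k3 V2(1)] by auto
  have yV1: "y \<notin> V1" using V1(2) cy by auto
  have "bintree k (Suc (j + 2)) d (?g \<union> V1 \<union> V2) (insert ?g (E1 \<union> E2))"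
  proof (rule bintree.step[OF V1(1) V2(1)])
    show "card ?g = k" using S k3 by simp
    show "?g \<inter> V1 = {c}" using V1(2) cy fV1 by auto
    show "?g \<inter> V2 = {y}" using V2(2) cy yV2 by auto
    show "V1 \<inter> V2 = {}" using V2(2) yV1 by auto
  qed (use cy S in auto)
  moreover have "(?g \<union> V1 \<union> V2) \<inter> F \<subseteq> {d}" using V1(2) V2(2) S cy by auto
  ultimately show ?case by auto
qed

text \<open>Two binary trees are glued at their roots.  An additional edge inside one of them prolongs the
  longest path from the root there, and the other tree continues it; an edge across joins two long
  paths that both avoid the root.\<close>
theorem ex_bintree_pair:
  assumes pq: "3 \<le> q" "q \<le> p" "p \<le> q + 1"
  shows "\<exists>(V::nat set) E. saturated k (p + q + 1) V E \<and> bacyclic E \<and> (\<forall>x\<in>V. \<forall>y\<in>V. reach E x y) \<and> has_path E (p + q) \<and>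
    card E + 2 = 3 * 2 ^ (p - 2) + 3 * 2 ^ (q - 2) \<and> k + 1 \<le> card V"
proof -
  define v :: nat where "v = 0"
  obtain V1 E1 where 1: "bintree k (p - 2 + 2) v V1 E1" using bintree_exists[of "{}" "p - 2" v] by auto
  moreover have "p - 2 + 2 = p" "q - 2 + 2 = q" using pq by auto
  ultimately have br1: "bintree k p v V1 E1" and qq: "q - 2 + 2 = q" by metis+
  have f1: "finite V1" using bintree_basic[OF k3 br1] by auto
  obtain V2 E2 where 2: "bintree k (q - 2 + 2) v V2 E2" "V2 \<inter> V1 \<subseteq> {v}" using bintree_exists[OF f1, of "q - 2" v] by auto
  then have br2: "bintree k q v V2 E2" using qq by metis
  note b1 = bintree_basic[OF k3 br1] and b2 = bintree_basic[OF k3 br2]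
  have i: "V1 \<inter> V2 = {v}" using 2(2) b1 b2 by auto
  have E12: "E1 \<inter> E2 = {}" using bintree_disj[OF k3 br1 br2] i by simp
  let ?E = "E1 \<union> E2" let ?V = "V1 \<union> V2"
  have sepE: "bacyclic ?E" by (rule glue_bacyclic[OF i]) (use b1 b2 bintree_tree[OF k3 br1] bintree_tree[OF k3 br2] in auto)
  have rv: "reach ?E v x" if "x \<in> ?V" for x
  proof (cases "x \<in> V1")
    case True
    then have "reach E1 v x" using bintree_tree[OF k3 br1] by simp
    then show ?thesis by (rule reach_mono) simp
  next
    case False
    then have "reach E2 v x" using bintree_tree[OF k3 br2] that by simp
    then show ?thesis by (rule reach_mono) simp
  qed
  have con: "reach ?E x y" if "x \<in> ?V" "y \<in> ?V" for x y
    by (rule reach_trans[OF reach_sym[OF rv[OF that(1)]] rv[OF that(2)]])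
  note l1 = bintree_len[OF k3 br1] and l2 = bintree_len[OF k3 br2]
  have len: "card A \<le> p + q" if "bpath ?E u w A W" for u w A W
  proof (rule glue_len[OF i, of E1 E2 "p + q" p q, OF _ _ _ _ _ _ _ that])
    show "card A \<le> p + q" if "bpath E1 u w A W" for u w A W
    proof -
      have "card A \<le> 2 * p - 1" using l1 that by blast
      then show ?thesis using pq by simp
    qed
    show "card A \<le> p + q" if "bpath E2 u w A W" for u w A W
    proof -
      have "card A \<le> 2 * q - 1" using l2 that by blast
      then show ?thesis using pq by simp
    qed
    show "card A \<le> p" if "bpath E1 v w A W" for w A W using l1 that by blast
    show "card A \<le> q" if "bpath E2 v w A W" for w A W using l2 that by blast
  qed (use b1 b2 in auto)
  \<comment> \<open>Inside one tree a path has at most \<open>2 * p - 1\<close> edges, which is at most \<open>p + q\<close> as the heights are balanced.\<close>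
  have nolong: "\<not> has_path ?E (p + q + 1)" using len unfolding has_path_def by fastforce
  obtain x1 A1 W1 where A1: "bpath E1 v x1 A1 W1" "card A1 = p" "W1 \<subseteq> V1" using bintree_down[OF k3 br1] by blast
  obtain x2 A2 W2 where A2: "bpath E2 v x2 A2 W2" "card A2 = q" "W2 \<subseteq> V2" using bintree_down[OF k3 br2] by blast
  have two: "has_path F (card A + card B)"
    if h: "bpath F v x A W" "bpath F v y B Z" "A \<inter> B = {}" "W \<subseteq> V1" "Z \<subseteq> V2" for F x y A B W Z
  proof -
    have "W \<inter> Z = {v}" using h i bpath_basic(3)[OF h(1)] bpath_basic(3)[OF h(2)] by auto
    from bpath_concat[OF bpath_rev[OF h(1)] h(2,3) this] have "bpath F x y (A \<union> B) (W \<union> Z)" .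
    moreover have "card (A \<union> B) = card A + card B" using h bpath_basic(1)[OF h(1)] bpath_basic(1)[OF h(2)] by (simp add: card_Un_disjoint)
    ultimately show ?thesis by (intro has_pathI) auto
  qed
  have AE: "A1 \<subseteq> E1" "A2 \<subseteq> E2" using bpath_basic(5)[OF A1(1)] bpath_basic(5)[OF A2(1)] .
  have "A1 \<inter> A2 = {}" using AE E12 by auto
  then have hp: "has_path ?E (p + q)"
    using two[OF bpath_mono[OF A1(1)] bpath_mono[OF A2(1)], of ?E] A1 A2 AE E12 by auto
  have sat: "has_path (insert e ?E) (p + q + 1)" if e: "e \<subseteq> ?V" "card e = k" "e \<notin> ?E" for e
  proof -
    let ?F = "insert e ?E"
    have eA: "e \<notin> A1" "e \<notin> A2" using AE e by auto
    consider "e \<subseteq> V1" | "e \<subseteq> V2" | "\<not> e \<subseteq> V1" "\<not> e \<subseteq> V2" by blast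
    then show ?thesis
    proof cases
      case 1
      have "gains E1 V1 v p e" using bintree_gain[OF br1 1 e(2)] e(3) by simp
      then obtain x A W where A: "bpath (insert e E1) v x A W" "W \<subseteq> V1" "p + 1 \<le> card A" unfolding gains_def by blast
      have "A \<subseteq> insert e E1" using bpath_basic(5)[OF A(1)] .
      then have "A \<inter> A2 = {}" using AE eA E12 by auto
      then have "has_path ?F (card A + card A2)"
        using two[OF bpath_mono[OF A(1)] bpath_mono[OF A2(1)], of ?F] A A2 by auto
      then show ?thesis by (rule has_path_le) (use A A2 in simp)
    next
      case 2
      have "gains E2 V2 v q e" using bintree_gain[OF br2 2 e(2)] e(3) by simp
      then obtain x A W where A: "bpath (insert e E2) v x A W" "W \<subseteq> V2" "q + 1 \<le> card A" unfolding gains_def by blast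
      have "A \<subseteq> insert e E2" using bpath_basic(5)[OF A(1)] .
      then have "A1 \<inter> A = {}" using AE eA E12 by auto
      then have "has_path ?F (card A1 + card A)"
        using two[OF bpath_mono[OF A1(1)] bpath_mono[OF A(1)], of ?F] A A1 by auto
      then show ?thesis by (rule has_path_le) (use A A1 in simp)
    next
      case 3
      obtain u w where uw: "u \<in> e" "u \<notin> V2" "w \<in> e" "w \<notin> V1" using 3 by blast
      then have uw': "u \<in> V1 - {v}" "w \<in> V2 - {v}" using e(1) i by auto
      obtain x A W where A: "bpath E1 u x A W" "W \<subseteq> V1 - {v}" "p \<le> card A" using bintree_W[OF k3 br1] uw'(1) pq by fastforce
      obtain y B Z where B: "bpath E2 w y B Z" "Z \<subseteq> V2 - {v}" "q \<le> card B" using bintree_W[OF k3 br2] uw'(2) pq by fastforce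
      have AB: "A \<subseteq> E1" "B \<subseteq> E2" using bpath_basic(5)[OF A(1)] bpath_basic(5)[OF B(1)] .
      have n: "e \<notin> A" "e \<notin> B" "A \<inter> B = {}" "W \<inter> Z = {}" using AB e E12 A(2) B(2) i by auto
      have P: "bpath ?F u x A W" "bpath ?F w y B Z" by (rule bpath_mono[OF A(1)], blast) (rule bpath_mono[OF B(1)], blast)
      have "bpath ?F x y (insert e (A \<union> B)) (W \<union> Z)" "card (insert e (A \<union> B)) = Suc (card A + card B)"
        using bpath_join[OF P _ uw(1,3) n] bpath_join_card[OF P _ uw(1,3) n] by auto
      then show ?thesis using A(3) B(3) by (intro has_pathI) auto
    qed
  qed
  have "saturated k (p + q + 1) ?V ?E" unfolding saturated_def using b1 b2 nolong sat by auto
  moreover have "card ?E = card E1 + card E2" using E12 b1 b2 by (simp add: card_Un_disjoint)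
  moreover have "k + 1 \<le> card ?V"
  proof -
    have "E1 \<noteq> {}"
    proof
      assume "E1 = {}"
      then have "A1 = {}" using AE by simp
      then show False using A1 pq by simp
    qed
    then obtain a where a: "a \<in> E1" by blast
    have "\<exists>b\<in>?V. b \<notin> a"
    proof (rule ccontr)
      assume "\<not> ?thesis"
      then have "V2 \<subseteq> a" by blast
      then have "V2 \<subseteq> V1" using a b1 by blast
      then have "V2 \<subseteq> {v}" using i by blast
      moreover have "x2 \<in> V2" "x2 \<noteq> v" using bpath_basic(4)[OF A2(1)] A2 bpath_loop pq by (auto, fastforce)
      ultimately show False by blast
    qed
    then obtain b where b: "b \<in> ?V" "b \<notin> a" by blast
    have "a \<subseteq> V1" "card a = k" using a b1 by auto
    moreover have "finite a" using \<open>a \<subseteq> V1\<close> b1 finite_subset by auto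
    moreover have "finite ?V" using b1 b2 by simp
    ultimately show ?thesis using card_mono[of ?V "insert b a"] b by auto
  qed
  ultimately show ?thesis using sepE con hp b1 b2 by (intro exI[of _ ?V] exI[of _ ?E]) auto
qed

end

section \<open>Minimum saturated linear trees\<close>

lemma Berge_saturated_iff:
  assumes "t \<noteq> 0"
  shows "Berge_saturated k (path_graph (Suc t)) (V, E) \<longleftrightarrow> saturated k t V E"
proof -
  have un: "uniform k (V, E) \<longleftrightarrow> finite V \<and> (\<forall>e\<in>E. e \<subseteq> V \<and> card e = k)"
    unfolding uniform_def hypergraph_def by auto
  show ?thesis
  proof (cases "finite V \<and> (\<forall>e\<in>E. e \<subseteq> V \<and> card e = k)")
    case True
    then have h: "hypergraph (V, E)" unfolding hypergraph_def by auto
    have h2: "hypergraph (V, insert e E)" if "e \<subseteq> V" for e using True that unfolding hypergraph_def by auto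
    have c: "contains_Berge (path_graph (Suc t)) (add_edge (V, E) e) \<longleftrightarrow> has_path (insert e E) t" if "e \<subseteq> V" for e
      unfolding add_edge_def using contains_path_iff[OF h2[OF that] assms] by simp
    show ?thesis unfolding Berge_saturated_def saturated_def un contains_path_iff[OF h assms] using c by auto
  next
    case False
    then show ?thesis unfolding Berge_saturated_def saturated_def un by blast
  qed
qed

text \<open>The trees over which \<open>min_sat_tree\<close> takes the minimum.\<close>
definition sat_tree :: "nat \<Rightarrow> nat \<Rightarrow> 'a set \<Rightarrow> 'a set set \<Rightarrow> bool" where
  "sat_tree k t V E \<longleftrightarrow> saturated k t V E \<and> bacyclic E \<and> (\<forall>x\<in>V. \<forall>y\<in>V. reach E x y) \<and> k + 1 \<le> card V"

lemma sat_tree_iff: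
  assumes "t \<noteq> 0"
  shows "linear_tree (V, E) \<and> Berge_saturated k (path_graph (Suc t)) (V, E) \<and> k + 1 \<le> card V \<longleftrightarrow> sat_tree k t V E"
proof (cases "saturated k t V E \<and> k + 1 \<le> card V")
  case True
  then have S: "finite V" "\<And>e. e \<in> E \<Longrightarrow> e \<subseteq> V" "V \<noteq> {}" unfolding saturated_def by auto
  have h: "hypergraph (V, E)" using S unfolding hypergraph_def by auto
  have "(\<forall>l\<ge>2. \<not> has_Berge_cycle l (V, E)) \<longleftrightarrow> bacyclic E" using bacyclic_no_cycle no_cycle_bacyclic[of E V] S(2) by blast
  moreover have "connected_hypergraph (V, E) \<longleftrightarrow> (\<forall>x\<in>V. \<forall>y\<in>V. reach E x y)"
    unfolding connected_hypergraph_def reach_rtrancl using S by simp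
  ultimately show ?thesis unfolding linear_tree_def sat_tree_def Berge_saturated_iff[OF assms] using h True by blast
next
  case False
  then show ?thesis unfolding sat_tree_def Berge_saturated_iff[OF assms] by blast
qed

lemma min_sat_tree_eq:
  assumes "t \<noteq> 0"
  shows "min_sat_tree k (Suc t) = Inf {card E | (V::nat set) E. sat_tree k t V E}"
proof -
  have "{card (edges T) | T :: nat hypergraph. linear_tree T \<and> Berge_saturated k (path_graph (Suc t)) T \<and> card (verts T) \<ge> k + 1}
    = {card E | (V::nat set) E. sat_tree k t V E}"
    unfolding sat_tree_iff[OF assms, symmetric] by (auto; metis fst_conv snd_conv)
  then show ?thesis unfolding min_sat_tree_def by simp
qed

text \<open>A minimum tree without a path of \<open>t - 1\<close> edges has at least as many edges as the pair of binary
  trees, which then is a minimum tree as well.\<close>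
lemma min_tree:
  assumes k: "k \<ge> 3" and t: "t \<ge> 9"
  shows "\<exists>(V::nat set) E. sat_tree k t V E \<and> has_path E (t - 1) \<and> card E = min_sat_tree k (Suc t)"
    "sat_tree k t (V'::nat set) E' \<Longrightarrow> min_sat_tree k (Suc t) \<le> card E'"
proof -
  have t0: "t \<noteq> 0" using t by simp
  let ?M = "{card E | (V::nat set) E. sat_tree k t V E}"
  \<comment> \<open>The heights of the two binary trees add up to \<open>t - 1\<close> and differ by at most one.\<close>
  define q where "q = (t - 1) div 2"
  define p where "p = t - 1 - q"
  have pq: "3 \<le> q" "q \<le> p" "p \<le> q + 1" "p + q + 1 = t" "p + q = t - 1" unfolding p_def q_def using t by linarith+
  obtain V0 :: "nat set" and E0 where T0: "sat_tree k t V0 E0" "has_path E0 (t - 1)" "card E0 + 2 = 3 * 2 ^ (p - 2) + 3 * 2 ^ (q - 2)"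
    using ex_bintree_pair[OF k pq(1-3), unfolded pq(4), unfolded pq(5)] unfolding sat_tree_def by blast
  then have "?M \<noteq> {}" by blast
  then have "Inf ?M \<in> ?M" by (rule Inf_nat_def1)
  then obtain V :: "nat set" and E where T: "sat_tree k t V E" "card E = Inf ?M"
    unfolding mem_Collect_eq by metis
  have le: "Inf ?M \<le> card E'" if "sat_tree k t (V'::nat set) E'" for V' E'
    by (rule cInf_lower) (use that in auto)
  then show "sat_tree k t (V'::nat set) E' \<Longrightarrow> min_sat_tree k (Suc t) \<le> card E'"
    unfolding min_sat_tree_eq[OF t0] .
  have "\<exists>(V::nat set) E. sat_tree k t V E \<and> has_path E (t - 1) \<and> card E = Inf ?M"
  proof (cases "has_path E (t - 1)")
    case True then show ?thesis using T by blast
  next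
    case False
    have LB: "(\<forall>h. t = 2 * h + 3 \<longrightarrow> 1 + 3 * (2 ^ h - 1) \<le> card E) \<and> (\<forall>h. t = 2 * h + 2 \<longrightarrow> 3 * (2 ^ h - 1) \<le> card E)"
      by (rule short_saturated_tree_edges_ge[of k t V E]) (use T k t False in \<open>auto simp: sat_tree_def\<close>)
    have "card E0 \<le> card E"
    proof (cases "odd t")
      case True
      define h where "h = q - 1"
      have e: "t = 2 * h + 3" "p = Suc (Suc (h - 1))" "q = Suc (Suc (h - 1))" "h = Suc (h - 1)" 
      proof -
        obtain s where s: "t = 2 * s + 1" using True by (elim oddE)
        then have "q = s" "p = s" "s \<ge> 4" unfolding p_def q_def using t by auto
        then show "t = 2 * h + 3" "p = Suc (Suc (h - 1))" "q = Suc (Suc (h - 1))" "h = Suc (h - 1)" using s unfolding h_def by auto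
      qed
      have 1: "1 + 3 * (2 ^ h - 1) \<le> card E" using LB e(1) by blast
      have 2: "p - 2 = h - 1" "q - 2 = h - 1" using e(2,3) by simp_all
      have 3: "(2::nat) ^ h = 2 * 2 ^ (h - 1)" by (subst e(4)) simp
      from 1 2 3 have "3 * 2 ^ (p - 2) + 3 * 2 ^ (q - 2) \<le> card E + 2" by simp
      then show ?thesis using T0(3) by simp
    next
      case False
      define h where "h = q"
      have e: "t = 2 * h + 2" "p = Suc h" "h = Suc (Suc (h - 2))" 
      proof -
        obtain s where s: "t = 2 * s" using False evenE by blast
        obtain s' where s': "s = Suc s'" using s t by (cases s) auto
        have "q = s'" "p = Suc s'" "s' \<ge> 3" unfolding p_def q_def s s' using t s s' by auto
        then show "t = 2 * h + 2" "p = Suc h" "h = Suc (Suc (h - 2))" using s s' unfolding h_def by auto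
      qed
      have 1: "3 * (2 ^ h - 1) \<le> card E" using LB e(1) by blast
      have 2: "p - 2 = Suc (h - 2)" "q - 2 = h - 2" using e(2,3) h_def by simp_all
      have 3: "(2::nat) ^ h = 4 * 2 ^ (h - 2)" by (subst e(3)) simp
      have 4: "(1::nat) \<le> 2 ^ (h - 2)" by simp
      from 2 have 5: "3 * 2 ^ (p - 2) + 3 * 2 ^ (q - 2) = 9 * (2::nat) ^ (h - 2)" by simp
      from 1 3 4 5 have "3 * 2 ^ (p - 2) + 3 * 2 ^ (q - 2) \<le> card E + 2" by linarith
      then show ?thesis using T0(3) by simp
    qed
    then have "card E0 = Inf ?M" using le[OF T0(1)] T(2) by simp
    then show ?thesis using T0 by blast
  qed
  then show "\<exists>(V::nat set) E. sat_tree k t V E \<and> has_path E (t - 1) \<and> card E = min_sat_tree k (Suc t)"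
    unfolding min_sat_tree_eq[OF t0] .
qed

section \<open>Edges through the end of a long path\<close>

text \<open>If \<open>r\<close> is not on the path, the new edge simply precedes it.  Otherwise the path is rerouted:
  let \<open>a\<close> be the path edge through which \<open>r\<close> is reached.  Start in a vertex of \<open>a\<close> off the path, run
  through \<open>a\<close> back to \<open>x\<close>, through \<open>e\<close> to \<open>r\<close> and on to the end.  All edges of the path are used,
  and \<open>e\<close> in addition.\<close>
lemma path_gains_at_end:
  assumes P: "bpath E x w A W" and e: "e \<notin> E" "x \<in> e" "r \<in> e" "r \<noteq> x"
    and thick: "\<And>a. a \<in> A \<Longrightarrow> r \<in> a \<Longrightarrow> \<exists>z\<in>a. z \<notin> W"
  shows "has_path (insert e E) (card A + 1)"
proof -
  let ?E = "insert e E"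
  have eA: "e \<notin> A" using bpath_basic(5)[OF P] e by blast
  show ?thesis
  proof (cases "r \<in> W")
    case False
    have "bpath ?E x w A W" by (rule bpath_mono[OF P]) blast
    from bpath_cons'[OF this _ e(3,2) eA False] show ?thesis unfolding has_path_def by fastforce
  next
    case True
    from bpath_split_vertex[OF P True] obtain A1 A2 W1 W2 where
      1: "bpath E x r A1 W1" "bpath E r w A2 W2" "A = A1 \<union> A2" "A1 \<inter> A2 = {}" "W = W1 \<union> W2" "W1 \<inter> W2 = {r}" by blast
    have "A1 \<noteq> {}" using 1(1) e(4) bpath_empty by metis
    from bpath_first[OF bpath_rev[OF 1(1)] this] obtain a v A1' W1' where
      2: "a \<in> E" "r \<in> a" "v \<in> a" "a \<notin> A1'" "r \<notin> W1'" "bpath E v x A1' W1'" "A1 = insert a A1'" "W1 = insert r W1'" by blast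
    obtain z where z: "z \<in> a" "z \<notin> W" using thick[of a] 1 2 by blast
    have "bpath E z x (insert a A1') (insert z W1')" using bpath_cons'[OF 2(6,1) z(1) 2(3,4)] z 1 2 by blast
    then have P1: "bpath ?E x z A1 (insert z W1')" using bpath_mono[OF bpath_rev] 2(7) by (metis subset_insertI)
    have P2: "bpath ?E r w A2 W2" by (rule bpath_mono[OF 1(2)]) blast
    have n: "e \<notin> A1" "e \<notin> A2" using eA 1 by auto
    have "insert z W1' \<inter> W2 = {}" using z 1 2 by auto
    then have "bpath ?E z w (insert e (A1 \<union> A2)) (insert z W1' \<union> W2)" "card (insert e (A1 \<union> A2)) = Suc (card A1 + card A2)"
      using bpath_join[OF P1 P2 _ e(2,3) n 1(4)] bpath_join_card[OF P1 P2 _ e(2,3) n 1(4)] by auto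
    moreover have "card A = card A1 + card A2" using 1 bpath_basic(1)[OF 1(1)] bpath_basic(1)[OF 1(2)] by (simp add: card_Un_disjoint)
    ultimately show ?thesis by (intro has_pathI) auto
  qed
qed

lemma first_hit: "bpath E x d A V \<Longrightarrow> d \<in> Z \<Longrightarrow> \<exists>s A' V'. bpath E x s A' V' \<and> V' \<inter> Z = {s} \<and> A' \<subseteq> A \<and> V' \<subseteq> V"
proof (induction rule: bpath.induct)
  case (nil u)
  then show ?case using bpath.nil[of E u] by blast
next
  case (cons a u v A V w)
  show ?case
  proof (cases "u \<in> Z")
    case True
    then show ?thesis using bpath.nil[of E u] by blast
  next
    case False
    obtain s A' V' where 1: "bpath E v s A' V'" "V' \<inter> Z = {s}" "A' \<subseteq> A" "V' \<subseteq> V" using cons by blast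
    have "a \<notin> A'" "u \<notin> V'" using 1 cons.hyps by auto
    then have "bpath E u s (insert a A') (insert u V')" using bpath_cons'[OF 1(1) cons.hyps(1,2,3)] by blast
    moreover have "insert u V' \<inter> Z = {s}" using 1 False by simp
    moreover have "insert a A' \<subseteq> insert a A" "insert u V' \<subseteq> insert u V" using 1 by auto
    ultimately show ?thesis by blast
  qed
qed

text \<open>Walk from \<open>x\<close> until a vertex of the path or of one of its edges is met, and continue along the longer
  of the two parts of the path.\<close>
lemma long_from_everywhere:
  assumes P: "bpath E u w A W" and r: "reach E x u"
  shows "\<exists>y B Z. bpath E x y B Z \<and> card A \<le> 2 * card B"
proof -
  define Z where "Z = W \<union> \<Union>A"
  obtain X0 V0 where "bpath E x u X0 V0" using r unfolding reach_def by blast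
  moreover have "u \<in> Z" using bpath_basic(3)[OF P] unfolding Z_def by blast
  ultimately obtain s X V where X: "bpath E x s X V" "V \<inter> Z = {s}" using first_hit by metis
  \<comment> \<open>An edge of both would have two vertices in \<open>Z\<close>, but the walk meets \<open>Z\<close> only once.\<close>
  have XA: "X \<inter> A = {}"
  proof (rule ccontr)
    assume "X \<inter> A \<noteq> {}"
    then obtain a where a: "a \<in> X" "a \<in> A" by blast
    from bpath_split_edge[OF X(1) a(1)] obtain p q A1 A2 V1 V2 where
      1: "bpath E x p A1 V1" "bpath E q s A2 V2" "p \<in> a" "q \<in> a" "V = V1 \<union> V2" "V1 \<inter> V2 = {}" by blast
    have pV: "p \<in> V1" "q \<in> V2" using bpath_basic(4)[OF 1(1)] bpath_basic(3)[OF 1(2)] .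
    have "p \<in> V \<inter> Z" "q \<in> V \<inter> Z" using pV 1 a unfolding Z_def by auto
    then have "p = q" using X(2) by simp
    then show False using pV 1 by blast
  qed
  have fin: "finite X" using bpath_basic(1)[OF X(1)] .
  have ext: "\<exists>y B Z. bpath E x y B Z \<and> n \<le> 2 * card B" if B: "bpath E s y B Y" "B \<subseteq> A" "Y \<subseteq> Z" "n \<le> 2 * card B" for y B Y n
  proof -
    have "V \<inter> Y \<subseteq> V \<inter> Z" using B(3) by blast
    then have "V \<inter> Y \<subseteq> {s}" using X(2) by simp
    moreover have "s \<in> V \<inter> Y" using bpath_basic(3)[OF B(1)] bpath_basic(4)[OF X(1)] by simp
    ultimately have "V \<inter> Y = {s}" by blast
    moreover have XB: "X \<inter> B = {}" using XA B(2) by blast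
    ultimately have "bpath E x y (X \<union> B) (V \<union> Y)" using bpath_concat[OF X(1) B(1)] by blast
    moreover have "card (X \<union> B) = card X + card B" using XB fin bpath_basic(1)[OF B(1)] by (simp add: card_Un_disjoint)
    ultimately show ?thesis using B(4) by (intro exI[of _ y] exI[of _ "X \<union> B"] exI[of _ "V \<union> Y"]) auto
  qed
  show ?thesis
  proof (cases "s \<in> W")
    case True
    from bpath_split_vertex[OF P True] obtain A1 A2 W1 W2 where
      1: "bpath E u s A1 W1" "bpath E s w A2 W2" "A = A1 \<union> A2" "A1 \<inter> A2 = {}" "W = W1 \<union> W2" by blast
    have c: "card A = card A1 + card A2" using 1 bpath_basic(1)[OF 1(1)] bpath_basic(1)[OF 1(2)] by (simp add: card_Un_disjoint)
    show ?thesis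
    proof (cases "card A1 \<le> card A2")
      case True show ?thesis by (rule ext[OF 1(2)]) (use 1(3,5) c True in \<open>auto simp: Z_def\<close>)
    next
      case False show ?thesis by (rule ext[OF bpath_rev[OF 1(1)]]) (use 1(3,5) c False in \<open>auto simp: Z_def\<close>)
    qed
  next
    case False
    have sZ: "s \<in> Z" using X(2) by blast
    then obtain a where a: "a \<in> A" "s \<in> a" using False unfolding Z_def by blast
    from bpath_split_edge[OF P a(1)] obtain p q A1 A2 W1 W2 where
      1: "bpath E u p A1 W1" "bpath E q w A2 W2" "p \<in> a" "q \<in> a" "a \<notin> A1" "a \<notin> A2"
      "A = insert a (A1 \<union> A2)" "A1 \<inter> A2 = {}" "W = W1 \<union> W2" by blast
    have aE: "a \<in> E" using a bpath_basic(5)[OF P] by blast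
    have c: "card A = Suc (card A1 + card A2)" using 1 bpath_basic(1)[OF 1(1)] bpath_basic(1)[OF 1(2)] by (simp add: card_Un_disjoint)
    have s1: "s \<notin> W1" "s \<notin> W2" using False 1 by auto
    show ?thesis
    proof (cases "card A1 \<le> card A2")
      case True
      have b: "bpath E s w (insert a A2) (insert s W2) \<and> card (insert a A2) = Suc (card A2)"
        using bpath_cons'[OF 1(2) aE a(2) 1(4,6) s1(2)] .
      show ?thesis
      proof (rule ext[OF conjunct1[OF b]])
        show "insert a A2 \<subseteq> A" unfolding 1(7) by blast
        show "insert s W2 \<subseteq> Z" using sZ 1(9) unfolding Z_def by blast
        show "card A \<le> 2 * card (insert a A2)" using c True b by simp
      qed
    next
      case False
      have b: "bpath E s u (insert a A1) (insert s W1) \<and> card (insert a A1) = Suc (card A1)"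
        using bpath_cons'[OF bpath_rev[OF 1(1)] aE a(2) 1(3,5) s1(1)] .
      show ?thesis
      proof (rule ext[OF conjunct1[OF b]])
        show "insert a A1 \<subseteq> A" unfolding 1(7) by blast
        show "insert s W1 \<subseteq> Z" using sZ 1(9) unfolding Z_def by blast
        show "card A \<le> 2 * card (insert a A1)" using c False b by simp
      qed
    qed
  qed
qed

section \<open>Pendant edges\<close>

text \<open>Two paths of this length and an edge between them make a path with \<open>t\<close> edges.\<close>
definition far_reaching :: "nat \<Rightarrow> 'a set \<Rightarrow> 'a set set \<Rightarrow> bool" where
  "far_reaching t V E \<longleftrightarrow> (\<forall>x\<in>V. \<exists>y A W. bpath E x y A W \<and> t - 1 \<le> 2 * card A)"

text \<open>The vertex \<open>c\<close> is the second vertex of a path with \<open>t - 1\<close> edges whose first edge \<open>f\<close> is pendant,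
  and every other edge of that path has a vertex off the path, as required for rerouting.\<close>
definition pendant_site :: "nat \<Rightarrow> 'a set set \<Rightarrow> 'a \<Rightarrow> bool" where
  "pendant_site t E c \<longleftrightarrow> (\<exists>f x w A W. f \<in> E \<and> c \<in> f \<and> x \<in> f \<and> x \<noteq> c \<and> (\<forall>v\<in>f - {c}. \<forall>h\<in>E. v \<in> h \<longrightarrow> h = f) \<and>
    bpath E c w A W \<and> f \<notin> A \<and> card A = t - 2 \<and> (\<forall>a\<in>A. \<exists>z\<in>a. z \<notin> W))"

definition extendable :: "nat \<Rightarrow> nat \<Rightarrow> 'a set \<Rightarrow> 'a set set \<Rightarrow> bool" where
  "extendable k t V E \<longleftrightarrow> saturated k t V E \<and> far_reaching t V E \<and> (\<exists>c\<in>V. pendant_site t E c)"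

text \<open>The new edge is a twin of the pendant edge \<open>f\<close>: in a path it can be replaced by \<open>f\<close>, so no longer
  path arises, and its new vertices start paths with \<open>t - 1\<close> edges.\<close>
lemma add_pendant:
  assumes k: "k \<ge> 3" and t: "t \<ge> 4" and S: "saturated k t V E" and ec: "far_reaching t V E" and c: "c \<in> V" "pendant_site t E c"
    and N: "finite N" "card N = k - 1" "N \<inter> V = {}"
  shows "saturated k t (V \<union> N) (insert (insert c N) E) \<and> far_reaching t (V \<union> N) (insert (insert c N) E) \<and> pendant_site t (insert (insert c N) E) c \<and> insert c N \<notin> E"
proof -
  let ?p = "insert c N"
  let ?E = "insert ?p E"
  have SV: "finite V" "\<And>e. e \<in> E \<Longrightarrow> e \<subseteq> V" "\<And>e. e \<in> E \<Longrightarrow> card e = k" "\<not> has_path E t"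
    "\<And>e. e \<subseteq> V \<Longrightarrow> card e = k \<Longrightarrow> e \<notin> E \<Longrightarrow> has_path (insert e E) t" using S unfolding saturated_def by auto
  obtain f x w A W where f0: "f \<in> E" "c \<in> f" "x \<in> f" "x \<noteq> c" "\<forall>v\<in>f - {c}. \<forall>h\<in>E. v \<in> h \<longrightarrow> h = f"
    and A0: "bpath E c w A W" "f \<notin> A" "card A = t - 2" "\<forall>a\<in>A. \<exists>z\<in>a. z \<notin> W"
    using c(2)[unfolded pendant_site_def] by (elim exE conjE) (rule that)
  have fp: "h = f" if "v \<in> f" "v \<noteq> c" "h \<in> E" "v \<in> h" for v h using f0(5) that by simp
  have At: "\<exists>z\<in>a. z \<notin> W" if "a \<in> A" for a using A0(4) that by simp
  note f = f0(1-4) fp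
  note A = A0(1-3) At
  have N2: "\<exists>z\<in>N. z \<noteq> v" for v
  proof (rule ccontr)
    assume "\<not> ?thesis"
    then have "N \<subseteq> {v}" by blast
    then have "card N \<le> card {v}" by (intro card_mono) auto
    then show False using N k by simp
  qed
  obtain n0 where n0: "n0 \<in> N" using N2 by blast
  have pE: "?p \<notin> E"
  proof
    assume "?p \<in> E"
    then have "n0 \<in> V" using SV(2)[of ?p] n0 by auto
    then show False using n0 N(3) by auto
  qed
  have cN: "c \<notin> N" using c(1) N(3) by auto
  have WV: "W \<subseteq> V" using bpath_in[OF A(1) c(1)] SV(2) by blast
  \<comment> \<open>Such a path would extend over \<open>f\<close>, or begin with \<open>f\<close> and stop at once.\<close>
  have nofrom: "\<not> (t - 1 \<le> card Q)" if Q: "bpath E c w Q V'" for w Q V'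
  proof
    assume len: "t - 1 \<le> card Q"
    have Q0: "Q \<noteq> {}" using len t by auto
    show False
    proof (cases "f \<in> Q")
      case False
      have "x \<notin> V'"
      proof
        assume "x \<in> V'"
        from bpath_verts_end[OF Q Q0 this] obtain a where "a \<in> Q" "x \<in> a" by blast
        then show False using f(5)[OF f(3,4), of a] bpath_basic(5)[OF Q] False by blast
      qed
      from bpath_cons'[OF Q f(1,3,2) False this] have "has_path E t" using len t unfolding has_path_def by fastforce
      then show False using SV by blast
    next
      case True
      from bpath_split_edge[OF Q True] obtain a b A1 A2 V1 V2 where
        1: "bpath E c a A1 V1" "bpath E b w A2 V2" "a \<in> f" "b \<in> f" "f \<notin> A1" "f \<notin> A2" "Q = insert f (A1 \<union> A2)" "V1 \<inter> V2 = {}" by blast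
      have A1: "A1 = {}"
      proof (rule ccontr)
        assume n: "A1 \<noteq> {}"
        from bpath_verts_end[OF 1(1) n bpath_basic(4)[OF 1(1)]] obtain h where h: "h \<in> A1" "a \<in> h" by blast
        have "h \<in> E" "h \<noteq> f" using h 1(5) bpath_basic(5)[OF 1(1)] by auto
        then have "a = c" using f(5)[OF 1(3)] h by blast
        then show False using bpath_loop 1(1) n by metis
      qed
      have "a = c" using 1(1) bpath_empty A1 by metis
      then have bc: "b \<noteq> c" using 1(8) bpath_basic(4)[OF 1(1)] bpath_basic(3)[OF 1(2)] by blast
      have A2: "A2 = {}"
      proof (rule ccontr)
        assume n: "A2 \<noteq> {}"
        from bpath_verts_end[OF 1(2) n bpath_basic(3)[OF 1(2)]] obtain h where h: "h \<in> A2" "b \<in> h" by blast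
        have "h \<in> E" "h \<noteq> f" using h 1(6) bpath_basic(5)[OF 1(2)] by auto
        then show False using f(5)[OF 1(4) bc] h by blast
      qed
      show False using len 1(7) A1 A2 t by simp
    qed
  qed
  have free: "\<not> has_path ?E t"
  proof
    assume "has_path ?E t"
    then obtain u y Q VQ where Q: "bpath ?E u y Q VQ" "card Q = t" using has_path_exact by blast
    show False
    proof (cases "?p \<in> Q")
      case False
      then have "bpath E u y Q VQ" using bpath_basic(5)[OF Q(1)] by (intro bpath_restrict[OF Q(1)]) auto
      then show False using SV(4) Q(2) has_pathI by (metis order_refl)
    next
      case True
      from bpath_split_edge[OF Q(1) True] obtain a b A1 A2 V1 V2 where
        1: "bpath ?E u a A1 V1" "bpath ?E b y A2 V2" "a \<in> ?p" "b \<in> ?p" "?p \<notin> A1" "?p \<notin> A2" "Q = insert ?p (A1 \<union> A2)" "A1 \<inter> A2 = {}" "V1 \<inter> V2 = {}" by blast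
      have b1: "bpath E a u A1 V1" using bpath_basic(5)[OF 1(1)] 1(5) by (intro bpath_rev[OF bpath_restrict[OF 1(1)]]) auto
      have b2: "bpath E b y A2 V2" using bpath_basic(5)[OF 1(2)] 1(6) by (intro bpath_restrict[OF 1(2)]) auto
      have cd: "card Q = Suc (card A1 + card A2)" using 1 bpath_basic(1)[OF b1] bpath_basic(1)[OF b2] by (simp add: card_Un_disjoint)
      have ab: "a \<noteq> b" using 1(9) bpath_basic(3)[OF b1] bpath_basic(3)[OF b2] by blast
      have emp: "B = {}" if "bpath E v z B Z" "v \<in> ?p" "v \<noteq> c" for v z B Z
        using bpath_start_edge[OF that(1), of V] SV(2) that(2,3) N(3) by blast
      show False
      proof (cases "a = c")
        case True
        then have "A2 = {}" using emp[OF b2 1(4)] ab by blast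
        then show False using nofrom[OF b1[unfolded True]] cd Q(2) by simp
      next
        case False
        then have A1: "A1 = {}" using emp[OF b1 1(3)] by blast
        show False
        proof (cases "b = c")
          case True then show False using nofrom[OF b2[unfolded True]] cd Q(2) A1 by simp
        next
          case False
          then have "A2 = {}" using emp[OF b2 1(4)] by blast
          then show False using A1 cd Q(2) t by simp
        qed
      qed
    qed
  qed
  have newpath: "bpath ?E x' w (insert ?p A) (insert x' W) \<and> card (insert ?p A) = t - 1" if "x' \<in> N" for x'
  proof -
    have "bpath ?E c w A W" by (rule bpath_mono[OF A(1)]) blast
    moreover have "?p \<notin> A" using pE bpath_basic(5)[OF A(1)] by blast
    moreover have "x' \<notin> W" using WV N(3) that by blast
    ultimately show ?thesis using bpath_cons'[of ?E c w A W ?p x'] that A(3) t by simp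
  qed
  have sat: "has_path (insert e ?E) t" if e: "e \<subseteq> V \<union> N" "card e = k" "e \<notin> ?E" for e
  proof (cases "e \<subseteq> V")
    case True
    then have "has_path (insert e E) t" using SV(5) e by blast
    then show ?thesis by (rule has_path_mono) blast
  next
    case False
    then obtain x' where x': "x' \<in> e" "x' \<in> N" using e by blast
    obtain r where r: "r \<in> e" "r \<noteq> x'" using ex_other[OF k e(2), of x' x'] by blast
    note P = newpath[OF x'(2)]
    have "has_path (insert e ?E) (card (insert ?p A) + 1)"
    proof (rule path_gains_at_end[OF conjunct1[OF P] e(3) x'(1) r])
      fix a assume "a \<in> insert ?p A"
      then show "\<exists>z\<in>a. z \<notin> insert x' W"
      proof
        assume "a = ?p"
        moreover obtain z where "z \<in> N" "z \<noteq> x'" using N2 by blast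
        moreover have "z \<notin> W" using WV N(3) \<open>z \<in> N\<close> by blast
        ultimately show ?thesis by blast
      next
        assume a: "a \<in> A"
        then obtain z where z: "z \<in> a" "z \<notin> W" using A(4) by blast
        have "z \<in> V" using a z SV(2) bpath_basic(5)[OF A(1)] by blast
        then have "z \<noteq> x'" using N(3) x' by blast
        then show ?thesis using z by blast
      qed
    qed
    then show ?thesis using P t by simp
  qed
  have "saturated k t (V \<union> N) ?E"
    unfolding saturated_def using SV N k c cN free sat by auto
  moreover have "far_reaching t (V \<union> N) ?E"
    unfolding far_reaching_def
  proof
    fix v assume "v \<in> V \<union> N"
    then show "\<exists>y A W. bpath ?E v y A W \<and> t - 1 \<le> 2 * card A"
    proof
      assume "v \<in> V"
      then obtain y B Z where B: "bpath E v y B Z" "t - 1 \<le> 2 * card B" using ec unfolding far_reaching_def by blast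
      have "bpath ?E v y B Z" by (rule bpath_mono[OF B(1)]) blast
      then show ?thesis using B by blast
    next
      assume "v \<in> N"
      from newpath[OF this] show ?thesis by (intro exI[of _ w] exI[of _ "insert ?p A"] exI[of _ "insert v W"]) auto
    qed
  qed
  moreover have "pendant_site t ?E c"
    unfolding pendant_site_def
  proof (rule exI[of _ f], rule exI[of _ x], rule exI[of _ w], rule exI[of _ A], rule exI[of _ W], intro conjI ballI impI)
    fix v h assume v: "v \<in> f - {c}" and h: "h \<in> ?E" "v \<in> h"
    have "v \<in> V" using v f SV(2) by blast
    then have "v \<notin> ?p" using v N(3) by blast
    then show "h = f" using f(5)[of v h] v h by blast
  next
    show "bpath ?E c w A W" by (rule bpath_mono[OF A(1)]) blast
  qed (use f A in auto)
  ultimately show ?thesis using pE by blast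
qed

lemma extendable_iter:
  assumes k: "k \<ge> 3" and t: "t \<ge> 4" and E: "extendable k t (V::nat set) E"
  shows "\<exists>(V'::nat set) E'. extendable k t V' E' \<and> card V' = card V + j * (k - 1) \<and> card E' = card E + j"
proof (induction j)
  case 0 then show ?case using E by auto
next
  case (Suc j)
  then obtain V' :: "nat set" and E' where 1: "extendable k t V' E'" "card V' = card V + j * (k - 1)" "card E' = card E + j" by blast
  obtain c where c: "saturated k t V' E'" "far_reaching t V' E'" "c \<in> V'" "pendant_site t E' c" using 1 unfolding extendable_def by blast
  have fV: "finite V'" using c(1) unfolding saturated_def by blast
  obtain N where N: "finite N" "card N = k - 1" "N \<inter> V' = {}" using fresh_set[OF k fV, of "k - 1"] by blast
  from add_pendant[OF k t c N] have "extendable k t (V' \<union> N) (insert (insert c N) E')" "insert c N \<notin> E'"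
    using c(3) unfolding extendable_def by auto
  moreover have "card (V' \<union> N) = card V' + (k - 1)" using N fV by (simp add: card_Un_disjoint Int_commute)
  moreover have "finite E'" using saturated_finite[OF c(1)] .
  ultimately show ?case using 1 by (intro exI[of _ "V' \<union> N"] exI[of _ "insert (insert c N) E'"]) auto
qed

text \<open>Otherwise a longest path could be continued beyond its first edge \<open>f\<close>.\<close>
lemma end_private:
  assumes s: "bacyclic E" and no: "\<not> has_path E t" and k: "\<And>e. e \<in> E \<Longrightarrow> card e = k" "k \<ge> 2"
    and f: "f \<in> E" "c \<in> f" and A: "bpath E c w A W" "f \<notin> A" "card A + 2 \<ge> t"
    and v: "v \<in> f" "v \<noteq> c" "h \<in> E" "v \<in> h"
  shows "h = f"
proof (rule ccontr)
  assume hf: "h \<noteq> f"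
  have "\<exists>z\<in>h. z \<noteq> v"
  proof (rule ccontr)
    assume "\<not> ?thesis"
    then have "h \<subseteq> {v}" by blast
    then have "card h \<le> card {v}" by (intro card_mono) auto
    then show False using k v by fastforce
  qed
  then obtain z where z: "z \<in> h" "z \<noteq> v" by blast
  have "bpath (E - {f}) v z {h} {v, z}" using v z hf by (intro bpath_single) auto
  from bacyclic_join[OF s f(1) v(1) f(2) v(2) this bpath_avoid[OF A(1,2)]] have "has_path E t"
    using A(3) by (intro has_pathI) auto
  then show False using no by blast
qed

lemma sat_tree_extendable:
  assumes k: "k \<ge> 3" and t: "t \<ge> 4" and T: "sat_tree k t V E" and P: "has_path E (t - 1)"
  shows "extendable k t V E"
proof -
  have S: "saturated k t V E" "bacyclic E" "\<And>x y. x \<in> V \<Longrightarrow> y \<in> V \<Longrightarrow> reach E x y" using T unfolding sat_tree_def by auto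
  have SV: "\<And>e. e \<in> E \<Longrightarrow> e \<subseteq> V" "\<And>e. e \<in> E \<Longrightarrow> card e = k" "\<not> has_path E t" using S unfolding saturated_def by auto
  obtain x w A W where A: "bpath E x w A W" "card A = t - 1" using has_path_exact[OF P] by blast
  have "A \<noteq> {}" using A t by auto
  from bpath_first[OF A(1) this] obtain f c A' W' where
    1: "f \<in> E" "x \<in> f" "c \<in> f" "f \<notin> A'" "x \<notin> W'" "bpath E c w A' W'" "A = insert f A'" by blast
  have cA: "card A' = t - 2" using A 1 bpath_basic(1)[OF 1(6)] t by simp
  have "x \<noteq> c" using 1 bpath_basic(3)[OF 1(6)] by blast
  have k2: "k \<ge> 2" using k by simp
  have priv: "h = f" if "v \<in> f - {c}" "h \<in> E" "v \<in> h" for v h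
    by (rule end_private[OF S(2) SV(3,2) k2 1(1,3,6,4) _ _ _ that(2,3)]) (use that cA t in auto)
  have "pendant_site t E c" unfolding pendant_site_def
    using 1 \<open>x \<noteq> c\<close> cA priv bacyclic_path_thick[OF S(2) 1(6)] bpath_basic(5)[OF 1(6)] SV(2) k
    by (intro exI[of _ f] exI[of _ x] exI[of _ w] exI[of _ A'] exI[of _ W']) auto
  moreover have "far_reaching t V E" unfolding far_reaching_def
  proof
    fix v assume v: "v \<in> V"
    have "x \<in> V" using 1 SV(1) by blast
    from long_from_everywhere[OF A(1) S(3)[OF v this]] A(2) show "\<exists>y A W. bpath E v y A W \<and> t - 1 \<le> 2 * card A" by simp
  qed
  moreover have "c \<in> V" using 1 SV(1) by blast
  ultimately show ?thesis unfolding extendable_def using S(1) by blast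
qed

section \<open>Absorbing a remainder of vertices by one edge\<close>

text \<open>If no edge crosses the boundary of \<open>Z\<close>, a path stays on one side.\<close>
lemma zone:
  assumes "bpath E u w A W" "\<And>h. h \<in> E \<Longrightarrow> h \<subseteq> Z \<or> h \<inter> Z = {}"
  shows "(u \<in> Z \<longrightarrow> W \<subseteq> Z \<and> (\<forall>a\<in>A. a \<subseteq> Z)) \<and> (u \<notin> Z \<longrightarrow> W \<inter> Z = {} \<and> (\<forall>a\<in>A. a \<inter> Z = {}))"
  using assms
proof (induction rule: bpath.induct)
  case (cons a u v A V w)
  note IH = cons.IH[OF cons.prems]
  have a: "a \<subseteq> Z \<or> a \<inter> Z = {}" using cons.prems[OF cons.hyps(1)] .
  show ?case
  proof (cases "u \<in> Z")
    case True
    then have "a \<subseteq> Z" using a cons.hyps(2) by blast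
    moreover have "v \<in> Z" using \<open>a \<subseteq> Z\<close> cons.hyps(3) by blast
    ultimately show ?thesis using IH True by simp
  next
    case False
    then have "a \<inter> Z = {}" using a cons.hyps(2) by blast
    moreover have "v \<notin> Z" using \<open>a \<inter> Z = {}\<close> cons.hyps(3) by blast
    ultimately show ?thesis using IH False by simp
  qed
qed simp

lemma split_tails:
  assumes "bpath E u w Q V" "g \<in> Q"
  obtains a b Q1 Q2 V1 V2 where "bpath (E - {g}) a u Q1 V1" "bpath (E - {g}) b w Q2 V2" "a \<in> g" "b \<in> g" "a \<noteq> b"
    "Q = insert g (Q1 \<union> Q2)" "Q1 \<inter> Q2 = {}" "V1 \<inter> V2 = {}" "card Q = Suc (card Q1 + card Q2)" "g \<notin> Q1" "g \<notin> Q2" "g \<in> E"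
proof -
  from bpath_split_edge[OF assms] obtain a b A1 A2 V1 V2 where
    1: "bpath E u a A1 V1" "bpath E b w A2 V2" "a \<in> g" "b \<in> g" "g \<notin> A1" "g \<notin> A2"
    "Q = insert g (A1 \<union> A2)" "A1 \<inter> A2 = {}" "V1 \<inter> V2 = {}" by blast
  have "a \<noteq> b" using 1(9) bpath_basic(4)[OF 1(1)] bpath_basic(3)[OF 1(2)] by blast
  moreover have "card Q = Suc (card A1 + card A2)" using 1(5-8) bpath_basic(1)[OF 1(1)] bpath_basic(1)[OF 1(2)] by (simp add: card_Un_disjoint)
  moreover have "g \<in> E" using bpath_basic(5)[OF assms(1)] assms(2) by blast
  ultimately show ?thesis using that[OF bpath_avoid[OF bpath_rev[OF 1(1)] 1(5)] bpath_avoid[OF 1(2,6)] 1(3,4) _ 1(7,8,9) _ 1(5,6)] by blast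
qed

text \<open>A path with \<open>t - 1\<close> edges starts with \<open>x f c g d\<close> and continues along \<open>R\<close>.  The set \<open>Y\<close> of
  \<open>k - i\<close> vertices of \<open>g\<close>, among them \<open>c\<close>, will be shared by \<open>g\<close> and a new edge whose other vertices
  are the \<open>i\<close> new vertices in \<open>S\<close>.\<close>
locale gadget =
  fixes k t i :: nat and V :: "'a set" and E :: "'a set set" and f g :: "'a set" and x c d w :: 'a
    and R :: "'a set set" and WR :: "'a set" and Y S :: "'a set"
  assumes k: "k \<ge> 3" and t: "t \<ge> 9" and T: "sat_tree k t V E"
    and f: "f \<in> E" "x \<in> f" "c \<in> f" "x \<noteq> c" "f \<noteq> g" and g: "g \<in> E" "c \<in> g" "d \<in> g" "c \<noteq> d"
    and R: "bpath (E - {g}) d w R WR" "card R = t - 3"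
    and Y: "Y \<subseteq> g - {d}" "c \<in> Y" "card Y = k - i" and S: "finite S" "card S = i" "S \<inter> V = {}" and i: "1 \<le> i" "i + 2 \<le> k"
begin

lemma saturated: "saturated k t V E" and tree: "bacyclic E" and con: "\<And>x y. x \<in> V \<Longrightarrow> y \<in> V \<Longrightarrow> reach E x y"
  using T unfolding sat_tree_def by auto

lemma sat_facts: "finite V" "\<And>e. e \<in> E \<Longrightarrow> e \<subseteq> V" "\<And>e. e \<in> E \<Longrightarrow> card e = k" "\<not> has_path E t"
    "\<And>e. e \<subseteq> V \<Longrightarrow> card e = k \<Longrightarrow> e \<notin> E \<Longrightarrow> has_path (insert e E) t"
  using saturated unfolding saturated_def by auto

lemma path_short: "bpath E u y A W \<Longrightarrow> card A < t" using sat_facts(4) unfolding has_path_def by (meson not_le)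

lemma tail_at_g_le:
  assumes "y \<in> g" "y \<noteq> d" "bpath (E - {g}) y z B Z"
  shows "card B \<le> 1"
proof -
  note j = bacyclic_join[OF tree g(1) assms(1) g(3) assms(2,3) R(1)]
  from path_short[OF j(1)] j(2) R(2) t show ?thesis by simp
qed

lemma f_tail: "bpath (E - {g}) c x {f} {c, x}"
  by (rule bpath_single) (use f f(4)[symmetric] in simp_all)

lemma tail_at_d_le:
  assumes "bpath (E - {g}) d z B Z"
  shows "card B \<le> t - 3"
proof -
  note j = bacyclic_join[OF tree g(1) g(3) g(2) g(4)[symmetric] assms f_tail]
  from path_short[OF j(1)] j(2) t show ?thesis by simp
qed

lemma third_vertex: "e \<in> E \<Longrightarrow> \<exists>z\<in>e. z \<noteq> a \<and> z \<noteq> b"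
  by (rule ex_other[OF k sat_facts(3)])

text \<open>All other edges at vertices of \<open>Y\<close> are removed, since together with the new edge \<open>bridge\<close> they would
  create paths that are too long.  They are pendant, so that their private vertices can be given to
  new pendant edges at the opposite end of the tree.\<close>
definition pendants where "pendants = {f'\<in>E. f' \<noteq> g \<and> f' \<inter> Y \<noteq> {}}"
definition pzone where "pzone = Y \<union> \<Union>pendants"
definition bridge where "bridge = Y \<union> S"
definition E_new where "E_new = insert bridge (E - pendants)"
definition V_new where "V_new = (V - (\<Union>pendants - Y)) \<union> S"

lemma Y_in_g: "y \<in> Y \<Longrightarrow> y \<in> g \<and> y \<noteq> d" using Y by blast
lemma Y_in_V: "Y \<subseteq> V" using Y sat_facts(2)[OF g(1)] by blast

lemma pendant_meets_Y: "f' \<in> pendants \<Longrightarrow> \<exists>y. f' \<inter> g = {y} \<and> f' \<inter> Y = {y}"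
proof -
  assume F: "f' \<in> pendants"
  then obtain y where y: "y \<in> f'" "y \<in> Y" "f' \<in> E" "f' \<noteq> g" unfolding pendants_def by blast
  have "v = y" if "v \<in> f'" "v \<in> g" for v
    using bacyclic_inter_edges[OF tree y(3) g(1) y(4) that y(1)] Y_in_g[OF y(2)] by simp
  then show ?thesis using y Y_in_g by blast
qed

text \<open>A further edge at a vertex of \<open>f'\<close> would give a tail of two edges behind \<open>g\<close>, where only one
  fits.\<close>
lemma pendant_private:
  assumes F: "f' \<in> pendants" and v: "v \<in> f'" "v \<notin> Y" "h \<in> E" "v \<in> h"
  shows "h = f'"
proof (rule ccontr)
  assume hf: "h \<noteq> f'"
  obtain y where y: "f' \<inter> g = {y}" "f' \<inter> Y = {y}" using pendant_meets_Y[OF F] by blast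
  then have yy: "y \<in> f'" "y \<in> g" "y \<in> Y" by auto
  have fE: "f' \<in> E" "f' \<noteq> g" using F unfolding pendants_def by auto
  have vy: "v \<noteq> y" using v yy by blast
  have "v \<notin> g" using y v vy by auto
  then have hg: "h \<noteq> g" using v by blast
  obtain z where z: "z \<in> h" "z \<noteq> v" "z \<noteq> y" using third_vertex[OF v(3)] by blast
  have 1: "bpath (E - {g}) v z {h} {v, z}" by (rule bpath_single) (use z(1) z(2)[symmetric] v hg in simp_all)
  have "bpath (E - {g}) y z {f', h} {y, v, z} \<and> card {f', h} = Suc (card {h})"
    by (rule bpath_cons'[OF 1]) (use z(3)[symmetric] yy vy[symmetric] fE hf[symmetric] v in simp_all)
  then show False using tail_at_g_le[of y z "{f', h}"] yy Y_in_g by auto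
qed

text \<open>The edges at \<open>Y\<close> form a zone that can be entered and left through \<open>g\<close> only.\<close>
lemma gate: "h \<in> E \<Longrightarrow> h \<noteq> g \<Longrightarrow> h \<subseteq> pzone \<and> h \<in> pendants \<or> h \<inter> pzone = {} \<and> h \<notin> pendants"
proof -
  assume h: "h \<in> E" "h \<noteq> g"
  show ?thesis
  proof (cases "h \<in> pendants")
    case True then show ?thesis unfolding pzone_def by auto
  next
    case False
    have "h \<inter> Y = {}" using False h unfolding pendants_def by blast
    moreover have "h \<inter> f' = {}" if "f' \<in> pendants" for f'
    proof (rule ccontr)
      assume "h \<inter> f' \<noteq> {}"
      then obtain v where v: "v \<in> h" "v \<in> f'" by blast
      then have "v \<notin> Y" using \<open>h \<inter> Y = {}\<close> by blast
      then show False using pendant_private[OF that v(2) _ h(1) v(1)] False that by blast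
    qed
    ultimately show ?thesis using False unfolding pzone_def by blast
  qed
qed

lemma g_pzone: "v \<in> g \<Longrightarrow> v \<in> pzone \<Longrightarrow> v \<in> Y"
proof -
  assume v: "v \<in> g" "v \<in> pzone"
  show "v \<in> Y"
  proof (rule ccontr)
    assume "v \<notin> Y"
    then obtain f' where f': "f' \<in> pendants" "v \<in> f'" using v unfolding pzone_def by blast
    obtain y where "f' \<inter> g = {y}" "f' \<inter> Y = {y}" using pendant_meets_Y[OF f'(1)] by blast
    then have "v = y" "y \<in> Y" using v f' by auto
    then show False using \<open>v \<notin> Y\<close> by simp
  qed
qed

lemma edge_nonempty: "h \<in> E \<Longrightarrow> h \<noteq> {}" using sat_facts(3) k by fastforce

lemma d_notin_pzone: "d \<notin> pzone" using g_pzone[OF g(3)] Y by blast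
lemma g_not_pendant: "g \<notin> pendants" unfolding pendants_def by blast
lemma g_in_E_new: "g \<in> E_new" using g g_not_pendant unfolding E_new_def by blast
lemma ex_new_vertex: "\<exists>s. s \<in> S" using S i by fastforce
lemma pzone_in_V: "pzone \<subseteq> V" using Y_in_V sat_facts(2) unfolding pzone_def pendants_def by blast
lemma new_vertex_outside: "s \<in> S \<Longrightarrow> s \<notin> pzone \<and> s \<notin> V" using pzone_in_V S by blast
lemma bridge_new: "bridge \<notin> E"
proof
  assume "bridge \<in> E"
  then have "S \<subseteq> V" using sat_facts(2) unfolding bridge_def by blast
  then show False using ex_new_vertex new_vertex_outside by blast
qed
lemma bridge_neq_g: "bridge \<noteq> g" using bridge_new g by blast
lemma bridge_card: "card bridge = k"
  using Y S Y_in_V sat_facts(1) i finite_subset[of Y V] unfolding bridge_def by (subst card_Un_disjoint) auto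
lemma ex_other_Y: "\<exists>y\<in>Y. y \<noteq> v"
proof (rule ccontr)
  assume "\<not> ?thesis"
  then have "Y \<subseteq> {v}" by blast
  then have "card Y \<le> card {v}" by (intro card_mono) auto
  then show False using Y i by simp
qed

lemma R_avoids_pzone: "WR \<inter> pzone = {}" "a \<in> R \<Longrightarrow> a \<inter> pzone = {}" "R \<subseteq> E - pendants"
proof -
  have z: "WR \<inter> pzone = {} \<and> (\<forall>a\<in>R. a \<inter> pzone = {})"
    using zone[OF R(1), of pzone] d_notin_pzone gate by blast
  then show "WR \<inter> pzone = {}" "a \<in> R \<Longrightarrow> a \<inter> pzone = {}" by auto
  have RE: "R \<subseteq> E - {g}" using bpath_basic(5)[OF R(1)] .
  show "R \<subseteq> E - pendants"
  proof
    fix a assume a: "a \<in> R"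
    then have "a \<inter> pzone = {}" "a \<in> E" "a \<noteq> g" using z RE by auto
    then show "a \<in> E - pendants" using gate[of a] edge_nonempty[of a] by auto
  qed
qed

lemma R_path_new: "bpath E_new d w R WR" using bpath_restrict[OF R(1)] R_avoids_pzone(3) unfolding E_new_def by blast
lemma WR_in_V: "WR \<subseteq> V" using bpath_in[OF R(1), of V] g sat_facts(2) by blast
lemma R_avoids_g: "g \<notin> R" "bridge \<notin> R" using bpath_basic(5)[OF R(1)] bridge_new by auto
lemma WR_meets_g: "WR \<inter> g = {d}" by (rule bacyclic_tail_edge[OF tree g(1,3) R(1)])

text \<open>Every vertex of the new edge is again the end of a path with \<open>t - 1\<close> edges: go through \<open>bridge\<close> to
  another vertex of \<open>Y\<close> and on through \<open>g\<close>.\<close>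
lemma bridge_path:
  assumes "x' \<in> bridge" "y \<in> Y" "y \<noteq> x'"
  shows "bpath E_new x' w (insert bridge (insert g R)) (insert x' (insert y WR)) \<and> card (insert bridge (insert g R)) = t - 1"
proof -
  have y: "y \<notin> WR" "y \<in> g" using R_avoids_pzone(1) Y_in_g assms unfolding pzone_def by auto
  have 1: "bpath E_new y w (insert g R) (insert y WR) \<and> card (insert g R) = Suc (card R)"
    using bpath_cons'[OF R_path_new g_in_E_new y(2) g(3) R_avoids_g(1) y(1)] .
  have h: "bridge \<in> E_new" "y \<in> bridge" "bridge \<notin> insert g R" using assms R_avoids_g bridge_neq_g unfolding E_new_def bridge_def by auto
  have "x' \<notin> WR" using assms(1) R_avoids_pzone(1) WR_in_V new_vertex_outside unfolding bridge_def pzone_def by blast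
  then have "x' \<notin> insert y WR" using assms by blast
  from bpath_cons'[OF conjunct1[OF 1] h(1) assms(1) h(2,3) this] show ?thesis using 1 R(2) t by simp
qed

lemma R_third_vertex: "a \<in> R \<Longrightarrow> x' \<in> bridge \<Longrightarrow> y \<in> Y \<Longrightarrow> \<exists>z\<in>a. z \<notin> insert x' (insert y WR)"
proof -
  assume a: "a \<in> R" and x': "x' \<in> bridge" and y: "y \<in> Y"
  have aE: "a \<in> E" using a R_avoids_pzone(3) by blast
  have "\<exists>z\<in>a. z \<notin> WR" using bacyclic_path_thick[OF tree bpath_mono[OF R(1)] a] sat_facts(3)[OF aE] k by blast
  then obtain z where z: "z \<in> a" "z \<notin> WR" by blast
  have "z \<notin> pzone" "z \<in> V" using z R_avoids_pzone(2)[OF a] sat_facts(2)[OF aE] by auto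
  then have "z \<noteq> x'" "z \<noteq> y" using x' y new_vertex_outside unfolding bridge_def pzone_def by auto
  then show ?thesis using z by blast
qed

text \<open>An edge through a vertex of \<open>bridge\<close> gains by rerouting.  The vertex \<open>r\<close> is chosen off that edge
  of the path which may have no vertex off the path: off \<open>bridge\<close> if the path starts in a new vertex,
  off \<open>g\<close> if it starts in \<open>Y\<close>.\<close>
lemma saturated_at_bridge:
  assumes e: "card e = k" "e \<notin> E_new" "x' \<in> e" "x' \<in> bridge"
  shows "has_path (insert e E_new) t"
proof -
  have fk: "finite g" "card g = k" "finite bridge" using sat_facts(3)[OF g(1)] k bridge_card by (auto intro: card_ge_0_finite)
  have eh: "\<not> e \<subseteq> bridge" using card_subset_eq[OF fk(3), of e] e bridge_card unfolding E_new_def by auto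
  have eg: "\<not> e \<subseteq> g" using card_subset_eq[OF fk(1), of e] e g_in_E_new fk(2) by auto
  have fin: "has_path (insert e E_new) t" if "has_path (insert e E_new) (card (insert bridge (insert g R)) + 1)" "card (insert bridge (insert g R)) = t - 1"
    using that t by simp
  show ?thesis
  proof (cases "x' \<in> S")
    case True
    obtain r where r: "r \<in> e" "r \<notin> bridge" using eh by blast
    have cx: "c \<noteq> x'" using True new_vertex_outside Y_in_V Y by blast
    note P = bridge_path[OF e(4) Y(2) cx]
    show ?thesis
    proof (rule fin[OF path_gains_at_end[OF conjunct1[OF P] e(2,3) r(1)] conjunct2[OF P]])
      show "r \<noteq> x'" using r e by blast
      fix a assume a: "a \<in> insert bridge (insert g R)" "r \<in> a"
      then consider "a = g" | "a \<in> R" using r by blast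
      then show "\<exists>z\<in>a. z \<notin> insert x' (insert c WR)"
      proof cases
        case 1
        obtain z where z: "z \<in> g" "z \<noteq> d" "z \<noteq> c" using third_vertex[OF g(1)] by blast
        then have "z \<notin> WR" using WR_meets_g by blast
        moreover have "z \<noteq> x'" using True new_vertex_outside sat_facts(2)[OF g(1)] z by blast
        ultimately show ?thesis using z 1 by blast
      next
        case 2 show ?thesis by (rule R_third_vertex[OF 2 e(4) Y(2)])
      qed
    qed
  next
    case False
    then have xY: "x' \<in> Y" using e unfolding bridge_def by blast
    obtain r where r: "r \<in> e" "r \<notin> g" using eg by blast
    obtain y where y: "y \<in> Y" "y \<noteq> x'" using ex_other_Y by blast
    note P = bridge_path[OF e(4) y]
    show ?thesis
    proof (rule fin[OF path_gains_at_end[OF conjunct1[OF P] e(2,3) r(1)] conjunct2[OF P]])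
      show "r \<noteq> x'" using r xY Y_in_g by blast
      fix a assume a: "a \<in> insert bridge (insert g R)" "r \<in> a"
      then consider "a = bridge" | "a \<in> R" using r by blast
      then show "\<exists>z\<in>a. z \<notin> insert x' (insert y WR)"
      proof cases
        case 1
        obtain s where s: "s \<in> S" using ex_new_vertex by blast
        then have "s \<notin> insert x' (insert y WR)" using new_vertex_outside[OF s] WR_in_V Y_in_V xY y by blast
        then show ?thesis using s 1 unfolding bridge_def by blast
      next
        case 2 show ?thesis by (rule R_third_vertex[OF 2 e(4) y(1)])
      qed
    qed
  qed
qed

text \<open>A path of the old tree that ends in the removed zone uses at most one edge there after passing
  through \<open>g\<close>; the new edge \<open>bridge\<close> takes its place.\<close>
lemma reroute_over_bridge:
  assumes eZ: "e \<inter> pzone = {}" "e \<noteq> {}" "e \<inter> S = {}" and Q1: "bpath (insert e E - {g}) a u Q1 V1" and Q2: "bpath (insert e E - {g}) b w' Q2 V2"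
    and ab: "a \<in> g" "b \<in> g" "a \<in> Y" "b \<notin> Y"
  shows "card Q1 \<le> 1" "has_path (insert e E_new) (card Q1 + card Q2 + 1)"
proof -
  have gt: "h \<subseteq> pzone \<or> h \<inter> pzone = {}" if "h \<in> insert e E - {g}" for h using gate[of h] that eZ by blast
  have aZ: "a \<in> pzone" using ab unfolding pzone_def by blast
  have bZ: "b \<notin> pzone" using g_pzone ab by blast
  have 1: "\<And>h. h \<in> Q1 \<Longrightarrow> h \<subseteq> pzone" using zone[OF Q1 gt] aZ by blast
  have 2: "V2 \<inter> pzone = {}" "\<And>h. h \<in> Q2 \<Longrightarrow> h \<inter> pzone = {}" using zone[OF Q2 gt] bZ by blast+
  have "e \<notin> Q1" using 1 eZ by blast
  then have "bpath (E - {g}) a u Q1 V1" using bpath_basic(5)[OF Q1] by (intro bpath_restrict[OF Q1]) auto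
  then show c1: "card Q1 \<le> 1" using tail_at_g_le ab Y_in_g by blast
  have Q2E: "Q2 \<subseteq> insert e E_new"
  proof
    fix h assume h: "h \<in> Q2"
    show "h \<in> insert e E_new"
    proof (cases "h = e")
      case False
      then have "h \<in> E" "h \<noteq> g" using h bpath_basic(5)[OF Q2] by auto
      then have "h \<notin> pendants" using gate[of h] 2(2)[OF h] edge_nonempty[of h] by auto
      then show ?thesis using \<open>h \<in> E\<close> unfolding E_new_def by blast
    qed simp
  qed
  have P: "bpath (insert e E_new) b w' Q2 V2" by (rule bpath_restrict[OF Q2 Q2E])
  obtain s where s: "s \<in> S" using ex_new_vertex by blast
  have gQ: "g \<notin> Q2" using bpath_basic(5)[OF Q2] by blast
  have hQ: "bridge \<notin> Q2" using 2(2)[of bridge] ab aZ unfolding bridge_def by blast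
  have aV: "a \<notin> V2" using 2 aZ by blast
  have "g \<in> insert e E_new" using g_in_E_new by blast
  from bpath_cons'[OF P this ab(1,2) gQ aV]
  have J: "bpath (insert e E_new) a w' (insert g Q2) (insert a V2)" "card (insert g Q2) = Suc (card Q2)" by auto
  show "has_path (insert e E_new) (card Q1 + card Q2 + 1)"
  proof -
    have "h \<subseteq> S \<or> h \<inter> S = {}" if "h \<in> insert e E - {g}" for h
      using that eZ(3) sat_facts(2)[of h] S(3) by blast
    moreover have "b \<notin> S" using sat_facts(2)[OF g(1)] ab(2) S(3) by blast
    ultimately have "V2 \<inter> S = {}" using zone[OF Q2, of S] by blast
    then have sV: "s \<notin> V2" using s by blast
    have sa: "s \<noteq> a" using new_vertex_outside[OF s] aZ by blast
    have h: "bridge \<in> insert e E_new" "s \<in> bridge" "a \<in> bridge" "bridge \<notin> insert g Q2" using s ab(3) hQ bridge_neq_g unfolding E_new_def bridge_def by auto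
    have "s \<notin> insert a V2" using sV sa by blast
    from bpath_cons'[OF J(1) h this] show ?thesis using J c1 unfolding has_path_def by (metis Suc_eq_plus1 add_Suc_right add_le_mono1 add.commute plus_1_eq_Suc)
  qed
qed

end

context gadget
begin

lemma avoids_bridge: "e \<subseteq> V_new \<Longrightarrow> e \<inter> bridge = {} \<Longrightarrow> e \<inter> pzone = {} \<and> e \<inter> S = {} \<and> e \<subseteq> V"
  unfolding V_new_def bridge_def pzone_def by auto

text \<open>For an edge away from \<open>bridge\<close>, the path with \<open>t\<close> edges given by the saturated old tree is carried
  over to the new hypergraph.\<close>
lemma saturated_off_bridge:
  assumes e: "e \<subseteq> V_new" "card e = k" "e \<notin> E_new" "e \<inter> bridge = {}"
  shows "has_path (insert e E_new) t"
proof -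
  have eV: "e \<inter> pzone = {}" "e \<inter> S = {}" "e \<subseteq> V" using avoids_bridge[OF e(1,4)] by auto
  have e0: "e \<noteq> {}" using e(2) k by auto
  have "e \<notin> E"
  proof
    assume eE: "e \<in> E"
    then have "e \<in> pendants" using e(3) unfolding E_new_def by blast
    then have "e \<inter> Y \<noteq> {}" unfolding pendants_def by blast
    then show False using e(4) unfolding bridge_def by blast
  qed
  then obtain u w' Q VQ where Q: "bpath (insert e E) u w' Q VQ" "card Q = t"
    using has_path_exact[OF sat_facts(5)[OF eV(3) e(2)]] by blast
  have eg: "e \<noteq> g" using e(3) g_in_E_new by blast
  have gt: "h \<subseteq> pzone \<or> h \<inter> pzone = {}" if "h \<in> insert e E - {g}" for h using gate[of h] that eV by blast
  have out: "h \<in> insert e E_new" if "h \<in> insert e E" "h \<inter> pzone = {}" for h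
  proof (cases "h = e")
    case False
    then have hE: "h \<in> E" using that by blast
    have "h \<notin> pendants"
    proof
      assume "h \<in> pendants"
      then have "h \<subseteq> pzone" unfolding pzone_def by blast
      then show False using that(2) edge_nonempty[OF hE] by blast
    qed
    then show ?thesis using hE unfolding E_new_def by blast
  qed simp
  have direct: "has_path (insert e E_new) t" if "\<And>h. h \<in> Q \<Longrightarrow> h \<in> insert e E_new"
    using bpath_restrict[OF Q(1), of "insert e E_new"] that Q(2) has_pathI by (metis order_refl subsetI)
  have QE: "Q \<subseteq> insert e E" using bpath_basic(5)[OF Q(1)] .
  show ?thesis
  proof (cases "g \<in> Q")
    case False
    have b: "bpath (insert e E - {g}) u w' Q VQ" by (rule bpath_avoid[OF Q(1) False])
    show ?thesis
    proof (cases "u \<in> pzone")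
      case True
      then have "\<forall>h\<in>Q. h \<subseteq> pzone" using zone[OF b gt] by blast
      then have "e \<notin> Q" using eV(1) e0 by blast
      then have "bpath E u w' Q VQ" using QE by (intro bpath_restrict[OF Q(1)]) auto
      from path_short[OF this] show ?thesis using Q(2) by simp
    next
      case False
      then have dz: "\<forall>h\<in>Q. h \<inter> pzone = {}" using zone[OF b gt] by blast
      show ?thesis
      proof (rule direct)
        fix h assume "h \<in> Q"
        then show "h \<in> insert e E_new" using out[of h] dz QE by auto
      qed
    qed
  next
    case True
    from split_tails[OF Q(1) True] obtain a b Q1 Q2 V1 V2 where
      1: "bpath (insert e E - {g}) a u Q1 V1" "bpath (insert e E - {g}) b w' Q2 V2" "a \<in> g" "b \<in> g" "a \<noteq> b"
      "Q = insert g (Q1 \<union> Q2)" "Q1 \<inter> Q2 = {}" "V1 \<inter> V2 = {}" "card Q = Suc (card Q1 + card Q2)" "g \<notin> Q1" "g \<notin> Q2" "g \<in> insert e E" .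
    consider "a \<in> Y" "b \<in> Y" | "a \<in> Y" "b \<notin> Y" | "a \<notin> Y" "b \<in> Y" | "a \<notin> Y" "b \<notin> Y" by blast
    then show ?thesis
    proof cases
      case 1
      have one: "card B \<le> 1" if B: "bpath (insert e E - {g}) y z B Z" "y \<in> Y" for y z B Z
      proof -
        have "y \<in> pzone" using B(2) unfolding pzone_def by blast
        then have "\<forall>h\<in>B. h \<subseteq> pzone" using zone[OF B(1) gt] by blast
        then have "e \<notin> B" using eV(1) e0 by blast
        then have "bpath (E - {g}) y z B Z" using bpath_basic(5)[OF B(1)] by (intro bpath_restrict[OF B(1)]) auto
        then show ?thesis using tail_at_g_le Y_in_g[OF B(2)] by blast
      qed
      have "card Q \<le> 3" using one[OF \<open>bpath (insert e E - {g}) a u Q1 V1\<close> 1(1)] one[OF \<open>bpath (insert e E - {g}) b w' Q2 V2\<close> 1(2)]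
          \<open>card Q = Suc (card Q1 + card Q2)\<close> by simp
      then show ?thesis using Q(2) t by simp
    next
      case 2
      from reroute_over_bridge(2)[OF eV(1) e0 eV(2) 1(1,2,3,4) 2] show ?thesis using 1(9) Q(2) by simp
    next
      case 3
      from reroute_over_bridge(2)[OF eV(1) e0 eV(2) 1(2,1,4,3) 3(2,1)] show ?thesis using 1(9) Q(2) by (simp add: add.commute)
    next
      case 4
      have disj: "\<forall>h\<in>B. h \<inter> pzone = {}" if B: "bpath (insert e E - {g}) y z B Z" "y \<in> g" "y \<notin> Y" for y z B Z
        using zone[OF B(1) gt] g_pzone[OF B(2)] B(3) by blast
      have "h \<in> insert e E_new" if "h \<in> Q" for h
      proof (cases "h = g")
        case True then show ?thesis using g_in_E_new by simp
      next
        case False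
        then have "h \<in> Q1 \<union> Q2" using that 1(6) by blast
        then have "h \<inter> pzone = {}" using disj[OF 1(1,3) 4(1)] disj[OF 1(2,4) 4(2)] by blast
        then show ?thesis using out[of h] that QE by auto
      qed
      then show ?thesis by (rule direct)
    qed
  qed
qed

text \<open>With \<open>g\<close> removed, the new edge is isolated.  So a path consists of two tails at vertices of \<open>g\<close>; a
  tail at \<open>d\<close> has at most \<open>t - 3\<close> edges and every other tail at most one.\<close>
lemma E_new_path_free: "\<not> has_path E_new t"
proof
  assume "has_path E_new t"
  then obtain u w' Q VQ where Q: "bpath E_new u w' Q VQ" "card Q = t" using has_path_exact by blast
  have QE: "Q \<subseteq> E_new" using bpath_basic(5)[OF Q(1)] .
  have h2Q: "bridge \<in> Q"
  proof (rule ccontr)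
    assume "bridge \<notin> Q"
    then have "bpath E u w' Q VQ" using QE unfolding E_new_def by (intro bpath_restrict[OF Q(1)]) auto
    from path_short[OF this] show False using Q(2) by simp
  qed
  have h20: "bridge \<noteq> {}" using Y unfolding bridge_def by blast
  have gt: "h \<subseteq> bridge \<or> h \<inter> bridge = {}" if "h \<in> E_new - {g}" for h
  proof (cases "h = bridge")
    case False
    then have h: "h \<in> E" "h \<notin> pendants" "h \<noteq> g" using that unfolding E_new_def by auto
    then have "h \<inter> Y = {}" unfolding pendants_def by blast
    moreover have "h \<inter> S = {}" using sat_facts(2)[OF h(1)] S(3) by blast
    ultimately show ?thesis unfolding bridge_def by blast
  qed simp
  have inside: "h = bridge" if "h \<in> E_new" "h \<noteq> g" "h \<subseteq> bridge" for h
  proof (rule ccontr)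
    assume "h \<noteq> bridge"
    then have h: "h \<in> E" "h \<notin> pendants" using that unfolding E_new_def by auto
    then have "h \<inter> Y = {}" "h \<inter> S = {}" using that(2) sat_facts(2)[OF h(1)] S(3) unfolding pendants_def by blast+
    then show False using that(3) edge_nonempty[OF h(1)] unfolding bridge_def by blast
  qed
  have tails: "(y \<noteq> d \<longrightarrow> card B \<le> 1) \<and> (y = d \<longrightarrow> card B \<le> t - 3)" if B: "bpath (E_new - {g}) y z B Z" "y \<in> g" for y z B Z
  proof (cases "y \<in> bridge")
    case True
    then have "\<forall>h\<in>B. h \<subseteq> bridge" using zone[OF B(1) gt] by blast
    then have "B \<subseteq> {bridge}" using inside bpath_basic(5)[OF B(1)] by blast
    then have "card B \<le> card {bridge}" by (intro card_mono) auto
    then have "card B \<le> 1" by simp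
    moreover have "1 \<le> t - 3" using t by simp
    ultimately show ?thesis using le_trans by blast
  next
    case False
    then have "\<forall>h\<in>B. h \<inter> bridge = {}" using zone[OF B(1) gt] by blast
    then have "bridge \<notin> B" using h20 by blast
    then have "bpath (E - {g}) y z B Z" using bpath_basic(5)[OF B(1)] unfolding E_new_def by (intro bpath_restrict[OF B(1)]) auto
    then show ?thesis using tail_at_g_le[OF B(2)] tail_at_d_le by blast
  qed
  show False
  proof (cases "g \<in> Q")
    case False
    have b: "bpath (E_new - {g}) u w' Q VQ" by (rule bpath_avoid[OF Q(1) False])
    have "u \<in> bridge"
    proof (rule ccontr)
      assume "u \<notin> bridge"
      then have "\<forall>h\<in>Q. h \<inter> bridge = {}" using zone[OF b gt] by blast
      then show False using h2Q h20 by blast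
    qed
    then have "\<forall>h\<in>Q. h \<subseteq> bridge" using zone[OF b gt] by blast
    then have "Q \<subseteq> {bridge}" using inside QE False by blast
    then have "card Q \<le> card {bridge}" by (intro card_mono) auto
    then show False using Q(2) t by simp
  next
    case True
    from split_tails[OF Q(1) True] obtain a b Q1 Q2 V1 V2 where
      1: "bpath (E_new - {g}) a u Q1 V1" "bpath (E_new - {g}) b w' Q2 V2" "a \<in> g" "b \<in> g" "a \<noteq> b"
      "Q = insert g (Q1 \<union> Q2)" "Q1 \<inter> Q2 = {}" "V1 \<inter> V2 = {}" "card Q = Suc (card Q1 + card Q2)" "g \<notin> Q1" "g \<notin> Q2" "g \<in> E_new" .
    then show False using tails[OF 1(1,3)] tails[OF 1(2,4)] Q(2) t by (cases "a = d"; cases "b = d") simp_all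
  qed
qed

lemma V_new_minus_bridge: "V_new - bridge \<subseteq> V - pzone"
  unfolding V_new_def bridge_def pzone_def by blast

lemma finite_V_new: "finite V_new" unfolding V_new_def using sat_facts(1) S(1) by simp

lemma E_new_uniform: "h \<in> E_new \<Longrightarrow> h \<subseteq> V_new \<and> card h = k"
proof -
  assume h: "h \<in> E_new"
  show ?thesis
  proof (cases "h = bridge")
    case True
    have "bridge \<subseteq> V_new" using Y_in_V unfolding bridge_def V_new_def by blast
    then show ?thesis using True bridge_card by simp
  next
    case False
    then have hE: "h \<in> E" "h \<notin> pendants" using h unfolding E_new_def by auto
    have "h \<inter> (\<Union>pendants - Y) = {}"
    proof (cases "h = g")
      case True
      then show ?thesis using g_pzone unfolding pzone_def by blast
    next
      case False
      then have "h \<inter> pzone = {}" using gate[OF hE(1)] hE(2) by blast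
      then show ?thesis unfolding pzone_def by blast
    qed
    then show ?thesis using sat_facts(2,3)[OF hE(1)] unfolding V_new_def by blast
  qed
qed

lemma E_new_saturated: "saturated k t V_new E_new"
  unfolding saturated_def
proof (intro conjI allI impI ballI)
  show "finite V_new" by (rule finite_V_new)
  fix e assume e: "e \<subseteq> V_new \<and> card e = k \<and> e \<notin> E_new"
  show "has_path (insert e E_new) t"
  proof (cases "e \<inter> bridge = {}")
    case True then show ?thesis using saturated_off_bridge e by blast
  next
    case False then show ?thesis using saturated_at_bridge e by blast
  qed
qed (use E_new_uniform E_new_path_free in auto)

text \<open>A path to \<open>d\<close> from outside the zone, stopped at \<open>g\<close>, does not use removed edges.\<close>
lemma E_new_connected: 
  assumes v: "v \<in> V_new" and s: "s \<in> S"
  shows "reach E_new v s"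
proof -
  have h2Ea: "bridge \<in> E_new" unfolding E_new_def by blast
  have cs: "reach E_new c s" using Y(2) s unfolding bridge_def by (intro reach_edge[OF h2Ea]) (auto simp: bridge_def)
  show ?thesis
  proof (cases "v \<in> bridge")
    case True
    show ?thesis by (rule reach_edge[OF h2Ea True]) (use s in \<open>auto simp: bridge_def\<close>)
  next
    case False
    then have vZ: "v \<in> V" "v \<notin> pzone" using V_new_minus_bridge v by auto
    have dV: "d \<in> V" using g sat_facts(2) by blast
    obtain A W where A: "bpath E v d A W" using con[OF vZ(1) dV] unfolding reach_def by blast
    have gt: "h \<subseteq> pzone \<or> h \<inter> pzone = {}" if "h \<in> E - {g}" for h using gate[of h] that by blast
    have out: "bpath E_new v z B Z" if B: "bpath (E - {g}) v z B Z" for z B Z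
    proof -
      have B0: "\<forall>h\<in>B. h \<inter> pzone = {}" using zone[OF B gt] vZ(2) by blast
      have "B \<subseteq> E_new"
      proof
        fix h assume h: "h \<in> B"
        then have "h \<in> E" "h \<noteq> g" using bpath_basic(5)[OF B] by auto
        then have "h \<notin> pendants" using gate[of h] B0 h edge_nonempty[of h] by auto
        then show "h \<in> E_new" using \<open>h \<in> E\<close> unfolding E_new_def by blast
      qed
      then show ?thesis by (rule bpath_restrict[OF B])
    qed
    have "\<exists>z\<in>g. reach E_new v z"
    proof (cases "g \<in> A")
      case False
      from out[OF bpath_avoid[OF A False]] show ?thesis using g(3) unfolding reach_def by blast
    next
      case True
      from bpath_split_edge[OF A True] obtain p A1 V1 where "bpath E v p A1 V1" "p \<in> g" "g \<notin> A1" by blast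
      from out[OF bpath_avoid[OF this(1,3)]] this(2) show ?thesis unfolding reach_def by blast
    qed
    then obtain z where z: "z \<in> g" "reach E_new v z" by blast
    have "reach E_new z c" by (rule reach_edge[OF g_in_E_new z(1) g(2)])
    then show ?thesis using reach_trans[OF z(2)] reach_trans[OF _ cs] by blast
  qed
qed

text \<open>Further pendant edges are added at the far end \<open>w\<close> of \<open>R\<close>, which the replacement leaves untouched.\<close>
lemma E_new_pendant_site: "\<exists>c'\<in>V_new. pendant_site t E_new c'"
proof -
  obtain s where s: "s \<in> S" using ex_new_vertex by blast
  have "R \<noteq> {}" using R(2) t by auto
  have RE: "R \<subseteq> E - {g}" using bpath_basic(5)[OF R(1)] .
  from bpath_first[OF bpath_rev[OF R(1)] \<open>R \<noteq> {}\<close>] obtain f' c' R' W' where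
    1: "f' \<in> E - {g}" "w \<in> f'" "c' \<in> f'" "f' \<notin> R'" "w \<notin> W'" "bpath (E - {g}) c' d R' W'" "R = insert f' R'" "WR = insert w W'" by blast
  have cR: "card R' = t - 4" using 1 R(2) bpath_basic(1)[OF 1(6)] t by simp
  have c'W: "c' \<in> W'" "d \<in> W'" using bpath_basic(3,4)[OF 1(6)] .
  have wc: "w \<noteq> c'" using 1 c'W by blast
  have f'E_new: "f' \<in> E_new" using 1 R_avoids_pzone(3) unfolding E_new_def by blast
  have bd: "bpath E_new d c' R' W'" using bpath_rev[OF bpath_restrict[OF 1(6), of E_new]] R_avoids_pzone(3) 1(7) unfolding E_new_def by blast
  have g1: "g \<notin> R'" "bridge \<notin> R'" using R_avoids_g 1(7) by auto
  have cY: "c \<notin> W'" using R_avoids_pzone(1) Y(2) 1(8) unfolding pzone_def by blast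
  have J1: "bpath E_new c c' (insert g R') (insert c W')" "card (insert g R') = Suc (card R')"
    using bpath_cons'[OF bd g_in_E_new g(2,3) g1(1) cY] by auto
  have sn: "s \<notin> insert c W'" using new_vertex_outside[OF s] WR_in_V 1(8) sat_facts(2)[OF g(1)] g(2) by blast
  have h: "bridge \<in> E_new" "s \<in> bridge" "c \<in> bridge" "bridge \<notin> insert g R'" using s Y(2) g1 bridge_neq_g unfolding E_new_def bridge_def by auto
  have J2: "bpath E_new s c' (insert bridge (insert g R')) (insert s (insert c W'))" "card (insert bridge (insert g R')) = Suc (card (insert g R'))"
    using bpath_cons'[OF J1(1) h sn] by auto
  have bd': "bpath E d c' R' W'" by (rule bpath_rev[OF bpath_mono[OF 1(6)]]) blast
  have I1: "bpath E c c' (insert g R') (insert c W')" "card (insert g R') = Suc (card R')"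
    using bpath_cons'[OF bd' g(1,2,3) g1(1) cY] by auto
  have fR: "f \<notin> R"
  proof
    assume "f \<in> R"
    then have "reach (E - {g}) d c" using bpath_reach_edge[OF R(1)] f(3) by blast
    then show False using bacyclicD[OF tree g(1,3,2)] g(4) by blast
  qed
  have xW: "x \<notin> insert c W'"
  proof
    assume "x \<in> insert c W'"
    then have "x \<in> WR" using f(4) 1(8) by blast
    then have "reach (E - {g}) d x" using bpath_reach[OF R(1)] by blast
    moreover have "reach (E - {g}) x c" using f by (intro reach_edge[of f]) auto
    ultimately have "reach (E - {g}) d c" by (rule reach_trans)
    then show False using bacyclicD[OF tree g(1,3,2)] g(4) by blast
  qed
  have fn: "f \<notin> insert g R'" using fR f(5) 1(7) by blast
  have I2: "bpath E x c' (insert f (insert g R')) (insert x (insert c W'))" "card (insert f (insert g R')) = Suc (card (insert g R'))"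
    using bpath_cons'[OF I1(1) f(1,2,3) fn xW] by auto
  have f'n: "f' \<notin> insert f (insert g R')" using 1 fR by blast
  have fz: "f' \<inter> pzone = {}" using R_avoids_pzone(2) 1(7) by blast
  have priv: "h = f'" if v: "v \<in> f' - {c'}" "h \<in> E_new" "v \<in> h" for v h
  proof (cases "h = bridge")
    case True
    have "v \<in> V" using v(1) 1(1) sat_facts(2) by blast
    moreover have "v \<notin> Y" using v fz unfolding pzone_def by blast
    ultimately show ?thesis using v(3) True S(3) unfolding bridge_def by blast
  next
    case False
    then have hE: "h \<in> E" using v unfolding E_new_def by blast
    show ?thesis
      by (rule end_private[OF tree sat_facts(4,3) _ _ 1(3) bpath_rev[OF I2(1)] f'n _ _ _ hE v(3)])
         (use k 1 v cR I1 I2 t in auto)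
  qed
  have thick: "\<exists>z\<in>a. z \<notin> insert s (insert c W')" if a: "a \<in> insert bridge (insert g R')" for a
  proof -
    obtain y where y: "y \<in> Y" "y \<noteq> c" using ex_other_Y by blast
    have yW: "y \<notin> insert s (insert c W')"
      using y R_avoids_pzone(1) new_vertex_outside[OF s] Y_in_V 1(8) unfolding pzone_def by blast
    consider "a = bridge" | "a = g" | "a \<in> R'" using a by blast
    then show ?thesis
    proof cases
      case 1 then show ?thesis using yW y unfolding bridge_def by blast
    next
      case 2 then show ?thesis using yW y Y_in_g by blast
    next
      case 3
      have "\<exists>z\<in>a. z \<notin> insert s (insert c WR)"
        by (rule R_third_vertex) (use 3 1(7) s Y(2) in \<open>auto simp: bridge_def\<close>)
      then show ?thesis using 1(8) by blast
    qed
  qed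
  have "pendant_site t E_new c'"
    unfolding pendant_site_def
    by (rule exI[of _ f'], rule exI[of _ w], rule exI[of _ s], rule exI[of _ "insert bridge (insert g R')"], rule exI[of _ "insert s (insert c W')"],
        intro conjI ballI impI f'E_new 1(2,3) wc bpath_rev[OF J2(1)])
       (use priv thick cR J1 J2 t f'n 1 bridge_new in auto)
  moreover have "c' \<in> V_new" using E_new_uniform[OF f'E_new] 1(3) by blast
  ultimately show ?thesis by blast
qed

lemma E_new_extendable: "extendable k t V_new E_new"
proof -
  obtain s where s: "s \<in> S" using ex_new_vertex by blast
  have cs: "c \<noteq> s" using new_vertex_outside[OF s] Y(2) Y_in_V by blast
  have "s \<in> bridge" using s unfolding bridge_def by blast
  from bridge_path[OF this Y(2) cs] have P: "bpath E_new s w (insert bridge (insert g R)) (insert s (insert c WR))" "card (insert bridge (insert g R)) = t - 1" by auto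
  have "far_reaching t V_new E_new" unfolding far_reaching_def
  proof
    fix v assume "v \<in> V_new"
    from long_from_everywhere[OF P(1) E_new_connected[OF this s]] P(2)
    show "\<exists>y A W. bpath E_new v y A W \<and> t - 1 \<le> 2 * card A" by simp
  qed
  then show ?thesis unfolding extendable_def using E_new_saturated E_new_pendant_site by blast
qed

text \<open>Each removed pendant edge takes \<open>k - 1\<close> vertices with it.\<close>
lemma card_new: "card V_new + card pendants * (k - 1) = card V + i" "card E_new + card pendants = card E + 1"
proof -
  have fE: "finite E" using saturated_finite[OF saturated] .
  have FsE: "pendants \<subseteq> E" unfolding pendants_def by blast
  then have fF: "finite pendants" using fE finite_subset by blast
  have eq: "\<Union>pendants - Y = (\<Union>f'\<in>pendants. f' - Y)" by blast
  have fin: "finite f'" if "f' \<in> pendants" for f' using that FsE sat_facts(1,2) finite_subset by blast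
  have "card (\<Union>f'\<in>pendants. f' - Y) = (\<Sum>f'\<in>pendants. card (f' - Y))"
  proof (rule card_UN_disjoint[OF fF])
    show "\<forall>f'\<in>pendants. finite (f' - Y)" using fin by blast
    show "\<forall>f'\<in>pendants. \<forall>h\<in>pendants. f' \<noteq> h \<longrightarrow> (f' - Y) \<inter> (h - Y) = {}"
    proof (intro ballI impI)
      fix f' h assume h: "f' \<in> pendants" "h \<in> pendants" "f' \<noteq> h"
      show "(f' - Y) \<inter> (h - Y) = {}"
      proof (rule ccontr)
        assume "(f' - Y) \<inter> (h - Y) \<noteq> {}"
        then obtain v where "v \<in> f'" "v \<notin> Y" "v \<in> h" by blast
        then show False using pendant_private[OF h(1), of v h] h FsE by blast
      qed
    qed
  qed
  also have "\<dots> = (\<Sum>f'\<in>pendants. k - 1)"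
  proof (rule sum.cong[OF refl])
    fix f' assume F: "f' \<in> pendants"
    obtain y where y: "f' \<inter> Y = {y}" using pendant_meets_Y[OF F] by blast
    then have "f' - Y = f' - {y}" "y \<in> f'" by auto
    then show "card (f' - Y) = k - 1" using fin[OF F] sat_facts(3) FsE F by auto
  qed
  finally have cU: "card (\<Union>pendants - Y) = card pendants * (k - 1)" unfolding eq by simp
  have UV: "\<Union>pendants - Y \<subseteq> V" using FsE sat_facts(2) by blast
  have "card (V - (\<Union>pendants - Y)) = card V - card (\<Union>pendants - Y)" using UV sat_facts(1) finite_subset by (intro card_Diff_subset) auto
  moreover have "card (\<Union>pendants - Y) \<le> card V" by (rule card_mono[OF sat_facts(1) UV])
  moreover have "card V_new = card (V - (\<Union>pendants - Y)) + card S"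
    unfolding V_new_def using sat_facts(1) S by (intro card_Un_disjoint) auto
  ultimately show "card V_new + card pendants * (k - 1) = card V + i" using cU S(2) by simp
  have "card (E - pendants) = card E - card pendants" using FsE fF by (intro card_Diff_subset) auto
  moreover have "card pendants \<le> card E" by (rule card_mono[OF fE FsE])
  moreover have "card E_new = Suc (card (E - pendants))" unfolding E_new_def using bridge_new fE by simp
  ultimately show "card E_new + card pendants = card E + 1" by simp
qed

end

text \<open>Here \<open>m\<close> counts the removed pendant edges.\<close>
lemma sat_tree_absorb:
  assumes k: "k \<ge> 3" and t: "t \<ge> 9" and T: "sat_tree k t (V::nat set) E" and P: "has_path E (t - 1)" and i: "1 \<le> i" "i + 2 \<le> k"
  shows "\<exists>(V'::nat set) E' m. extendable k t V' E' \<and> card V' + m * (k - 1) = card V + i \<and> card E' + m = card E + 1"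
proof -
  have S: "bacyclic E" "finite V" "\<And>e. e \<in> E \<Longrightarrow> e \<subseteq> V \<and> card e = k" using T unfolding sat_tree_def saturated_def by auto
  obtain x w A W where A: "bpath E x w A W" "card A = t - 1" using has_path_exact[OF P] by blast
  have "A \<noteq> {}" using A t by auto
  from bpath_first[OF A(1) this] obtain f c A' W' where
    1: "f \<in> E" "x \<in> f" "c \<in> f" "f \<notin> A'" "x \<notin> W'" "bpath E c w A' W'" "A = insert f A'" by blast
  have c1: "card A' = t - 2" using A 1 bpath_basic(1)[OF 1(6)] by simp
  then have "A' \<noteq> {}" using t by auto
  from bpath_first[OF 1(6) this] obtain g d R WR where
    2: "g \<in> E" "c \<in> g" "d \<in> g" "g \<notin> R" "c \<notin> WR" "bpath E d w R WR" "A' = insert g R" "W' = insert c WR" by blast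
  have c2: "card R = t - 3" using c1 2 bpath_basic(1)[OF 2(6)] by simp
  have xc: "x \<noteq> c" using 1 bpath_basic(3)[OF 1(6)] by blast
  have cd: "c \<noteq> d" using 2 bpath_basic(3)[OF 2(6)] by blast
  have fg: "f \<noteq> g" using 1 2 by blast
  have gk: "finite g" "card g = k" using S(3)[OF 2(1)] S(2) finite_subset by auto
  have "card (g - {d, c}) = k - 2" using gk 2 cd by (subst card_Diff_subset) auto
  then have "k - i - 1 \<le> card (g - {d, c})" using i by simp
  then obtain Y0 where Y0: "Y0 \<subseteq> g - {d, c}" "card Y0 = k - i - 1" "finite Y0" by (rule obtain_subset_with_card_n)
  have "c \<notin> Y0" using Y0(1) by blast
  then have "card (insert c Y0) = k - i" using Y0(2,3) i by simp
  obtain N where N: "finite N" "card N = i" "N \<inter> V = {}" using fresh_set[OF k S(2), of i] by blast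
  interpret gadget k t i V E f g x c d w R WR "insert c Y0" N
    by unfold_locales (use k t T 1 2 xc cd fg bpath_avoid[OF 2(6,4)] c2 Y0 \<open>card (insert c Y0) = k - i\<close> N i in simp_all, use Y0 2 cd in blast)
  show ?thesis using E_new_extendable card_new by blast
qed

section \<open>Disjoint copies and the construction for the upper bound\<close>

lemma bpath_image:
  assumes "inj f" "bpath E u w A W"
  shows "bpath ((`) f ` E) (f u) (f w) ((`) f ` A) (f ` W)"
  using assms(2)
proof (induction rule: bpath.induct)
  case (nil u) then show ?case using bpath.nil[of "(`) f ` E" "f u"] by simp
next
  case (cons a u v A V w)
  have "f ` a \<notin> (`) f ` A"
  proof
    assume "f ` a \<in> (`) f ` A"
    then obtain b where "b \<in> A" "f ` a = f ` b" by (elim imageE)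
    then show False using cons.hyps(4) inj_image_eq_iff[OF assms(1)] by metis
  qed
  moreover have "f u \<notin> f ` V" using cons.hyps(5) assms(1) by (simp add: inj_image_mem_iff)
  ultimately have "bpath ((`) f ` E) (f u) (f w) (insert (f ` a) ((`) f ` A)) (insert (f u) (f ` V))"
    by (rule bpath.cons[OF imageI[OF cons.hyps(1)] imageI[OF cons.hyps(2)] imageI[OF cons.hyps(3)] _ _ cons.IH])
  then show ?case by simp
qed

lemma bpath_pull:
  assumes "inj f" "bpath ((`) f ` E) u' w' A' W'"
  shows "\<forall>u. u' = f u \<longrightarrow> (\<exists>w A W. bpath E u w A W \<and> A' = (`) f ` A \<and> W' = f ` W)"
  using assms(2)
proof (induction rule: bpath.induct)
  case (nil u')
  then show ?case using bpath.nil by (metis image_empty image_insert)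
next
  case (cons a' u' v' A' V' w')
  show ?case
  proof (intro allI impI)
    fix u assume u: "u' = f u"
    obtain a where a: "a \<in> E" "a' = f ` a" using cons.hyps(1) by blast
    have ua: "u \<in> a" using cons.hyps(2) u a(2) assms(1) by (simp add: inj_image_mem_iff)
    obtain v where v: "v \<in> a" "v' = f v" using cons.hyps(3) a(2) by blast
    obtain w A W where b: "bpath E v w A W" "A' = (`) f ` A" "V' = f ` W" using cons.IH v(2) by blast
    have "a \<notin> A" using cons.hyps(4) a(2) b(2) by blast
    moreover have "u \<notin> W" using cons.hyps(5) u b(3) by blast
    ultimately have "bpath E u w (insert a A) (insert u W)" using bpath_cons'[OF b(1) a(1) ua v(1)] by blast
    moreover have "insert a' A' = (`) f ` insert a A" "insert u' V' = f ` insert u W" using a b u by auto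
    ultimately show "\<exists>w A W. bpath E u w A W \<and> insert a' A' = (`) f ` A \<and> insert u' V' = f ` W" by blast
  qed
qed

lemma card_image_edges: "inj f \<Longrightarrow> card ((`) f ` A) = card A"
  by (rule card_image) (simp add: inj_on_def inj_image_eq_iff)

lemma has_path_image:
  assumes "inj f" "t \<noteq> 0"
  shows "has_path ((`) f ` E) t \<longleftrightarrow> has_path E t"
proof
  assume "has_path E t"
  then obtain u w A W where "bpath E u w A W" "t \<le> card A" unfolding has_path_def by blast
  then show "has_path ((`) f ` E) t" using bpath_image[OF assms(1)] card_image_edges[OF assms(1)] by (metis has_pathI)
next
  assume "has_path ((`) f ` E) t"
  then obtain u' w' A' W' where b: "bpath ((`) f ` E) u' w' A' W'" "t \<le> card A'" unfolding has_path_def by blast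
  then have "A' \<noteq> {}" using assms(2) by auto
  from bpath_first[OF b(1) this] obtain a' where "a' \<in> (`) f ` E" "u' \<in> a'" by blast
  then obtain u where u: "u' = f u" by auto
  from bpath_pull[OF assms(1) b(1), rule_format, OF u] obtain w A W where "bpath E u w A W" "A' = (`) f ` A"
    by (elim exE conjE)
  then show "has_path E t" using b(2) card_image_edges[OF assms(1)] by (metis has_pathI)
qed

lemma saturated_image:
  assumes f: "inj f" "t \<noteq> 0" and S: "saturated k t V E"
  shows "saturated k t (f ` V) ((`) f ` E)"
proof -
  have SS: "finite V" "\<And>e. e \<in> E \<Longrightarrow> e \<subseteq> V" "\<And>e. e \<in> E \<Longrightarrow> card e = k" "\<not> has_path E t"
    "\<And>e. e \<subseteq> V \<Longrightarrow> card e = k \<Longrightarrow> e \<notin> E \<Longrightarrow> has_path (insert e E) t" using S unfolding saturated_def by auto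
  have c: "card (f ` e) = card e" for e by (rule card_image[OF inj_on_subset[OF f(1) subset_UNIV]])
  have "has_path (insert e' ((`) f ` E)) t" if e': "e' \<subseteq> f ` V" "card e' = k" "e' \<notin> (`) f ` E" for e'
  proof -
    obtain e where e: "e \<subseteq> V" "e' = f ` e" using e'(1) by (meson subset_imageE)
    have "e \<notin> E" using e' e by blast
    moreover have "card e = k" using e' e c by simp
    ultimately have "has_path (insert e E) t" using e SS(5) by simp
    then show ?thesis using has_path_image[OF f, of "insert e E"] e by simp
  qed
  moreover have "e' \<subseteq> f ` V \<and> card e' = k" if e'E: "e' \<in> (`) f ` E" for e'
  proof -
    obtain e where e: "e \<in> E" "e' = f ` e" using e'E by blast
    then show ?thesis using SS(2,3)[OF e(1)] c by auto
  qed
  moreover have "\<not> has_path ((`) f ` E) t" using has_path_image[OF f] SS(4) by blast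
  ultimately show ?thesis using SS(1) unfolding saturated_def by simp
qed

lemma far_reaching_image:
  assumes "inj f" "far_reaching t V E"
  shows "far_reaching t (f ` V) ((`) f ` E)"
  unfolding far_reaching_def
proof
  fix x' assume "x' \<in> f ` V"
  then obtain x where x: "x \<in> V" "x' = f x" by (elim imageE)
  obtain y A W where A: "bpath E x y A W" "t - 1 \<le> 2 * card A" using assms(2) x(1) unfolding far_reaching_def by blast
  have "bpath ((`) f ` E) x' (f y) ((`) f ` A) (f ` W)" using bpath_image[OF assms(1) A(1)] x by simp
  moreover have "t - 1 \<le> 2 * card ((`) f ` A)" using A(2) card_image_edges[OF assms(1)] by simp
  ultimately show "\<exists>y A W. bpath ((`) f ` E) x' y A W \<and> t - 1 \<le> 2 * card A" by blast
qed

text \<open>An edge across the two parts joins a path of each part, and these have at least half of the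
  \<open>t - 1\<close> remaining edges each.\<close>
lemma union_sat:
  assumes t: "t \<noteq> 0" and k: "k \<noteq> 0" and S: "saturated k t V1 E1" "far_reaching t V1 E1" "saturated k t V2 E2" "far_reaching t V2 E2" and d: "V1 \<inter> V2 = {}"
  shows "saturated k t (V1 \<union> V2) (E1 \<union> E2) \<and> far_reaching t (V1 \<union> V2) (E1 \<union> E2) \<and> E1 \<inter> E2 = {}"
proof -
  have S1: "\<And>e. e \<in> E1 \<Longrightarrow> e \<subseteq> V1 \<and> card e = k" "\<not> has_path E1 t" using S unfolding saturated_def by auto
  have S2: "\<And>e. e \<in> E2 \<Longrightarrow> e \<subseteq> V2 \<and> card e = k" "\<not> has_path E2 t" using S unfolding saturated_def by auto
  have E12: "E1 \<inter> E2 = {}"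
  proof (rule ccontr)
    assume "E1 \<inter> E2 \<noteq> {}"
    then obtain e where "e \<in> E1" "e \<in> E2" by blast
    then have "e \<subseteq> V1 \<inter> V2" "card e = k" using S1 S2 by auto
    then show False using d k by auto
  qed
  have free: "\<not> has_path (E1 \<union> E2) t"
  proof
    assume "has_path (E1 \<union> E2) t"
    then obtain u w Q W where Q: "bpath (E1 \<union> E2) u w Q W" "card Q = t" using has_path_exact by blast
    have QE: "Q \<subseteq> E1 \<union> E2" using bpath_basic(5)[OF Q(1)] .
    have z: "h \<subseteq> V1 \<or> h \<inter> V1 = {}" if "h \<in> E1 \<union> E2" for h using that S1(1) S2(1) d by blast
    have ne: "h \<noteq> {}" if "h \<in> E1 \<union> E2" for h using that S1(1) S2(1) k by fastforce
    have "Q \<subseteq> E1 \<or> Q \<subseteq> E2"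
    proof (cases "u \<in> V1")
      case True
      then have "\<forall>h\<in>Q. h \<subseteq> V1" using zone[OF Q(1) z] by blast
      have "Q \<subseteq> E1"
      proof
        fix h assume h: "h \<in> Q"
        then have "h \<subseteq> V1" "h \<noteq> {}" using \<open>\<forall>h\<in>Q. h \<subseteq> V1\<close> ne QE by auto
        then have "h \<notin> E2" using S2(1)[of h] d by auto
        then show "h \<in> E1" using h QE by auto
      qed
      then show ?thesis ..
    next
      case False
      then have "\<forall>h\<in>Q. h \<inter> V1 = {}" using zone[OF Q(1) z] by blast
      have "Q \<subseteq> E2"
      proof
        fix h assume h: "h \<in> Q"
        then have "h \<inter> V1 = {}" "h \<noteq> {}" using \<open>\<forall>h\<in>Q. h \<inter> V1 = {}\<close> ne QE by auto
        then have "h \<notin> E1" using S1(1)[of h] by auto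
        then show "h \<in> E2" using h QE by auto
      qed
      then show ?thesis ..
    qed
    then have "has_path E1 t \<or> has_path E2 t" using bpath_restrict[OF Q(1)] Q(2) has_pathI by (metis order_refl)
    then show False using S1 S2 by blast
  qed
  have sat: "has_path (insert e (E1 \<union> E2)) t" if e: "e \<subseteq> V1 \<union> V2" "card e = k" "e \<notin> E1 \<union> E2" for e
  proof -
    consider "e \<subseteq> V1" | "e \<subseteq> V2" | "\<not> e \<subseteq> V1" "\<not> e \<subseteq> V2" by blast
    then show ?thesis
    proof cases
      case 1
      then have "has_path (insert e E1) t" using S(1) e unfolding saturated_def by simp
      then show ?thesis by (rule has_path_mono) blast
    next
      case 2
      then have "has_path (insert e E2) t" using S(3) e unfolding saturated_def by simp
      then show ?thesis by (rule has_path_mono) blast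
    next
      case 3
      obtain u v where uv: "u \<in> e" "u \<notin> V2" "v \<in> e" "v \<notin> V1" using 3 by blast
      then have uv': "u \<in> V1" "v \<in> V2" using e(1) by auto
      obtain x A W where A: "bpath E1 u x A W" "t - 1 \<le> 2 * card A" using S(2) uv' unfolding far_reaching_def by blast
      obtain y B Z where B: "bpath E2 v y B Z" "t - 1 \<le> 2 * card B" using S(4) uv' unfolding far_reaching_def by blast
      have "W \<subseteq> V1" using bpath_in[OF A(1) uv'(1)] S1(1) by blast
      moreover have "Z \<subseteq> V2" using bpath_in[OF B(1) uv'(2)] S2(1) by blast
      ultimately have WZ: "W \<inter> Z = {}" using d by blast
      have AB: "A \<subseteq> E1" "B \<subseteq> E2" using bpath_basic(5)[OF A(1)] bpath_basic(5)[OF B(1)] .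
      then have n: "e \<notin> A" "e \<notin> B" "A \<inter> B = {}" using e(3) E12 by auto
      have P1: "bpath (insert e (E1 \<union> E2)) u x A W" by (rule bpath_mono[OF A(1)]) blast
      have P2: "bpath (insert e (E1 \<union> E2)) v y B Z" by (rule bpath_mono[OF B(1)]) blast
      have "bpath (insert e (E1 \<union> E2)) x y (insert e (A \<union> B)) (W \<union> Z)" "card (insert e (A \<union> B)) = Suc (card A + card B)"
        using bpath_join[OF P1 P2 _ uv(1,3) n WZ] bpath_join_card[OF P1 P2 _ uv(1,3) n WZ] by auto
      then show ?thesis using A(2) B(2) by (intro has_pathI) auto
    qed
  qed
  have "far_reaching t (V1 \<union> V2) (E1 \<union> E2)" unfolding far_reaching_def
  proof
    fix x assume "x \<in> V1 \<union> V2"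
    then show "\<exists>y A W. bpath (E1 \<union> E2) x y A W \<and> t - 1 \<le> 2 * card A"
    proof
      assume "x \<in> V1"
      then obtain y A W where A: "bpath E1 x y A W" "t - 1 \<le> 2 * card A" using S(2) unfolding far_reaching_def by blast
      have "bpath (E1 \<union> E2) x y A W" by (rule bpath_mono[OF A(1)]) blast
      then show ?thesis using A(2) by blast
    next
      assume "x \<in> V2"
      then obtain y A W where A: "bpath E2 x y A W" "t - 1 \<le> 2 * card A" using S(4) unfolding far_reaching_def by blast
      have "bpath (E1 \<union> E2) x y A W" by (rule bpath_mono[OF A(1)]) blast
      then show ?thesis using A(2) by blast
    qed
  qed
  moreover have "saturated k t (V1 \<union> V2) (E1 \<union> E2)" unfolding saturated_def
  proof (intro conjI allI impI ballI)
    show "finite (V1 \<union> V2)" using S unfolding saturated_def by simp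
    show "e \<subseteq> V1 \<union> V2" if "e \<in> E1 \<union> E2" for e using that S1(1) S2(1) by blast
    show "card e = k" if "e \<in> E1 \<union> E2" for e using that S1(1) S2(1) by blast
  qed (use free sat in auto)
  ultimately show ?thesis using E12 by blast
qed

lemma sat_tree_card:
  assumes k: "k \<ge> 3" and T: "sat_tree k t V E"
  shows "card V = (k - 1) * card E + 1"
proof -
  have S: "saturated k t V E" "bacyclic E" "\<And>x y. x \<in> V \<Longrightarrow> y \<in> V \<Longrightarrow> reach E x y" "k + 1 \<le> card V" using T unfolding sat_tree_def by auto
  have u: "\<And>e. e \<in> E \<Longrightarrow> e \<subseteq> V" "\<And>e. e \<in> E \<Longrightarrow> card e = k" using S unfolding saturated_def by auto
  have "V \<noteq> {}" using S(4) by auto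
  then obtain v where v: "v \<in> V" by blast
  have "{} \<notin> E" using u(2) k by fastforce
  have "grow v V E" by (rule connected_grow[OF saturated_finite[OF S(1)] u(1) v S(3)[OF v] \<open>{} \<notin> E\<close>])
  from grow_card[OF this u(2)] k S(2) show ?thesis by simp
qed

section \<open>Components and the lower bound\<close>

text \<open>One copy of a minimum tree absorbs the \<open>r\<close> additional vertices: \<open>r mod (k - 1)\<close> of them by an
  overlapping edge, the others by pendant edges, which also make up for the \<open>m\<close> edges removed on
  that occasion.  The other \<open>q\<close> copies are added unchanged.\<close>
lemma upper_exists:
  assumes k: "k \<ge> 3" and t: "t \<ge> 9" and a: "a = min_sat_tree k (Suc t)"
  shows "\<exists>(V::nat set) E. saturated k t V E \<and> card V = Suc q * ((k - 1) * a + 1) + r \<and>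
    card E = Suc q * a + r div (k - 1) + (if r mod (k - 1) = 0 then 0 else 1)"
proof -
  have t4: "t \<ge> 4" "t \<noteq> 0" using t by auto
  obtain T :: "nat set" and F where T: "sat_tree k t T F" "has_path F (t - 1)" "card F = a"
    using min_tree(1)[OF k t] a by blast
  have cT: "card T = (k - 1) * a + 1" using sat_tree_card[OF k T(1)] T(3) by simp
  have TE: "extendable k t T F" by (rule sat_tree_extendable[OF k t4(1) T(1,2)])
  define i where "i = r mod (k - 1)"
  define j where "j = r div (k - 1)"
  have r: "r = j * (k - 1) + i" unfolding i_def j_def by (rule div_mult_mod_eq[symmetric])
  have ik: "i < k - 1" unfolding i_def using k by simp
  have base: "\<exists>(V::nat set) E. extendable k t V E \<and> card V = (k - 1) * a + 1 + r \<and> card E = a + j + (if i = 0 then 0 else 1)"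
  proof (cases "i = 0")
    case True
    then show ?thesis using extendable_iter[OF k t4(1) TE, of j] cT T(3) r by auto
  next
    case False
    then have "1 \<le> i" "i + 2 \<le> k" using ik by auto
    from sat_tree_absorb[OF k t T(1,2) this] obtain V' :: "nat set" and E' m where
      G: "extendable k t V' E'" "card V' + m * (k - 1) = card T + i" "card E' + m = card F + 1" by blast
    obtain V'' :: "nat set" and E'' where H: "extendable k t V'' E''" "card V'' = card V' + (m + j) * (k - 1)" "card E'' = card E' + (m + j)"
      using extendable_iter[OF k t4(1) G(1), of "m + j"] by blast
    have "card V'' = (k - 1) * a + 1 + r" using H(2) G(2) cT r by (simp add: add_mult_distrib)
    moreover have "card E'' = a + j + 1" using H(3) G(3) T(3) by simp
    ultimately show ?thesis using H(1) False by auto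
  qed
  have "\<exists>(V::nat set) E. saturated k t V E \<and> far_reaching t V E \<and> card V = Suc q * ((k - 1) * a + 1) + r \<and> card E = Suc q * a + j + (if i = 0 then 0 else 1)"
  proof (induction q)
    case 0
    from base obtain V :: "nat set" and E where "extendable k t V E" "card V = (k - 1) * a + 1 + r" "card E = a + j + (if i = 0 then 0 else 1)" by blast
    then show ?case unfolding extendable_def by (intro exI[of _ V] exI[of _ E]) simp
  next
    case (Suc q)
    then obtain V :: "nat set" and E where V: "saturated k t V E" "far_reaching t V E" "card V = Suc q * ((k - 1) * a + 1) + r" "card E = Suc q * a + j + (if i = 0 then 0 else 1)" by blast
    have fV: "finite V" "finite T" using V(1) TE unfolding saturated_def extendable_def by auto
    define N where "N = Suc (Max (insert 0 V))"
    define f where "f = (\<lambda>x::nat. x + N)"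
    have inj: "inj f" unfolding f_def by (simp add: inj_on_def)
    have d: "V \<inter> f ` T = {}"
    proof -
      have "x < N" if "x \<in> V" for x unfolding N_def using fV that by (simp add: le_imp_less_Suc)
      then show ?thesis unfolding f_def by fastforce
    qed
    have ST: "saturated k t (f ` T) ((`) f ` F)" "far_reaching t (f ` T) ((`) f ` F)"
      using saturated_image[OF inj t4(2)] far_reaching_image[OF inj] TE unfolding extendable_def by auto
    have k0: "k \<noteq> 0" using k by simp
    from union_sat[OF t4(2) k0 V(1,2) ST d] have U: "saturated k t (V \<union> f ` T) (E \<union> (`) f ` F)" "far_reaching t (V \<union> f ` T) (E \<union> (`) f ` F)" "E \<inter> (`) f ` F = {}" by auto
    have "card (f ` T) = card T" by (rule card_image[OF inj_on_subset[OF inj subset_UNIV]])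
    then have "card (V \<union> f ` T) = card V + card T" using fV d by (simp add: card_Un_disjoint)
    moreover have "card (E \<union> (`) f ` F) = card E + card F"
      using U(3) saturated_finite[OF V(1)] saturated_finite[OF ST(1)] card_image_edges[OF inj, of F] by (simp add: card_Un_disjoint)
    ultimately show ?case using U V(3,4) cT T(3) by (intro exI[of _ "V \<union> f ` T"] exI[of _ "E \<union> (`) f ` F"]) auto
  qed
  then show ?thesis unfolding i_def j_def by blast
qed

lemma add_div_le: "A \<ge> 1 \<Longrightarrow> (N + \<delta>) div A \<le> N div A + (\<delta>::nat)"
proof -
  assume A: "A \<ge> 1"
  have "(N + \<delta>) div A \<le> (N + \<delta> * A) div A" using A by (intro div_le_mono) auto
  also have "\<dots> = N div A + \<delta>" using A by simp
  finally show ?thesis .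
qed

context
  fixes k t :: nat and V :: "nat set" and E :: "nat set set"
  assumes k: "k \<ge> 3" and t: "t \<ge> 9" and S: "saturated k t V E"
begin

lemma hyp_facts: "finite V" "\<And>e. e \<in> E \<Longrightarrow> e \<subseteq> V" "\<And>e. e \<in> E \<Longrightarrow> card e = k" "\<not> has_path E t"
    "\<And>e. e \<subseteq> V \<Longrightarrow> card e = k \<Longrightarrow> e \<notin> E \<Longrightarrow> has_path (insert e E) t" "finite E"
  using S saturated_finite[OF S] unfolding saturated_def by auto

definition component :: "nat \<Rightarrow> nat set" where "component v = {u. reach E v u}"
definition components where "components = component ` V"
definition comp_edges where "comp_edges C = {e\<in>E. e \<subseteq> C}"

lemma edge_not_empty:
  assumes "e \<in> E"
  shows "\<exists>x. x \<in> e"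
proof -
  have "e \<noteq> {}" using hyp_facts(3)[OF assms] k by auto
  then show ?thesis by blast
qed

lemma component_subset: "v \<in> V \<Longrightarrow> component v \<subseteq> V"
  unfolding component_def using reach_in[of E v _ V] hyp_facts(2) by blast

lemma component_eq:
  assumes "u \<in> component v"
  shows "component u = component v"
proof -
  have uv: "reach E v u" using assms unfolding component_def by simp
  have "reach E v w" if "reach E u w" for w by (rule reach_trans[OF uv that])
  moreover have "reach E u w" if "reach E v w" for w by (rule reach_trans[OF reach_sym[OF uv] that])
  ultimately show ?thesis unfolding component_def by auto
qed

lemma components_disjoint: "C \<in> components \<Longrightarrow> D \<in> components \<Longrightarrow> C \<noteq> D \<Longrightarrow> C \<inter> D = {}"
proof (rule ccontr)
  assume h: "C \<in> components" "D \<in> components" "C \<noteq> D" "C \<inter> D \<noteq> {}"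
  then obtain a b z where "C = component a" "D = component b" "z \<in> component a" "z \<in> component b" unfolding components_def by blast
  then show False using component_eq h(3) by metis
qed

lemma components_subset: "C \<in> components \<Longrightarrow> C \<subseteq> V" unfolding components_def using component_subset by blast
lemma components_finite: "finite components" "C \<in> components \<Longrightarrow> finite C"
proof -
  show "finite components" unfolding components_def using hyp_facts(1) by simp
  show "finite C" if "C \<in> components" by (rule finite_subset[OF components_subset[OF that] hyp_facts(1)])
qed
lemma Union_components: "\<Union>components = V"
proof
  show "\<Union>components \<subseteq> V" using components_subset by blast
  show "V \<subseteq> \<Union>components" unfolding components_def component_def by (auto intro: reach_refl)
qed

lemma edge_in_component: "C \<in> components \<Longrightarrow> e \<in> E \<Longrightarrow> e \<inter> C \<noteq> {} \<Longrightarrow> e \<subseteq> C"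
proof
  fix y assume h: "C \<in> components" "e \<in> E" "e \<inter> C \<noteq> {}" "y \<in> e"
  then obtain v z where v: "C = component v" "z \<in> e" "z \<in> component v" unfolding components_def by blast
  then have "reach E v z" unfolding component_def by simp
  from reach_trans[OF this reach_edge[OF h(2) v(2) h(4)]] show "y \<in> C" using v(1) unfolding component_def by simp
qed

lemma card_verts_sum: "card V = (\<Sum>C\<in>components. card C)"
proof -
  have "card (\<Union>components) = sum card components"
    by (rule card_Union_disjoint) (use components_disjoint components_finite in \<open>auto simp: pairwise_def disjnt_def\<close>)
  then show ?thesis unfolding Union_components .
qed

lemma card_edges_sum: "card E = (\<Sum>C\<in>components. card (comp_edges C))"
proof -
  have "E = (\<Union>C\<in>components. comp_edges C)"
  proof
    show "(\<Union>C\<in>components. comp_edges C) \<subseteq> E" unfolding comp_edges_def by blast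
    show "E \<subseteq> (\<Union>C\<in>components. comp_edges C)"
    proof
      fix e assume e: "e \<in> E"
      then obtain x where x: "x \<in> e" using edge_not_empty by blast
      then have "x \<in> V" using hyp_facts(2)[OF e] by blast
      then obtain C where C: "C \<in> components" "x \<in> C" using Union_components by blast
      then have "e \<subseteq> C" using edge_in_component[OF C(1) e] x by blast
      then show "e \<in> (\<Union>C\<in>components. comp_edges C)" using C e unfolding comp_edges_def by blast
    qed
  qed
  moreover have "card (\<Union>C\<in>components. comp_edges C) = (\<Sum>C\<in>components. card (comp_edges C))"
  proof (rule card_UN_disjoint[OF components_finite(1)])
    show "\<forall>C\<in>components. finite (comp_edges C)" unfolding comp_edges_def using hyp_facts(6) by simp
    show "\<forall>C\<in>components. \<forall>D\<in>components. C \<noteq> D \<longrightarrow> comp_edges C \<inter> comp_edges D = {}"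
    proof (intro ballI impI)
      fix C D assume h: "C \<in> components" "D \<in> components" "C \<noteq> D"
      show "comp_edges C \<inter> comp_edges D = {}"
      proof (rule ccontr)
        assume "comp_edges C \<inter> comp_edges D \<noteq> {}"
        then obtain e where e: "e \<in> E" "e \<subseteq> C" "e \<subseteq> D" unfolding comp_edges_def by blast
        obtain x where "x \<in> e" using edge_not_empty[OF e(1)] by blast
        then show False using components_disjoint[OF h] e by blast
      qed
    qed
  qed
  ultimately show ?thesis by simp
qed

lemma edge_in_or_out: "C \<in> components \<Longrightarrow> h \<in> E \<Longrightarrow> h \<subseteq> C \<or> h \<inter> C = {}"
  using edge_in_component by blast

lemma comp_edges_reach: "C \<in> components \<Longrightarrow> x \<in> C \<Longrightarrow> y \<in> C \<Longrightarrow> reach (comp_edges C) x y"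
proof -
  assume h: "C \<in> components" "x \<in> C" "y \<in> C"
  then obtain v where v: "C = component v" unfolding components_def by blast
  have "reach E v x" "reach E v y" using h v unfolding component_def by simp_all
  then have "reach E x y" by (rule reach_trans[OF reach_sym])
  then obtain A W where b: "bpath E x y A W" unfolding reach_def by blast
  have "\<forall>a\<in>A. a \<subseteq> C" using zone[OF b edge_in_or_out[OF h(1)]] h(2) by blast
  then have "A \<subseteq> comp_edges C" using bpath_basic(5)[OF b] unfolding comp_edges_def by blast
  then show ?thesis using bpath_restrict[OF b] unfolding reach_def by blast
qed

lemma component_card:
  assumes C: "C \<in> components"
  shows "card C \<le> (k - 1) * card (comp_edges C) + 1 \<and> (card C = (k - 1) * card (comp_edges C) + 1 \<longleftrightarrow> bacyclic (comp_edges C))"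
proof -
  obtain v where v: "v \<in> C" using C unfolding components_def component_def by (auto intro: reach_refl)
  have "grow v C (comp_edges C)"
    by (rule connected_grow[OF _ _ v comp_edges_reach[OF C v]]) (use hyp_facts(6) edge_not_empty in \<open>auto simp: comp_edges_def\<close>)
  from grow_card[OF this, of k] show ?thesis using hyp_facts(3) k unfolding comp_edges_def by simp
qed

text \<open>A path through an edge added inside a component stays in that component.\<close>
lemma component_saturated:
  assumes C: "C \<in> components"
  shows "saturated k t C (comp_edges C)"
proof -
  have free: "\<not> has_path (comp_edges C) t" using has_path_mono[of "comp_edges C" t E] hyp_facts(4) unfolding comp_edges_def by blast
  have "has_path (insert e (comp_edges C)) t" if e: "e \<subseteq> C" "card e = k" "e \<notin> comp_edges C" for e
  proof -
    have eE: "e \<notin> E" using e unfolding comp_edges_def by blast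
    have "e \<subseteq> V" using e components_subset[OF C] by blast
    then obtain u w Q W where Q: "bpath (insert e E) u w Q W" "card Q = t"
      using has_path_exact[OF hyp_facts(5)[OF _ e(2) eE]] by blast
    have QE: "Q \<subseteq> insert e E" using bpath_basic(5)[OF Q(1)] .
    have z: "h \<subseteq> C \<or> h \<inter> C = {}" if "h \<in> insert e E" for h using that e(1) edge_in_or_out[OF C, of h] by blast
    have e0: "e \<noteq> {}" using e(2) k by auto
    have "u \<in> C"
    proof (rule ccontr)
      assume "u \<notin> C"
      then have "\<forall>a\<in>Q. a \<inter> C = {}" using zone[OF Q(1) z] by blast
      then have "e \<notin> Q" using e(1) e0 by blast
      then have "bpath E u w Q W" using QE by (intro bpath_restrict[OF Q(1)]) auto
      then show False using hyp_facts(4) Q(2) has_pathI by (metis order_refl)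
    qed
    then have "\<forall>a\<in>Q. a \<subseteq> C" using zone[OF Q(1) z] by blast
    then have "Q \<subseteq> insert e (comp_edges C)" using QE unfolding comp_edges_def by blast
    then have "bpath (insert e (comp_edges C)) u w Q W" by (rule bpath_restrict[OF Q(1)])
    then show ?thesis using Q(2) has_pathI by (metis order_refl)
  qed
  then show ?thesis unfolding saturated_def using free hyp_facts(3) components_finite(2)[OF C] unfolding comp_edges_def by auto
qed

text \<open>Tree components with at most one edge are isolated vertices or single edges.\<close>
definition small_trees where "small_trees = {C\<in>components. bacyclic (comp_edges C) \<and> card (comp_edges C) \<le> 1}"
definition big_trees where "big_trees = {C\<in>components. bacyclic (comp_edges C) \<and> 2 \<le> card (comp_edges C)}"
definition small_part where "small_part = \<Union>small_trees"

lemma card_le_edges_plus_trees: "card V \<le> (k - 1) * card E + (card small_trees + card big_trees)"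
proof -
  have fin: "finite small_trees" "finite big_trees" unfolding small_trees_def big_trees_def using components_finite by auto
  have "card V \<le> (\<Sum>C\<in>components. (k - 1) * card (comp_edges C) + (if C \<in> small_trees \<union> big_trees then 1 else 0))"
    unfolding card_verts_sum
  proof (rule sum_mono)
    fix C assume C: "C \<in> components"
    show "card C \<le> (k - 1) * card (comp_edges C) + (if C \<in> small_trees \<union> big_trees then 1 else 0)"
    proof (cases "bacyclic (comp_edges C)")
      case True
      then have "C \<in> small_trees \<union> big_trees" unfolding small_trees_def big_trees_def using C by auto
      then show ?thesis using component_card[OF C] by simp
    next
      case False
      then have "card C \<noteq> (k - 1) * card (comp_edges C) + 1" using component_card[OF C] by blast
      then have "card C \<le> (k - 1) * card (comp_edges C)" using component_card[OF C] by linarith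
      then show ?thesis by simp
    qed
  qed
  also have "\<dots> = (k - 1) * card E + card (components \<inter> (small_trees \<union> big_trees))"
    using components_finite(1) by (simp add: sum.distrib sum_distrib_left[symmetric] card_edges_sum[symmetric] sum.If_cases Int_def)
  also have "components \<inter> (small_trees \<union> big_trees) = small_trees \<union> big_trees" unfolding small_trees_def big_trees_def by blast
  also have "card (small_trees \<union> big_trees) = card small_trees + card big_trees"
    by (rule card_Un_disjoint[OF fin]) (auto simp: small_trees_def big_trees_def)
  finally show ?thesis .
qed

lemma big_tree_sat_tree: "C \<in> big_trees \<Longrightarrow> sat_tree k t C (comp_edges C)"
proof -
  assume "C \<in> big_trees"
  then have C: "C \<in> components" "bacyclic (comp_edges C)" "2 \<le> card (comp_edges C)" unfolding big_trees_def by auto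
  have "card C = (k - 1) * card (comp_edges C) + 1" using component_card[OF C(1)] C(2) by blast
  moreover have "(k - 1) * 2 \<le> (k - 1) * card (comp_edges C)" using C(3) by simp
  ultimately have "k + 1 \<le> card C" using k by linarith
  then show ?thesis unfolding sat_tree_def using component_saturated[OF C(1)] C comp_edges_reach[OF C(1)] by blast
qed

text \<open>Each large tree component is a saturated linear tree and thus has at least as many vertices as a
  minimum one.\<close>
lemma big_trees_room: "card big_trees * ((k - 1) * min_sat_tree k (Suc t) + 1) + card small_part \<le> card V"
proof -
  have fin: "finite small_trees" "finite big_trees" unfolding small_trees_def big_trees_def using components_finite by auto
  have sub: "small_trees \<subseteq> components" "big_trees \<subseteq> components" "small_trees \<inter> big_trees = {}" unfolding small_trees_def big_trees_def by auto
  have cU: "card small_part = (\<Sum>C\<in>small_trees. card C)" unfolding small_part_def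
    by (rule card_Union_disjoint) (use components_disjoint components_finite sub in \<open>auto simp: pairwise_def disjnt_def\<close>)
  have "card big_trees * ((k - 1) * min_sat_tree k (Suc t) + 1) = (\<Sum>C\<in>big_trees. (k - 1) * min_sat_tree k (Suc t) + 1)" by simp
  also have "\<dots> \<le> (\<Sum>C\<in>big_trees. card C)"
  proof (rule sum_mono)
    fix C assume C: "C \<in> big_trees"
    have "min_sat_tree k (Suc t) \<le> card (comp_edges C)" by (rule min_tree(2)[OF k t big_tree_sat_tree[OF C]])
    then have "(k - 1) * min_sat_tree k (Suc t) \<le> (k - 1) * card (comp_edges C)" by simp
    then show "(k - 1) * min_sat_tree k (Suc t) + 1 \<le> card C" using sat_tree_card[OF k big_tree_sat_tree[OF C]] by linarith
  qed
  finally have "card big_trees * ((k - 1) * min_sat_tree k (Suc t) + 1) + card small_part \<le> (\<Sum>C\<in>big_trees. card C) + (\<Sum>C\<in>small_trees. card C)" using cU by simp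
  also have "\<dots> = (\<Sum>C\<in>big_trees \<union> small_trees. card C)" using fin sub by (subst sum.union_disjoint) auto
  also have "\<dots> \<le> (\<Sum>C\<in>components. card C)" using components_finite sub by (intro sum_mono2) auto
  finally show ?thesis unfolding card_verts_sum .
qed

lemma small_part_edge_isolated: "e \<in> E \<Longrightarrow> e \<inter> small_part \<noteq> {} \<Longrightarrow> h \<in> E \<Longrightarrow> h \<inter> e \<noteq> {} \<Longrightarrow> h = e"
proof -
  assume h: "e \<in> E" "e \<inter> small_part \<noteq> {}" "h \<in> E" "h \<inter> e \<noteq> {}"
  then obtain C where C: "C \<in> small_trees" "e \<inter> C \<noteq> {}" unfolding small_part_def by blast
  then have Cc: "C \<in> components" "card (comp_edges C) \<le> Suc 0" unfolding small_trees_def by auto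
  have e: "e \<subseteq> C" by (rule edge_in_component[OF Cc(1) h(1) C(2)])
  then have "h \<inter> C \<noteq> {}" using h(4) by blast
  then have "h \<subseteq> C" by (rule edge_in_component[OF Cc(1) h(3)])
  then have "e \<in> comp_edges C" "h \<in> comp_edges C" using e h unfolding comp_edges_def by auto
  moreover have "finite (comp_edges C)" unfolding comp_edges_def using hyp_facts(6) by simp
  ultimately show ?thesis using Cc(2) card_le_Suc0_iff_eq by blast
qed

lemma small_part_tail: "bpath E a z B Z \<Longrightarrow> a \<in> small_part \<Longrightarrow> card B \<le> 1"
proof -
  assume b: "bpath E a z B Z" and a: "a \<in> small_part"
  show ?thesis
  proof (cases "B = {}")
    case False
    from bpath_first[OF b False] obtain h v B' Z' where
      1: "h \<in> E" "a \<in> h" "v \<in> h" "h \<notin> B'" "bpath E v z B' Z'" "B = insert h B'" by blast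
    have "B' = {}"
    proof (rule ccontr)
      assume n: "B' \<noteq> {}"
      from bpath_first[OF 1(5) n] obtain h' B'' where h': "h' \<in> E" "v \<in> h'" "B' = insert h' B''" by blast
      have "h' = h" by (rule small_part_edge_isolated[OF 1(1) _ h'(1)]) (use 1 a h' in blast)+
      then show False using h' 1 by blast
    qed
    then show ?thesis using 1 by simp
  qed simp
qed

lemma added_edge:
  assumes "e \<subseteq> V" "card e = k" "e \<notin> E"
  obtains a b y z A B Y Z where "bpath E a y A Y" "bpath E b z B Z" "a \<in> e" "b \<in> e" "a \<noteq> b" "t = Suc (card A + card B)"
proof -
  obtain u w Q W where Q: "bpath (insert e E) u w Q W" "card Q = t" using has_path_exact[OF hyp_facts(5)[OF assms]] by blast
  have "e \<in> Q"
  proof (rule ccontr)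
    assume "e \<notin> Q"
    then have "bpath E u w Q W" using bpath_basic(5)[OF Q(1)] by (intro bpath_restrict[OF Q(1)]) auto
    then show False using hyp_facts(4) Q(2) has_pathI by (metis order_refl)
  qed
  from split_tails[OF Q(1) this] obtain a b Q1 Q2 V1 V2 where
    1: "bpath (insert e E - {e}) a u Q1 V1" "bpath (insert e E - {e}) b w Q2 V2" "a \<in> e" "b \<in> e" "a \<noteq> b"
      "Q = insert e (Q1 \<union> Q2)" "Q1 \<inter> Q2 = {}" "V1 \<inter> V2 = {}" "card Q = Suc (card Q1 + card Q2)" "e \<notin> Q1" "e \<notin> Q2" "e \<in> insert e E" .
  have "insert e E - {e} = E" using assms(3) by blast
  then show ?thesis using that[of a u Q1 V1 b w Q2 V2] 1 Q(2) by simp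
qed

lemma small_part_subset: "small_part \<subseteq> V" unfolding small_part_def small_trees_def using components_subset by blast

text \<open>In \<open>small_part\<close> edges are isolated, so an edge added there lies on paths with at most three edges
  only.\<close>
lemma small_part_full: "e \<subseteq> small_part \<Longrightarrow> card e = k \<Longrightarrow> e \<in> E"
proof (rule ccontr)
  assume e: "e \<subseteq> small_part" "card e = k" "e \<notin> E"
  have "e \<subseteq> V" using e small_part_subset by blast
  from added_edge[OF this e(2,3)] obtain a b y z A B Y Z where
    1: "bpath E a y A Y" "bpath E b z B Z" "a \<in> e" "b \<in> e" "a \<noteq> b" "t = Suc (card A + card B)" .
  have "card A \<le> 1" "card B \<le> 1" using small_part_tail[OF 1(1)] small_part_tail[OF 1(2)] 1 e(1) by auto
  then show False using 1(6) t by simp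
qed

lemma finite_small_part: "finite small_part" using small_part_subset hyp_facts(1) finite_subset by blast

text \<open>Otherwise exchanging one vertex of an edge inside \<open>small_part\<close> gives another edge that meets it.\<close>
lemma card_small_part_le: "card small_part \<le> k"
proof (rule ccontr)
  assume "\<not> card small_part \<le> k"
  then have "k \<le> card small_part" by simp
  then obtain e where e: "e \<subseteq> small_part" "card e = k" "finite e" by (rule obtain_subset_with_card_n)
  have eE: "e \<in> E" using small_part_full e by blast
  have "\<not> small_part \<subseteq> e" using card_mono[OF e(3), of small_part] e(2) \<open>\<not> card small_part \<le> k\<close> by auto
  then obtain z where z: "z \<in> small_part" "z \<notin> e" by blast
  obtain y where y: "y \<in> e" using edge_not_empty[OF eE] by blast
  let ?h = "insert z (e - {y})"
  have "card ?h = k" using e y z k by simp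
  moreover have "?h \<subseteq> small_part" using e z by blast
  ultimately have hE: "?h \<in> E" using small_part_full by blast
  obtain x where "x \<in> e" "x \<noteq> y" using ex_other[OF k e(2), of y y] by blast
  then have "?h \<inter> e \<noteq> {}" by blast
  then have "?h = e" using small_part_edge_isolated[OF eE _ hE] y e by blast
  then show False using z by blast
qed

lemma small_part_isolated: "card small_part < k \<Longrightarrow> e \<in> E \<Longrightarrow> e \<inter> small_part = {}"
proof (rule ccontr)
  assume h: "card small_part < k" "e \<in> E" "e \<inter> small_part \<noteq> {}"
  then obtain C where C: "C \<in> small_trees" "e \<inter> C \<noteq> {}" unfolding small_part_def by blast
  then have "e \<subseteq> C" using edge_in_component h unfolding small_trees_def by blast
  then have "e \<subseteq> small_part" using C unfolding small_part_def by blast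
  then have "card e \<le> card small_part" by (rule card_mono[OF finite_small_part])
  then show False using hyp_facts(3)[OF h(2)] h(1) by simp
qed

lemma small_trees_one_edge: "card small_part = k \<Longrightarrow> card small_trees \<le> 1"
proof -
  assume c: "card small_part = k"
  have UE: "small_part \<in> E" using small_part_full c by blast
  have "C = D" if "C \<in> small_trees" "D \<in> small_trees" for C D
  proof -
    have edge_not_empty: "C' \<noteq> {}" if "C' \<in> small_trees" for C' using that unfolding small_trees_def components_def component_def by (auto intro: reach_refl)
    have CC: "C \<in> components" "D \<in> components" using that unfolding small_trees_def by auto
    have "small_part \<inter> C \<noteq> {}" using edge_not_empty[OF that(1)] that(1) unfolding small_part_def by blast
    then have "small_part \<subseteq> C" by (rule edge_in_component[OF CC(1) UE])
    then have "C \<inter> D \<noteq> {}" using edge_not_empty[OF that(2)] that(2) unfolding small_part_def by blast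
    then show ?thesis using components_disjoint[OF CC] by blast
  qed
  moreover have "finite small_trees" unfolding small_trees_def using components_finite by simp
  ultimately show ?thesis using card_le_Suc0_iff_eq[of small_trees] by simp
qed

lemma small_trees_le_isolated: "card small_part < k \<Longrightarrow> card small_trees \<le> card small_part"
proof -
  assume c: "card small_part < k"
  have fin: "finite small_trees" unfolding small_trees_def using components_finite by simp
  have "card small_trees = (\<Sum>C\<in>small_trees. 1)" by simp
  also have "\<dots> \<le> (\<Sum>C\<in>small_trees. card C)"
  proof (rule sum_mono)
    fix C assume "C \<in> small_trees"
    then have "C \<noteq> {}" "finite C" using components_finite(2) unfolding small_trees_def components_def component_def by (auto intro: reach_refl)
    then show "1 \<le> card C" by (simp add: Suc_le_eq card_gt_0_iff)
  qed
  also have "\<dots> = card small_part" unfolding small_part_def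
    by (rule card_Union_disjoint[symmetric]) (use components_disjoint components_finite in \<open>auto simp: pairwise_def disjnt_def small_trees_def\<close>)
  finally show ?thesis .
qed

text \<open>The \<open>k - 1\<close> isolated vertices together with any vertex \<open>v\<close> form a new edge, which can only be the
  first edge of a path, followed by a path with \<open>t - 1\<close> edges from \<open>v\<close>.  In a tree this contradicts
  the bound on path lengths: take such a path, with first edge \<open>g\<close> and second vertex \<open>v2\<close>, and a path
  with \<open>t - 1\<close> edges from \<open>v2\<close>.  If the latter avoids \<open>g\<close>, prepend \<open>g\<close> to it; otherwise it begins with
  \<open>g\<close> and its remainder can be joined, through \<open>g\<close>, to the remainder of the first path.\<close>
lemma no_big_trees: 
  assumes c: "card small_part = k - 1"
  shows "big_trees = {}"
proof (rule ccontr)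
  assume "big_trees \<noteq> {}"
  then obtain C where CT: "C \<in> big_trees" by blast
  then have C: "C \<in> components" "bacyclic (comp_edges C)" unfolding big_trees_def by auto
  have cU: "card small_part < k" using c k by simp
  have sub: "comp_edges C \<subseteq> E" unfolding comp_edges_def by blast
  have z: "h \<subseteq> C \<or> h \<inter> C = {}" if "h \<in> E" for h using edge_in_or_out[OF C(1) that] .
  have long: "\<exists>y A W. bpath (comp_edges C) v y A W \<and> t - 1 \<le> card A" if v: "v \<in> C" for v
  proof -
    have "C \<notin> small_trees" using CT unfolding big_trees_def small_trees_def by auto
    have vU: "v \<notin> small_part"
    proof
      assume "v \<in> small_part"
      then obtain D where D: "D \<in> small_trees" "v \<in> D" unfolding small_part_def by blast
      then have "D \<in> components" "D \<noteq> C" using \<open>C \<notin> small_trees\<close> unfolding small_trees_def by auto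
      then show False using components_disjoint[OF _ C(1)] D v by blast
    qed
    let ?e = "insert v small_part"
    have eV: "?e \<subseteq> V" using small_part_subset v components_subset[OF C(1)] by blast
    have ce: "card ?e = k" using vU finite_small_part c k by simp
    have U0: "small_part \<noteq> {}" using c k by auto
    have "?e \<inter> small_part \<noteq> {}" using U0 by blast
    then have eE: "?e \<notin> E" using small_part_isolated[OF cU, of ?e] by blast
    from added_edge[OF eV ce eE] obtain a b y z A B Y Z where
      1: "bpath E a y A Y" "bpath E b z B Z" "a \<in> ?e" "b \<in> ?e" "a \<noteq> b" "t = Suc (card A + card B)" .
    have emp: "card B = 0" if B: "bpath E b z B Z" "b \<in> small_part" for b z B Z
    proof -
      have "B = {}"
      proof (rule ccontr)
        assume "B \<noteq> {}"
        from bpath_first[OF B(1) this] obtain h where "h \<in> E" "b \<in> h" by blast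
        then show False using small_part_isolated[OF cU] B(2) by blast
      qed
      then show ?thesis by simp
    qed
    have "\<exists>y A W. bpath E v y A W \<and> t - 1 \<le> card A"
    proof (cases "a = v")
      case True
      then have "b \<in> small_part" using 1 by blast
      then show ?thesis using emp[OF 1(2)] 1 True by auto
    next
      case False
      then have aU: "card A = 0" using emp[OF 1(1)] 1(3) by blast
      show ?thesis
      proof (cases "b = v")
        case True then show ?thesis using aU 1 by auto
      next
        case False
        then have "card B = 0" using emp[OF 1(2)] 1(4) by blast
        then show ?thesis using aU 1(6) t by simp
      qed
    qed
    then obtain y A W where A: "bpath E v y A W" "t - 1 \<le> card A" by blast
    have "\<forall>a\<in>A. a \<subseteq> C" using zone[OF A(1) z] v by blast
    then have "A \<subseteq> comp_edges C" using bpath_basic(5)[OF A(1)] unfolding comp_edges_def by blast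
    then have "bpath (comp_edges C) v y A W" by (rule bpath_restrict[OF A(1)])
    then show ?thesis using A(2) by blast
  qed
  have no: "\<not> (t \<le> card A)" if "bpath (comp_edges C) u y A W" for u y A W
    using has_pathI[OF that] component_saturated[OF C(1)] unfolding saturated_def by blast
  obtain v where v: "v \<in> C" using C(1) unfolding components_def component_def by (auto intro: reach_refl)
  obtain y A W where A: "bpath (comp_edges C) v y A W" "t - 1 \<le> card A" using long[OF v] by blast
  then have "A \<noteq> {}" using t by auto
  from bpath_first[OF A(1) this] obtain g v2 A2 W2 where
    1: "g \<in> comp_edges C" "v \<in> g" "v2 \<in> g" "g \<notin> A2" "v \<notin> W2" "bpath (comp_edges C) v2 y A2 W2" "A = insert g A2" by blast
  have cA: "t - 2 \<le> card A2" using A 1 bpath_basic(1)[OF 1(6)] by simp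
  have vv: "v \<noteq> v2" using 1 bpath_basic(3)[OF 1(6)] by blast
  have "v2 \<in> C" using 1(1,3) unfolding comp_edges_def by blast
  then obtain x R Z where R: "bpath (comp_edges C) v2 x R Z" "t - 1 \<le> card R" using long by blast
  show False
  proof (cases "g \<in> R")
    case False
    note e = bacyclic_extend(1,2)[OF C(2) 1(1,3) bpath_avoid[OF R(1) False] 1(2) vv]
    show False using no[OF e(1)] e(2) R(2) t by simp
  next
    case True
    from bacyclic_first_edge[OF C(2) 1(1,3) R(1) True] obtain s R2 Z2 where
      s: "s \<in> g" "s \<noteq> v2" "bpath (comp_edges C - {g}) s x R2 Z2" "R = insert g R2" "Z = insert v2 Z2" "g \<notin> R2" "card R = Suc (card R2)" .
    note j = bacyclic_join[OF C(2) 1(1) s(1) 1(3) s(2,3) bpath_avoid[OF 1(6,4)]]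
    show False using no[OF j(1)] j(2) s(7) R(2) cA t by simp
  qed
qed

text \<open>With \<open>N = card V - (k - 2)\<close> it remains to see that there are at most \<open>k - 2 + N div A\<close> tree
  components.  The hypothesis gives \<open>N \<ge> A\<close>, which pays for the case of \<open>k - 1\<close> isolated vertices,
  where no large tree component exists.\<close>
lemma lower_bound:
  assumes n: "(k - 1) * min_sat_tree k (Suc t) + k - 1 \<le> card V"
  shows "card V \<le> (k - 1) * card E + (k - 2) + (card V - (k - 2)) div ((k - 1) * min_sat_tree k (Suc t) + 1)"
proof -
  define A where "A = (k - 1) * min_sat_tree k (Suc t) + 1"
  define N where "N = card V - (k - 2)"
  have A1: "A \<ge> 1" unfolding A_def by simp
  have NA: "A \<le> N" using n k unfolding A_def N_def by linarith
  have cV: "card V = N + (k - 2)" using n k unfolding N_def by linarith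
  have B: "card big_trees * A + card small_part \<le> N + (k - 2)" using big_trees_room unfolding A_def[symmetric] cV .
  have "card small_trees + card big_trees \<le> (k - 2) + N div A"
  proof -
    consider "card small_part = k" | "card small_part = k - 1" | "card small_part \<le> k - 2" using card_small_part_le by linarith
    then show ?thesis
    proof cases
      case 1
      then have "card big_trees * A \<le> N" using B k by linarith
      then have "card big_trees \<le> N div A" using A1 by (simp add: less_eq_div_iff_mult_less_eq)
      then show ?thesis using small_trees_one_edge[OF 1] k by linarith
    next
      case 2
      then have "card small_trees \<le> k - 1" using small_trees_le_isolated k by simp
      moreover have "1 \<le> N div A" using NA A1 by (simp add: less_eq_div_iff_mult_less_eq)
      ultimately show ?thesis using no_big_trees[OF 2] by simp
    next
      case 3
      then have "card big_trees * A \<le> N + (k - 2 - card small_part)" using B by linarith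
      then have "card big_trees \<le> (N + (k - 2 - card small_part)) div A" using A1 by (simp add: less_eq_div_iff_mult_less_eq)
      also have "\<dots> \<le> N div A + (k - 2 - card small_part)" by (rule add_div_le[OF A1])
      finally have "card big_trees \<le> N div A + (k - 2 - card small_part)" .
      moreover have "card small_trees \<le> card small_part" using small_trees_le_isolated 3 k by simp
      ultimately show ?thesis using 3 by linarith
    qed
  qed
  then show ?thesis using card_le_edges_plus_trees unfolding A_def N_def by linarith
qed

end

section \<open>The saturation number\<close>

lemma sat_eq_Inf:
  assumes "t \<noteq> 0"
  shows "sat k n (path_graph (Suc t)) = Inf {card E | (V::nat set) E. saturated k t V E \<and> card V = n}"
proof -
  have "{card (edges H) | H :: nat hypergraph. Berge_saturated k (path_graph (Suc t)) H \<and> card (verts H) = n}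
    = {card E | (V::nat set) E. saturated k t V E \<and> card V = n}"
    unfolding Berge_saturated_iff[OF assms, symmetric] by (auto; metis fst_conv snd_conv)
  then show ?thesis unfolding sat_def by simp
qed

theorem theorem2p3:
  fixes k m n :: nat
  assumes "k \<ge> 3" and "k \<noteq> 5" and "m \<ge> 10"
    and "n \<ge> (k - 1) * min_sat_tree k m + k - 1"
  shows "1 / (real k - 1) *
           (real n
            - real_of_int \<lfloor>(real n - real k + 2) / ((real k - 1) * real (min_sat_tree k m) + 1)\<rfloor>
            - real k + 2)
         \<le> real (sat k n (path_graph m)) \<and>
         int (sat k n (path_graph m))
         \<le> \<lceil>1 / (real k - 1) *
              (real n
               - real_of_int \<lfloor>real n / ((real k - 1) * real (min_sat_tree k m) + 1)\<rfloor>)\<rceil>"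
proof -
  obtain t where m: "m = Suc t" "t \<ge> 9" using assms(3) by (cases m) auto
  have t0: "t \<noteq> 0" using m by simp
  define a where "a = min_sat_tree k m"
  define A where "A = (k - 1) * a + 1"
  define s where "s = sat k n (path_graph m)"
  note k = assms(1)
  let ?M = "{card E | (V::nat set) E. saturated k t V E \<and> card V = n}"
  have sM: "s = Inf ?M" unfolding s_def m(1) by (rule sat_eq_Inf[OF t0])
  have nA: "n \<ge> A + (k - 2)" using assms(4) k unfolding A_def a_def by linarith
  have A1: "A \<ge> 1" unfolding A_def by simp
  define q where "q = n div A"
  define r where "r = n mod A"
  have q1: "q \<ge> 1" unfolding q_def using nA A1 by (simp add: less_eq_div_iff_mult_less_eq)
  have nq: "n = q * A + r" unfolding q_def r_def by simp
  obtain V :: "nat set" and E where VE: "saturated k t V E" "card V = Suc (q - 1) * ((k - 1) * a + 1) + r"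
    "card E = Suc (q - 1) * a + r div (k - 1) + (if r mod (k - 1) = 0 then 0 else 1)"
    using upper_exists[OF k m(2), of a "q - 1" r] m(1) unfolding a_def by blast
  have Sq: "Suc (q - 1) = q" using q1 by simp
  have cV: "card V = n" using VE(2) unfolding Sq A_def[symmetric] nq .
  have cE: "card E = q * a + r div (k - 1) + (if r mod (k - 1) = 0 then 0 else 1)" using VE(3) unfolding Sq .
  have inM: "card E \<in> ?M" using VE(1) cV by blast
  have up: "s \<le> card E" unfolding sM by (rule cInf_lower[OF inM]) simp
  have "Inf ?M \<in> ?M" by (rule Inf_nat_def1) (use inM in blast)
  then obtain V' :: "nat set" and E' where V': "saturated k t V' E'" "card V' = n" "card E' = s" unfolding sM[symmetric] mem_Collect_eq by metis
  have low: "n \<le> (k - 1) * s + (k - 2) + (n - (k - 2)) div A"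
    using lower_bound[OF k m(2) V'(1)] assms(4) unfolding V'(2,3) A_def a_def m(1) by simp
  have rk: "real (k - 1) = real k - 1" "real (k - 2) = real k - 2" using k by (simp_all add: of_nat_diff)
  have rA: "(real k - 1) * real (min_sat_tree k m) + 1 = real A" unfolding A_def a_def using rk by simp
  have kp: "real k - 1 > 0" using k by simp
  have f1: "\<lfloor>(real n - real k + 2) / real A\<rfloor> = int ((n - (k - 2)) div A)"
  proof -
    have "real n - real k + 2 = real (n - (k - 2))" using nA rk by (simp add: of_nat_diff)
    then show ?thesis by (simp only: floor_divide_of_nat_eq)
  qed
  have f2: "\<lfloor>real n / real A\<rfloor> = int q" unfolding q_def by (simp add: floor_divide_of_nat_eq)
  have "real n \<le> real ((k - 1) * s + (k - 2) + (n - (k - 2)) div A)" using low of_nat_le_iff by blast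
  then have "real n - real ((n - (k - 2)) div A) - real k + 2 \<le> (real k - 1) * real s" using rk by simp
  then have L: "1 / (real k - 1) * (real n - real ((n - (k - 2)) div A) - real k + 2) \<le> real s"
    using kp by (simp add: field_simps)
  have "real (card E) - 1 < 1 / (real k - 1) * (real n - real q)"
  proof -
    define i where "i = r mod (k - 1)"
    define j where "j = r div (k - 1)"
    have r: "r = (k - 1) * j + i" unfolding i_def j_def by (rule mult_div_mod_eq[symmetric])
    have nn: "real n - real q = (real k - 1) * (real q * real a + real j) + real i"
    proof -
      have "real n = real q * ((real k - 1) * real a + 1) + ((real k - 1) * real j + real i)"
        unfolding nq r A_def of_nat_add of_nat_mult of_nat_1 rk(1) by (rule refl)
      then show ?thesis by (simp add: algebra_simps)
    qed
    have "(real k - 1) * (real (card E) - 1) < real n - real q"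
    proof (cases "i = 0")
      case True
      then have "real (card E) = real q * real a + real j" using cE unfolding i_def j_def by simp
      then show ?thesis unfolding nn using True kp by (simp add: algebra_simps)
    next
      case False
      then have "real (card E) - 1 = real q * real a + real j" using cE unfolding i_def j_def by simp
      then show ?thesis unfolding nn using False by simp
    qed
    then show ?thesis using kp by (simp add: field_simps)
  qed
  then have "int (card E) \<le> \<lceil>1 / (real k - 1) * (real n - real q)\<rceil>" by (simp add: le_ceiling_iff)
  then have "int s \<le> \<lceil>1 / (real k - 1) * (real n - real q)\<rceil>" using up by linarith
  then show ?thesis unfolding rA f1 f2 s_def[symmetric] using L by simp
qed

end
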